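(* There is a computable function $f:\mathbb{N}\to\mathbb{N}$ and an algorithm that takes as input a positive integer $d$ and a connected graph $G$ of maximum degree $\Delta$, and determines in time $f(d)\cdot 2^{O(\Delta)}\cdot|G|^{O(1)}$ whether $G$ has a series-parallel supergraph $G'$ of diameter at most $d$.
   Context: Graphs are simple; a supergraph of $G$ contains $G$ as a subgraph and may have additional vertices and edges. $|G|$ is the number of vertices; diameter is the maximum shortest-path distance between two vertices. Series-parallel graphs are in the standard sense (in particular they have treewidth at most $2$). *)

theory Defs
  imports "Graph_Theory.Graph_Theory"
begin

text \<open>
  Finite simple undirected graphs are the library's \<open>pair_graph\<close>s: finite, loop-free,
  symmetric digraphs without parallel arcs, where an undirected edge \<open>uv\<close> is the pair of arcs
  \<open>(u, v)\<close>, \<open>(v, u)\<close>. Hence the degree of a vertex is its out-degree.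
\<close>

definition max_degree :: "'a pair_pre_digraph \<Rightarrow> nat" where
  "max_degree G = Max (out_degree (with_proj G) ` pverts G)"

text \<open>
  The constant \<open>wf_digraph.\<mu>\<close> is the library's weighted shortest-path distance; it is \<open>\<infinity>\<close> for
  vertices in different components, so the diameter of a disconnected graph is \<open>\<infinity>\<close>.
\<close>

definition diameter :: "'a pair_pre_digraph \<Rightarrow> ereal" where
  "diameter G = (SUP u \<in> pverts G. SUP v \<in> pverts G. wf_digraph.\<mu> (with_proj G) (\<lambda>_. 1) u v)"

text \<open>
  Two-terminal series-parallel graphs with terminals \<open>s\<close> and \<open>t\<close>. Compositions identify vertices,
  which is expressed by letting the two parts share exactly the identified vertices. Arc-disjointness
  in \<open>parallel\<close> only excludes parallel edges \<open>st\<close>: no later composition could remove them, so every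
  simple series-parallel graph is obtained through simple graphs.
\<close>

inductive two_terminal_sp :: "'a pair_pre_digraph \<Rightarrow> 'a \<Rightarrow> 'a \<Rightarrow> bool" where
  edge: "s \<noteq> t \<Longrightarrow> two_terminal_sp \<lparr> pverts = {s, t}, parcs = {(s, t), (t, s)} \<rparr> s t"
| series: "\<lbrakk> two_terminal_sp G s m; two_terminal_sp H m t; pverts G \<inter> pverts H = {m} \<rbrakk> \<Longrightarrow>
    two_terminal_sp \<lparr> pverts = pverts G \<union> pverts H, parcs = parcs G \<union> parcs H \<rparr> s t"
| parallel: "\<lbrakk> two_terminal_sp G s t; two_terminal_sp H s t;
    pverts G \<inter> pverts H = {s, t}; parcs G \<inter> parcs H = {} \<rbrakk> \<Longrightarrow>
    two_terminal_sp \<lparr> pverts = pverts G \<union> pverts H, parcs = parcs G \<union> parcs H \<rparr> s t"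

definition series_parallel :: "'a pair_pre_digraph \<Rightarrow> bool" where
  "series_parallel G \<longleftrightarrow> (\<exists>s t. two_terminal_sp G s t)"

definition has_sp_supergraph :: "nat \<Rightarrow> nat pair_pre_digraph \<Rightarrow> bool" where
  "has_sp_supergraph d G \<longleftrightarrow> (\<exists>G' :: nat pair_pre_digraph. pair_graph G' \<and>
     subgraph (with_proj G) (with_proj G') \<and> series_parallel G' \<and> diameter G' \<le> ereal (real d))"

text \<open>
  Model of computation: a structured random access machine over natural numbers with registers, an
  unbounded memory, indirect addressing, and addition and truncated subtraction (but no
  multiplication) at unit cost. In \<open>t\<close> steps the bit length of the numbers grows by at most \<open>t\<close>, so
  this model and Turing machines simulate each other with polynomial overhead; bounds of the form
  \<open>f d * 2 ^ O(\<Delta>) * n ^ O(1)\<close> do not depend on the choice between them.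

  Registers are named by numbers; \<open>Load x y\<close> is \<open>x := memory[y]\<close>, \<open>Store x y\<close> is
  \<open>memory[x] := y\<close>, and \<open>Cond\<close> and \<open>While\<close> test whether a register is nonzero.
\<close>

datatype program =
    Skip
  | Const nat nat
  | Add nat nat nat
  | Sub nat nat nat
  | Load nat nat
  | Store nat nat
  | Seq program program
  | Cond nat program program
  | While nat program

type_synonym state = "(nat \<Rightarrow> nat) \<times> (nat \<Rightarrow> nat)"

text \<open>\<open>exec p \<sigma> k \<sigma>'\<close>: started in \<open>\<sigma>\<close>, \<open>p\<close> halts in \<open>\<sigma>'\<close> after \<open>k\<close> steps.\<close>

inductive exec :: "program \<Rightarrow> state \<Rightarrow> nat \<Rightarrow> state \<Rightarrow> bool" where
  "exec Skip \<sigma> 1 \<sigma>"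
| "exec (Const x c) (r, m) 1 (r(x := c), m)"
| "exec (Add x y z) (r, m) 1 (r(x := r y + r z), m)"
| "exec (Sub x y z) (r, m) 1 (r(x := r y - r z), m)"
| "exec (Load x y) (r, m) 1 (r(x := m (r y)), m)"
| "exec (Store x y) (r, m) 1 (r, m(r x := r y))"
| "\<lbrakk> exec p \<sigma> k \<sigma>'; exec q \<sigma>' l \<sigma>'' \<rbrakk> \<Longrightarrow> exec (Seq p q) \<sigma> (k + l) \<sigma>''"
| "\<lbrakk> fst \<sigma> x \<noteq> 0; exec p \<sigma> k \<sigma>' \<rbrakk> \<Longrightarrow> exec (Cond x p q) \<sigma> (1 + k) \<sigma>'"
| "\<lbrakk> fst \<sigma> x = 0; exec q \<sigma> k \<sigma>' \<rbrakk> \<Longrightarrow> exec (Cond x p q) \<sigma> (1 + k) \<sigma>'"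
| "fst \<sigma> x = 0 \<Longrightarrow> exec (While x p) \<sigma> 1 \<sigma>"
| "\<lbrakk> fst \<sigma> x \<noteq> 0; exec p \<sigma> k \<sigma>'; exec (While x p) \<sigma>' l \<sigma>'' \<rbrakk> \<Longrightarrow>
    exec (While x p) \<sigma> (1 + k + l) \<sigma>''"

inductive_cases exec_elims:
  "exec Skip \<sigma> k \<sigma>'" "exec (Const x c) \<sigma> k \<sigma>'" "exec (Add x y z) \<sigma> k \<sigma>'"
  "exec (Sub x y z) \<sigma> k \<sigma>'" "exec (Load x y) \<sigma> k \<sigma>'" "exec (Store x y) \<sigma> k \<sigma>'"
  "exec (Seq p q) \<sigma> k \<sigma>'" "exec (Cond x p q) \<sigma> k \<sigma>'"

inductive_cases exec_WhileE: "exec (While x p) \<sigma> k \<sigma>'"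

lemma exec_deterministic:
  "exec p \<sigma> k \<sigma>' \<Longrightarrow> exec p \<sigma> l \<sigma>'' \<Longrightarrow> l = k \<and> \<sigma>'' = \<sigma>'"
proof (induction arbitrary: l \<sigma>'' rule: exec.induct)
  case (7 p \<sigma> k \<sigma>' q m \<tau>)
  from "7.prems" show ?case
  proof (rule exec_elims(7))
    fix k' \<rho> m'
    assume *: "l = k' + m'" "exec p \<sigma> k' \<rho>" "exec q \<rho> m' \<sigma>''"
    have 1: "k' = k \<and> \<rho> = \<sigma>'" by (rule "7.IH"(1)[OF *(2)])
    have "m' = m \<and> \<sigma>'' = \<tau>" by (rule "7.IH"(2)) (use 1 *(3) in \<open>simp only:\<close>)
    with 1 *(1) show ?thesis by (simp only:)
  qed
next
  case (8 \<sigma> x p k \<sigma>' q)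
  from "8.prems" show ?case
  proof (rule exec_elims(8))
    fix k' assume *: "l = Suc k'" "exec p \<sigma> k' \<sigma>''"
    from "8.IH"[OF *(2)] *(1) show ?thesis by (simp only: plus_1_eq_Suc)
  qed (use "8.hyps"(1) in \<open>simp only:\<close>)
next
  case (9 \<sigma> x q k \<sigma>' p)
  from "9.prems" show ?case
  proof (rule exec_elims(8))
    fix k' assume *: "l = Suc k'" "exec q \<sigma> k' \<sigma>''"
    from "9.IH"[OF *(2)] *(1) show ?thesis by (simp only: plus_1_eq_Suc)
  qed (use "9.hyps"(1) in simp)
next
  case (10 \<sigma> x p)
  from "10.prems" show ?case
    by (rule exec_WhileE) (use "10.hyps" in simp_all)
next
  case (11 \<sigma> x p k \<sigma>' m \<tau>)
  from "11.prems" show ?case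
  proof (rule exec_WhileE)
    fix k' \<rho> m'
    assume *: "l = Suc (k' + m')" "exec p \<sigma> k' \<rho>" "exec (While x p) \<rho> m' \<sigma>''"
    have 1: "k' = k \<and> \<rho> = \<sigma>'" by (rule "11.IH"(1)[OF *(2)])
    have "m' = m \<and> \<sigma>'' = \<tau>" by (rule "11.IH"(2)) (use 1 *(3) in \<open>simp only:\<close>)
    with 1 *(1) show ?thesis by (simp only: plus_1_eq_Suc add_Suc)
  qed (use "11.hyps"(1) in \<open>simp only:\<close>)
qed (erule exec_elims, simp add: One_nat_def)+

definition initial_state :: "nat list \<Rightarrow> state" where
  "initial_state xs = ((\<lambda>_. 0), (\<lambda>i. if i < length xs then xs ! i else 0))"

text \<open>On input \<open>xs\<close> (written to memory), \<open>p\<close> halts after \<open>k\<close> steps with output \<open>y\<close> (register 0).\<close>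

definition runs :: "program \<Rightarrow> nat list \<Rightarrow> nat \<Rightarrow> nat \<Rightarrow> bool" where
  "runs p xs k y \<longleftrightarrow> (\<exists>\<sigma>. exec p (initial_state xs) k \<sigma> \<and> fst \<sigma> 0 = y)"

definition computable :: "(nat \<Rightarrow> nat) \<Rightarrow> bool" where
  "computable f \<longleftrightarrow> (\<exists>p. \<forall>n. \<exists>k. runs p [n] k (f n))"

text \<open>
  The input consists of \<open>d\<close>, the number of vertices, and the adjacency matrix of \<open>G\<close>, row by row,
  with respect to an enumeration \<open>vs\<close> of its vertices.
\<close>

definition encode :: "nat \<Rightarrow> 'a list \<Rightarrow> 'a pair_pre_digraph \<Rightarrow> nat list" where
  "encode d vs G = d # length vs # [if (u, v) \<in> parcs G then 1 else 0. u \<leftarrow> vs, v \<leftarrow> vs]"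

end

theory Submission
  imports Defs
begin

text \<open>
  A series-parallel supergraph is built from two-terminal parts. How a part interacts
  with the rest is determined by the distances of its vertices to the terminals and the length of an
  outer path between the terminals. Capped at \<open>d + 1\<close>, this information takes a number of values
  that depends only on \<open>d\<close>. The vertices of \<open>G\<close> inside a part form a union of components of \<open>G\<close> minus
  the terminals, and as \<open>G\<close> is connected, there are only \<open>2 ^ O(\<Delta>)\<close> such unions for given terminals.
  A saturation over all these summaries of parts decides the problem.

  The machine program is compiled from a language whose loops have bounds in registers that the
  loop does not change. Thus the running time is polynomial in the largest of these bounds, and an
  upper bound on the number of summaries, computed beforehand, serves as the bound for the saturation.
\<close>

section \<open>Distances\<close>

text \<open>The diameter of a part cannot be judged in isolation, since two of its vertices may be
  close only by way of the rest of the graph. The promise \<open>D\<close> removes this obstacle: a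
  part is judged under an assumed outer distance, and a composition admits two parts only if it
  makes their promises true. Up to the cap, distances to the terminals then suffice for pairs of
  vertices from different parts, while pairs inside a part never have to be looked at again. The
  number of new vertices is not limited, and a summary does not tell them apart. Completeness is
  therefore an induction over the construction of a graph, whereas soundness has to rebuild a graph
  from a derivation and to keep its new vertices distinct. An arc of the input is checked when one
  of its ends stops being a terminal, because no later composition can supply it, or at the very end
  if it joins the last two terminals. A set \<open>P\<close> of pairs has
  \<open>2 ^ ((d + 2) ^ 2)\<close> possible values, so the factor depending on \<open>d\<close> is
  \<open>2 ^ O(d ^ 2)\<close>.\<close>

definition dst :: "('a \<times> 'a) set \<Rightarrow> 'a \<Rightarrow> 'a \<Rightarrow> nat" where
  "dst E x y = (LEAST k. (x, y) \<in> E ^^ k)"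

definition conn_graph :: "'a set \<Rightarrow> ('a \<times> 'a) set \<Rightarrow> bool" where
  "conn_graph V E \<longleftrightarrow> E \<subseteq> V \<times> V \<and> sym E \<and> (\<forall>x\<in>V. \<forall>y\<in>V. (x, y) \<in> E\<^sup>*)"

lemma dst_le: "(x, y) \<in> E ^^ k \<Longrightarrow> dst E x y \<le> k"
  unfolding dst_def by (rule Least_le)

text \<open>Reachability makes the set of walk lengths nonempty, so that \<open>LEAST\<close> is
  attained. On unreachable pairs \<open>dst\<close> is an arbitrary number, hence the reachability
  hypotheses here and below.\<close>

lemma dst_walk: "(x, y) \<in> E\<^sup>* \<Longrightarrow> (x, y) \<in> E ^^ dst E x y"
  unfolding dst_def by (metis LeastI rtrancl_power)

lemma dst_refl [simp]: "dst E x x = 0"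
  using dst_le[of x x 0 E] by simp

lemma dst_tri:
  assumes "(x, y) \<in> E\<^sup>*" "(y, z) \<in> E\<^sup>*"
  shows "dst E x z \<le> dst E x y + dst E y z"
  by (rule dst_le) (use dst_walk[OF assms(1)] dst_walk[OF assms(2)] in \<open>auto simp: relpow_add\<close>)

lemma dst_arc: "(x, y) \<in> E \<Longrightarrow> dst E x y \<le> 1"
  using dst_le[of x y 1 E] by simp

lemma dst_sym: "sym E \<Longrightarrow> dst E x y = dst E y x"
proof -
  assume E: "sym E"
  have "(y, x) \<in> E ^^ k" if "(x, y) \<in> E ^^ k" for x y k
    using that
  proof (induction k arbitrary: y)
    case (Suc k)
    then obtain z where "(x, z) \<in> E ^^ k" "(z, y) \<in> E" by auto
    with Suc.IH symD[OF E] show ?case by (blast intro: relpow_Suc_I2)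
  qed auto
  then have "(x, y) \<in> E ^^ k \<longleftrightarrow> (y, x) \<in> E ^^ k" for k by blast
  then show ?thesis by (simp add: dst_def)
qed

text \<open>Lower bounds on distances come from potentials: a function that vanishes at
  \<open>x\<close> and grows by at most one along every arc stays below the distance from
  \<open>x\<close>. In the gluing lemmas the claimed distance formula itself is the potential, so no
  path has to be cut into pieces.\<close>

lemma dst_ge:
  fixes g :: "'a \<Rightarrow> nat"
  assumes "(x, y) \<in> E\<^sup>*" "g x = 0" "\<And>u v. (u, v) \<in> E \<Longrightarrow> g v \<le> g u + 1"
  shows "g y \<le> dst E x y"
proof -
  have "g z \<le> k" if "(x, z) \<in> E ^^ k" for k z
    using that
  proof (induction k arbitrary: z)
    case (Suc k)
    then obtain u where "(x, u) \<in> E ^^ k" "(u, z) \<in> E" by auto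
    with Suc.IH[of u] assms(3)[of u z] show ?case by simp
  qed (use assms(2) in auto)
  then show ?thesis using dst_walk[OF assms(1)] by blast
qed

lemma dst_mono:
  assumes "(x, y) \<in> E\<^sup>*" "E \<subseteq> E'"
  shows "dst E' x y \<le> dst E x y"
proof -
  have "E ^^ k \<subseteq> E' ^^ k" for k using assms(2) by (induction k) auto
  then show ?thesis using dst_walk[OF assms(1)] by (intro dst_le) blast
qed

context
  fixes V :: "'a set" and E
  assumes cg: "conn_graph V E"
begin

lemma cg_sym: "dst E x y = dst E y x"
  using cg by (intro dst_sym) (simp add: conn_graph_def)

lemma cg_tri: "x \<in> V \<Longrightarrow> y \<in> V \<Longrightarrow> z \<in> V \<Longrightarrow> dst E x z \<le> dst E x y + dst E y z"
  using cg by (intro dst_tri) (auto simp: conn_graph_def)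

lemma cg_step: "x \<in> V \<Longrightarrow> (y, z) \<in> E \<Longrightarrow> dst E x z \<le> dst E x y + 1"
  using cg_tri[of x y z] dst_arc[of y z E] cg by (fastforce simp: conn_graph_def)

lemma cg_mono: "x \<in> V \<Longrightarrow> y \<in> V \<Longrightarrow> dst (E \<union> E') x y \<le> dst E x y"
  using cg by (intro dst_mono) (auto simp: conn_graph_def)

lemma cg_arcD: "(x, y) \<in> E \<Longrightarrow> x \<in> V \<and> y \<in> V"
  using cg by (auto simp: conn_graph_def)

lemma cg_ge:
  fixes g :: "'a \<Rightarrow> nat"
  assumes "x \<in> V" "y \<in> V" "g x = 0" "\<And>u v. (u, v) \<in> E \<Longrightarrow> g v \<le> g u + 1"
  shows "g y \<le> dst E x y"
  using cg assms by (intro dst_ge) (auto simp: conn_graph_def)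

text \<open>Adjacency is distance one, so the entry \<open>e\<close> of a summary also tells whether
  a part has an arc between its terminals.\<close>

lemma cg_dst_1: "x \<in> V \<Longrightarrow> y \<in> V \<Longrightarrow> x \<noteq> y \<Longrightarrow> dst E x y = 1 \<longleftrightarrow> (x, y) \<in> E"
proof
  assume "x \<in> V" "y \<in> V" "x \<noteq> y" "dst E x y = 1"
  then show "(x, y) \<in> E" using dst_walk[of x y E] cg by (auto simp: conn_graph_def)
next
  assume xy: "x \<in> V" "y \<in> V" "x \<noteq> y" "(x, y) \<in> E"
  have "dst E x y \<noteq> 0"
  proof
    assume "dst E x y = 0"
    with dst_walk[of x y E] xy(3,4) show False by auto
  qed
  then show "dst E x y = 1" using dst_arc[OF xy(4)] by simp
qed

end

section \<open>Distances in two graphs glued at one or two vertices\<close>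

lemma conn_graph_Un:
  assumes "conn_graph V1 E1" "conn_graph V2 E2" "m \<in> V1" "m \<in> V2"
  shows "conn_graph (V1 \<union> V2) (E1 \<union> E2)"
proof -
  have m: "E1\<^sup>* \<subseteq> (E1 \<union> E2)\<^sup>*" "E2\<^sup>* \<subseteq> (E1 \<union> E2)\<^sup>*" by (auto intro!: rtrancl_mono)
  have "(x, m) \<in> (E1 \<union> E2)\<^sup>* \<and> (m, x) \<in> (E1 \<union> E2)\<^sup>*" if "x \<in> V1 \<union> V2" for x
    using that assms m unfolding conn_graph_def by blast
  then have "(x, y) \<in> (E1 \<union> E2)\<^sup>*" if "x \<in> V1 \<union> V2" "y \<in> V1 \<union> V2" for x y
    using that by (meson rtrancl_trans)
  then show ?thesis using assms unfolding conn_graph_def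
    by (auto intro: symI dest: symD)
qed

text \<open>\<open>m\<close> is a cut vertex of the union: a path between the parts passes through
  it, and a detour into the other part has to come back to it.\<close>

lemma dst_series:
  assumes "conn_graph V1 E1" "conn_graph V2 E2" "V1 \<inter> V2 = {m}" "x \<in> V1"
  shows "y \<in> V1 \<Longrightarrow> dst (E1 \<union> E2) x y = dst E1 x y"
    and "y \<in> V2 \<Longrightarrow> dst (E1 \<union> E2) x y = dst E1 x m + dst E2 m y"
proof -
  have m: "m \<in> V1" "m \<in> V2" using assms(3) by auto
  note cg = conn_graph_Un[OF assms(1,2) m]
  \<comment> \<open>The candidate for the distance from \<open>x\<close>. As \<open>m\<close> is the
    only common vertex, the second branch is valid on all of \<open>V2\<close>, which lets the arcs
    of both parts be treated alike.\<close>
  define g where "g z = (if z \<in> V1 then dst E1 x z else dst E1 x m + dst E2 m z)" for z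
  have g2: "g z = dst E1 x m + dst E2 m z" if "z \<in> V2" for z
    using that assms(3) by (cases "z = m") (auto simp: g_def)
  have ge: "g y \<le> dst (E1 \<union> E2) x y" if "y \<in> V1 \<union> V2" for y
  proof (rule cg_ge[OF cg])
    fix u v assume "(u, v) \<in> E1 \<union> E2"
    then show "g v \<le> g u + 1"
    proof
      assume "(u, v) \<in> E1"
      then show ?thesis using cg_step[OF assms(1,4)] cg_arcD[OF assms(1)] by (auto simp: g_def)
    next
      assume "(u, v) \<in> E2"
      then show ?thesis using cg_step[OF assms(2) m(2)] cg_arcD[OF assms(2)] by (auto simp: g2)
    qed
  qed (use that assms(4) in \<open>auto simp: g_def\<close>)
  show "dst (E1 \<union> E2) x y = dst E1 x y" if "y \<in> V1"
    using ge[of y] cg_mono[OF assms(1,4) that] that by (auto simp: g_def intro: antisym)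
  show "dst (E1 \<union> E2) x y = dst E1 x m + dst E2 m y" if "y \<in> V2"
  proof (rule antisym)
    have "dst (E2 \<union> E1) m y \<le> dst E2 m y" by (rule cg_mono[OF assms(2) m(2) that])
    then show "dst (E1 \<union> E2) x y \<le> dst E1 x m + dst E2 m y"
      using cg_tri[OF cg, of x m y] cg_mono[OF assms(1,4) m(1), of E2] that m assms(4)
      by (simp add: Un_commute)
  qed (use ge[of y] g2 that in simp)
qed

text \<open>A walk that leaves \<open>V1\<close> usefully does so through one terminal and comes
  back through the other, crossing the second part at the cost \<open>dst E2 s t\<close>.\<close>

lemma dst_parallel:
  assumes "conn_graph V1 E1" "conn_graph V2 E2" "V1 \<inter> V2 = {s, t}" "x \<in> V1"
  shows "y \<in> V1 \<Longrightarrow> dst (E1 \<union> E2) x y =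
      min (dst E1 x y) (min (dst E1 x s + dst E2 s t + dst E1 t y) (dst E1 x t + dst E2 s t + dst E1 s y))"
    and "y \<in> V2 \<Longrightarrow> dst (E1 \<union> E2) x y = min (dst E1 x s + dst E2 s y) (dst E1 x t + dst E2 t y)"
proof -
  have st: "s \<in> V1" "s \<in> V2" "t \<in> V1" "t \<in> V2" using assms(3) by auto
  note cg = conn_graph_Un[OF assms(1,2) st(1,2)]
  let ?f = "\<lambda>z. min (dst E1 x z) (min (dst E1 x s + dst E2 s t + dst E1 t z) (dst E1 x t + dst E2 s t + dst E1 s z))"
  let ?h = "\<lambda>z. min (dst E1 x s + dst E2 s z) (dst E1 x t + dst E2 t z)"
  define g where "g z = (if z \<in> V1 then ?f z else ?h z)" for z
  \<comment> \<open>The two formulas overlap on the terminals and must agree there for the potential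
    to be consistent on arcs of both parts; this rests on the symmetry of distances in
    \<open>E2\<close>.\<close>
  have fh: "?f z = ?h z" if "z \<in> {s, t}" for z
    using that cg_sym[OF assms(2), of s t] by auto
  have g2: "g z = ?h z" if "z \<in> V2" for z
    using that fh[of z] assms(3) by (cases "z \<in> V1") (auto simp: g_def)
  have ge: "g y \<le> dst (E1 \<union> E2) x y" if "y \<in> V1 \<union> V2" for y
  proof (rule cg_ge[OF cg])
    fix u v assume "(u, v) \<in> E1 \<union> E2"
    then show "g v \<le> g u + 1"
    proof
      assume a: "(u, v) \<in> E1"
      then show ?thesis
        using cg_step[OF assms(1,4) a] cg_step[OF assms(1) st(1) a] cg_step[OF assms(1) st(3) a]
          cg_arcD[OF assms(1) a] by (auto simp: g_def)
    next
      assume a: "(u, v) \<in> E2"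
      then show ?thesis
        using cg_step[OF assms(2) st(2) a] cg_step[OF assms(2) st(4) a] cg_arcD[OF assms(2) a]
        by (auto simp: g2)
    qed
  qed (use that assms(4) in \<open>auto simp: g_def\<close>)
  have u1: "dst (E1 \<union> E2) a b \<le> dst E1 a b" if "a \<in> V1" "b \<in> V1" for a b
    by (rule cg_mono[OF assms(1) that])
  have u2: "dst (E1 \<union> E2) a b \<le> dst E2 a b" if "a \<in> V2" "b \<in> V2" for a b
    using cg_mono[OF assms(2) that, of E1] by (simp add: Un_commute)
  note tri = cg_tri[OF cg]
  show "dst (E1 \<union> E2) x y = ?f y" if y: "y \<in> V1"
  proof (rule antisym)
    have "dst (E1 \<union> E2) x y \<le> dst E1 x s + dst E2 s t + dst E1 t y"
      using tri[of x s y] tri[of s t y] u1[OF assms(4) st(1)] u2[OF st(2,4)] u1[OF st(3) y] y assms(4) st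
      by simp
    moreover have "dst (E1 \<union> E2) x y \<le> dst E1 x t + dst E2 s t + dst E1 s y"
      using tri[of x t y] tri[of t s y] u1[OF assms(4) st(3)] u2[OF st(4,2)] u1[OF st(1) y] y assms(4) st
        cg_sym[OF assms(2), of s t] by simp
    ultimately show "dst (E1 \<union> E2) x y \<le> ?f y" using u1[OF assms(4) y] by simp
  qed (use ge[of y] y in \<open>simp add: g_def\<close>)
  show "dst (E1 \<union> E2) x y = ?h y" if y: "y \<in> V2"
  proof (rule antisym)
    show "dst (E1 \<union> E2) x y \<le> ?h y"
      using tri[of x s y] tri[of x t y] u1[OF assms(4) st(1)] u1[OF assms(4) st(3)] u2[OF st(2) y]
        u2[OF st(4) y] y assms(4) st by simp
  qed (use ge[of y] y g2 in simp)
qed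

text \<open>The diameter is at most \<open>d\<close> on \<open>V\<close> once an outer path of length \<open>D\<close> joins \<open>s\<close> and \<open>t\<close>.\<close>

definition diam_ok :: "nat \<Rightarrow> 'a set \<Rightarrow> ('a \<times> 'a) set \<Rightarrow> 'a \<Rightarrow> 'a \<Rightarrow> nat \<Rightarrow> bool" where
  "diam_ok d V E s t D \<longleftrightarrow> (\<forall>x\<in>V. \<forall>y\<in>V. dst E x y \<le> d \<or>
     dst E x s + D + dst E y t \<le> d \<or> dst E x t + D + dst E y s \<le> d)"

text \<open>Seen from the first part, the outer path continues through the second one and has length
  \<open>D + dst E2 m t\<close>, and likewise with the roles exchanged. A pair from different parts
  has only two routes: through \<open>m\<close>, or around through \<open>s\<close> and
  \<open>t\<close>.\<close>

lemma diam_ok_series: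
  assumes "conn_graph V1 E1" "conn_graph V2 E2" "V1 \<inter> V2 = {m}" "s \<in> V1" "t \<in> V2"
  shows "diam_ok d (V1 \<union> V2) (E1 \<union> E2) s t D \<longleftrightarrow>
    diam_ok d V1 E1 s m (D + dst E2 m t) \<and> diam_ok d V2 E2 m t (D + dst E1 s m) \<and>
    (\<forall>x\<in>V1. \<forall>y\<in>V2. dst E1 x m + dst E2 y m \<le> d \<or> dst E1 x s + D + dst E2 y t \<le> d)"
    (is "?L \<longleftrightarrow> ?A \<and> ?B \<and> ?C")
proof -
  let ?E = "E1 \<union> E2"
  let ?P = "\<lambda>x y. dst ?E x y \<le> d \<or> dst ?E x s + D + dst ?E y t \<le> d \<or> dst ?E x t + D + dst ?E y s \<le> d"
  have m: "m \<in> V1" "m \<in> V2" using assms(3) by auto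
  note s1 = cg_sym[OF assms(1)] and s2 = cg_sym[OF assms(2)]
  have i: "V2 \<inter> V1 = {m}" using assms(3) by auto
  note d1 = dst_series[OF assms(1,2,3)]
  note d2 = dst_series[OF assms(2,1) i, unfolded Un_commute[of E2 E1]]
  have 11: "?P x y \<longleftrightarrow> dst E1 x y \<le> d \<or> dst E1 x s + (D + dst E2 m t) + dst E1 y m \<le> d \<or>
     dst E1 x m + (D + dst E2 m t) + dst E1 y s \<le> d" if "x \<in> V1" "y \<in> V1" for x y
    using that assms by (auto simp: d1 algebra_simps)
  have 22: "?P x y \<longleftrightarrow> dst E2 x y \<le> d \<or> dst E2 x m + (D + dst E1 s m) + dst E2 y t \<le> d \<or>
     dst E2 x t + (D + dst E1 s m) + dst E2 y m \<le> d" if "x \<in> V2" "y \<in> V2" for x y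
    using that assms s1[of s m] by (auto simp: d2 algebra_simps)
  have 12: "?P x y \<longleftrightarrow> dst E1 x m + dst E2 y m \<le> d \<or> dst E1 x s + D + dst E2 y t \<le> d"
    if "x \<in> V1" "y \<in> V2" for x y
    using that assms s2[of m y] by (auto simp: d1 d2)
  have sy: "?P x y \<longleftrightarrow> ?P y x" for x y
    using cg_sym[OF conn_graph_Un[OF assms(1,2) m], of x y] by (auto simp: algebra_simps)
  have "?L \<longleftrightarrow> (\<forall>x\<in>V1 \<union> V2. \<forall>y\<in>V1 \<union> V2. ?P x y)" by (simp add: diam_ok_def)
  also have "\<dots> \<longleftrightarrow> (\<forall>x\<in>V1. \<forall>y\<in>V1. ?P x y) \<and> (\<forall>x\<in>V2. \<forall>y\<in>V2. ?P x y) \<and> (\<forall>x\<in>V1. \<forall>y\<in>V2. ?P x y)"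
    using sy by blast
  also have "(\<forall>x\<in>V1. \<forall>y\<in>V1. ?P x y) \<longleftrightarrow> ?A" unfolding diam_ok_def using 11 by blast
  also have "(\<forall>x\<in>V2. \<forall>y\<in>V2. ?P x y) \<longleftrightarrow> ?B" unfolding diam_ok_def using 22 by blast
  also have "(\<forall>x\<in>V1. \<forall>y\<in>V2. ?P x y) \<longleftrightarrow> ?C" using 12 by blast
  finally show ?thesis .
qed

text \<open>Expanding the minima also yields routes that use both the other part and the outer path.
  They are dominated: \<open>xs + D + ys + e\<close> leaves and returns through the same terminal
  and is at least \<open>xy\<close>, and \<open>xt + e + D + ys + e\<close> is at least
  \<open>xt + e + ys\<close>.\<close>

lemma parallel_arith:
  fixes xy xs xt ys yt e D d :: nat
  assumes "xy \<le> xs + ys" "xy \<le> xt + yt"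
  shows "min xy (min (xs + e + yt) (xt + e + ys)) \<le> d \<or> min xs (xt + e) + D + min yt (ys + e) \<le> d \<or>
      min xt (xs + e) + D + min ys (yt + e) \<le> d \<longleftrightarrow>
    xy \<le> d \<or> xs + min D e + yt \<le> d \<or> xt + min D e + ys \<le> d"
  using assms by (auto simp: min_add_distrib_left min_add_distrib_right min_le_iff_disj)

text \<open>Again the mixed routes are dominated: \<open>xs + D + ys + e1\<close>, for instance, is
  at least \<open>xs + ys\<close>, and a route that crosses both parts and the outer path only
  lengthens one already listed.\<close>

lemma parallel_cross_arith:
  fixes xs xt ys yt e1 e2 D d :: nat
  assumes "xt \<le> xs + e1" "xs \<le> xt + e1" "yt \<le> ys + e2" "ys \<le> yt + e2"
  shows "min (xs + ys) (xt + yt) \<le> d \<or> min xs (xt + e2) + D + min yt (ys + e1) \<le> d \<or>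
      min xt (xs + e2) + D + min ys (yt + e1) \<le> d \<longleftrightarrow>
    xs + ys \<le> d \<or> xt + yt \<le> d \<or> xs + D + yt \<le> d \<or> xt + D + ys \<le> d"
  using assms by (auto simp: min_add_distrib_left min_add_distrib_right min_le_iff_disj)

text \<open>For each part, the other part is a second outer path, and the shorter of the two counts;
  hence the minima. A pair from different parts has four routes: through \<open>s\<close>, through
  \<open>t\<close>, or over the outer path in either direction.\<close>

lemma diam_ok_parallel:
  assumes "conn_graph V1 E1" "conn_graph V2 E2" "V1 \<inter> V2 = {s, t}"
  shows "diam_ok d (V1 \<union> V2) (E1 \<union> E2) s t D \<longleftrightarrow>
    diam_ok d V1 E1 s t (min D (dst E2 s t)) \<and> diam_ok d V2 E2 s t (min D (dst E1 s t)) \<and>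
    (\<forall>x\<in>V1. \<forall>y\<in>V2. dst E1 x s + dst E2 y s \<le> d \<or> dst E1 x t + dst E2 y t \<le> d \<or>
       dst E1 x s + D + dst E2 y t \<le> d \<or> dst E1 x t + D + dst E2 y s \<le> d)"
    (is "?L \<longleftrightarrow> ?A \<and> ?B \<and> ?C")
proof -
  let ?E = "E1 \<union> E2"
  let ?P = "\<lambda>x y. dst ?E x y \<le> d \<or> dst ?E x s + D + dst ?E y t \<le> d \<or> dst ?E x t + D + dst ?E y s \<le> d"
  have st: "s \<in> V1" "s \<in> V2" "t \<in> V1" "t \<in> V2" using assms(3) by auto
  note cg = conn_graph_Un[OF assms(1,2) st(1,2)]
  note s1 = cg_sym[OF assms(1)] and s2 = cg_sym[OF assms(2)]
  have i: "V2 \<inter> V1 = {s, t}" using assms(3) by auto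
  note d1 = dst_parallel[OF assms(1,2,3)]
  note d2 = dst_parallel[OF assms(2,1) i, unfolded Un_commute[of E2 E1]]
  have 11: "?P x y \<longleftrightarrow> dst E1 x y \<le> d \<or> dst E1 x s + min D (dst E2 s t) + dst E1 y t \<le> d \<or>
     dst E1 x t + min D (dst E2 s t) + dst E1 y s \<le> d" if x: "x \<in> V1" and y: "y \<in> V1" for x y
  proof -
    have *: "dst ?E z s = min (dst E1 z s) (dst E1 z t + dst E2 s t)"
      "dst ?E z t = min (dst E1 z t) (dst E1 z s + dst E2 s t)" if "z \<in> V1" for z
      using d1(1)[OF that st(1)] d1(1)[OF that st(3)] by (auto simp: min_def)
    have "dst E1 x y \<le> dst E1 x s + dst E1 y s" "dst E1 x y \<le> dst E1 x t + dst E1 y t"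
      using cg_tri[OF assms(1), of x s y] cg_tri[OF assms(1), of x t y] x y st
      by (simp_all add: s1[of s y] s1[of t y])
    then show ?thesis unfolding *[OF x] *[OF y] d1(1)[OF x y] s1[of t y] s1[of s y] by (rule parallel_arith)
  qed
  have 22: "?P x y \<longleftrightarrow> dst E2 x y \<le> d \<or> dst E2 x s + min D (dst E1 s t) + dst E2 y t \<le> d \<or>
     dst E2 x t + min D (dst E1 s t) + dst E2 y s \<le> d" if x: "x \<in> V2" and y: "y \<in> V2" for x y
  proof -
    have *: "dst ?E z s = min (dst E2 z s) (dst E2 z t + dst E1 s t)"
      "dst ?E z t = min (dst E2 z t) (dst E2 z s + dst E1 s t)" if "z \<in> V2" for z
      using d2(1)[OF that st(2)] d2(1)[OF that st(4)] by (auto simp: min_def)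
    have "dst E2 x y \<le> dst E2 x s + dst E2 y s" "dst E2 x y \<le> dst E2 x t + dst E2 y t"
      using cg_tri[OF assms(2), of x s y] cg_tri[OF assms(2), of x t y] x y st
      by (simp_all add: s2[of s y] s2[of t y])
    then show ?thesis unfolding *[OF x] *[OF y] d2(1)[OF x y] s2[of t y] s2[of s y] by (rule parallel_arith)
  qed
  have 12: "?P x y \<longleftrightarrow> dst E1 x s + dst E2 y s \<le> d \<or> dst E1 x t + dst E2 y t \<le> d \<or>
       dst E1 x s + D + dst E2 y t \<le> d \<or> dst E1 x t + D + dst E2 y s \<le> d"
    if x: "x \<in> V1" and y: "y \<in> V2" for x y
  proof -
    have *: "dst ?E x s = min (dst E1 x s) (dst E1 x t + dst E2 s t)"
      "dst ?E x t = min (dst E1 x t) (dst E1 x s + dst E2 s t)"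
      "dst ?E y s = min (dst E2 y s) (dst E2 y t + dst E1 s t)"
      "dst ?E y t = min (dst E2 y t) (dst E2 y s + dst E1 s t)"
      using d1(1)[OF x st(1)] d1(1)[OF x st(3)] d2(1)[OF y st(2)] d2(1)[OF y st(4)]
      by (auto simp: min_def)
    have "dst E1 x t \<le> dst E1 x s + dst E1 s t" "dst E1 x s \<le> dst E1 x t + dst E1 s t"
      "dst E2 y t \<le> dst E2 y s + dst E2 s t" "dst E2 y s \<le> dst E2 y t + dst E2 s t"
      using cg_tri[OF assms(1), of x s t] cg_tri[OF assms(1), of x t s]
        cg_tri[OF assms(2), of y s t] cg_tri[OF assms(2), of y t s] x y st
      by (simp_all add: s1[of t s] s2[of t s])
    then show ?thesis unfolding * d1(2)[OF x y] s2[of s y] s2[of t y] by (rule parallel_cross_arith)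
  qed
  have sy: "?P x y \<longleftrightarrow> ?P y x" for x y
    using cg_sym[OF cg, of x y] by (auto simp: algebra_simps)
  have "?L \<longleftrightarrow> (\<forall>x\<in>V1 \<union> V2. \<forall>y\<in>V1 \<union> V2. ?P x y)" by (simp add: diam_ok_def)
  also have "\<dots> \<longleftrightarrow> (\<forall>x\<in>V1. \<forall>y\<in>V1. ?P x y) \<and> (\<forall>x\<in>V2. \<forall>y\<in>V2. ?P x y) \<and> (\<forall>x\<in>V1. \<forall>y\<in>V2. ?P x y)"
    using sy by blast
  also have "(\<forall>x\<in>V1. \<forall>y\<in>V1. ?P x y) \<longleftrightarrow> ?A" unfolding diam_ok_def using 11 by blast
  also have "(\<forall>x\<in>V2. \<forall>y\<in>V2. ?P x y) \<longleftrightarrow> ?B" unfolding diam_ok_def using 22 by blast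
  also have "(\<forall>x\<in>V1. \<forall>y\<in>V2. ?P x y) \<longleftrightarrow> ?C" using 12 by blast
  finally show ?thesis .
qed

section \<open>Series-parallel graphs\<close>

lemma two_terminal_sp_graph:
  assumes "two_terminal_sp H s t"
  shows "finite (pverts H) \<and> s \<in> pverts H \<and> t \<in> pverts H \<and> s \<noteq> t \<and>
    conn_graph (pverts H) (parcs H) \<and> (\<forall>(u, v)\<in>parcs H. u \<noteq> v)"
  using assms
proof induction
  case (edge s t)
  have "sym {(s, t), (t, s)}" by (auto intro: symI)
  then show ?case using edge by (auto simp: conn_graph_def)
next
  case (series G s m H t)
  then have "s \<noteq> t" "m \<in> pverts G" "m \<in> pverts H" by blast+
  with series.IH show ?case
    using conn_graph_Un[of "pverts G" "parcs G" "pverts H" "parcs H" m] by auto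
next
  case (parallel G s t H)
  then show ?case
    using conn_graph_Un[of "pverts G" "parcs G" "pverts H" "parcs H" s] by auto
qed

lemma two_terminal_sp_pair_graph:
  assumes "two_terminal_sp H s t"
  shows "pair_graph H"
proof -
  note * = two_terminal_sp_graph[OF assms]
  have "parcs H \<subseteq> pverts H \<times> pverts H" using * by (simp add: conn_graph_def)
  moreover from this have "finite (parcs H)" using * finite_subset by blast
  moreover have "symmetric (with_proj H)" using * by (simp add: symmetric_def conn_graph_def)
  ultimately show ?thesis using * by unfold_locales auto
qed

lemma (in pair_wf_digraph) relpow_iff_awalk:
  assumes "u \<in> pverts G"
  shows "(u, v) \<in> parcs G ^^ k \<longleftrightarrow> (\<exists>p. awalk u p v \<and> length p = k)"
  using assms
proof (induction k arbitrary: u)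
  case 0
  then show ?case by (auto simp: awalk_Nil_iff)
next
  case (Suc k)
  show ?case
  proof
    assume "(u, v) \<in> parcs G ^^ Suc k"
    then obtain w where w: "(u, w) \<in> parcs G" "(w, v) \<in> parcs G ^^ k"
      by (meson relpow_Suc_D2)
    with Suc.IH[of w] obtain p where "awalk w p v" "length p = k" by (auto dest: in_arcsD2)
    with w(1) have "awalk u ((u, w) # p) v \<and> length ((u, w) # p) = Suc k" by (simp add: awalk_Cons_iff)
    then show "\<exists>p. awalk u p v \<and> length p = Suc k" by blast
  next
    assume "\<exists>p. awalk u p v \<and> length p = Suc k"
    then obtain e p where "awalk u (e # p) v" "length p = k" by (metis length_Suc_conv)
    then have e: "e \<in> parcs G" "fst e = u" "awalk (snd e) p v" by (auto simp: awalk_Cons_iff)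
    then have "(snd e, v) \<in> parcs G ^^ k" using Suc.IH[of "snd e"] \<open>length p = k\<close> arc_snd_in_verts by blast
    with e show "(u, v) \<in> parcs G ^^ Suc k" by (metis prod.collapse relpow_Suc_I2)
  qed
qed

text \<open>With unit weights the cost of a walk is its length, so the infimum over walks is the
  natural distance; connectivity makes it finite. From here on only \<open>dst\<close> is
  used.\<close>

lemma diameter_le_iff:
  assumes "pair_graph G" "conn_graph (pverts G) (parcs G)"
  shows "diameter G \<le> ereal (real d) \<longleftrightarrow> (\<forall>x\<in>pverts G. \<forall>y\<in>pverts G. dst (parcs G) x y \<le> d)"
proof -
  interpret pair_graph G by (rule assms(1))
  have "\<mu> (\<lambda>_. 1) x y \<le> ereal (real d) \<longleftrightarrow> dst (parcs G) x y \<le> d"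
    if xy: "x \<in> pverts G" "y \<in> pverts G" for x y
  proof -
    have c: "awalk_cost (\<lambda>_. 1) p = real (length p)" for p :: "('a \<times> 'a) list"
      by (induction p) (auto simp: awalk_cost_def)
    have r: "(x, y) \<in> (parcs G)\<^sup>*" using assms(2) xy by (simp add: conn_graph_def)
    have "\<mu> (\<lambda>_. 1) x y = ereal (real (dst (parcs G) x y))"
    proof (rule antisym)
      from dst_walk[OF r] obtain p where p: "awalk x p y" "length p = dst (parcs G) x y"
        using relpow_iff_awalk[OF xy(1)] by blast
      show "\<mu> (\<lambda>_. 1) x y \<le> ereal (real (dst (parcs G) x y))"
        using min_cost_le_walk_cost[OF p(1), of "\<lambda>_. 1"] p(2) by (simp add: c)
      show "ereal (real (dst (parcs G) x y)) \<le> \<mu> (\<lambda>_. 1) x y"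
        unfolding \<mu>_def
      proof (rule INF_greatest)
        fix p assume "p \<in> {p. awalk x p y}"
        then have "(x, y) \<in> parcs G ^^ length p" using relpow_iff_awalk[OF xy(1)] by blast
        then show "ereal (real (dst (parcs G) x y)) \<le> ereal (awalk_cost (\<lambda>_. 1) p)"
          by (simp add: c dst_le)
      qed
    qed
    then show ?thesis by simp
  qed
  then show ?thesis by (simp add: diameter_def SUP_le_iff)
qed

section \<open>The dynamic program\<close>

text \<open>
  A part \<open>H\<close> of a series-parallel supergraph with terminals \<open>s\<close>, \<open>t\<close> is summarised by
  \<open>(s, t, e, D, S, P)\<close>. Vertices of the input graph are named by their indices below \<open>n\<close>, and all
  other vertices have the name \<open>n\<close>. The number \<open>e\<close> is the distance of \<open>s\<close> and \<open>t\<close> in \<open>H\<close>, \<open>D\<close> is the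
  length of an \<open>s\<close>-\<open>t\<close> path promised outside of \<open>H\<close>, \<open>S\<close> are the input vertices in \<open>H\<close> other than
  \<open>s\<close>, \<open>t\<close>, and \<open>P\<close> are the pairs of distances to \<open>s\<close> and \<open>t\<close> in \<open>H\<close>. All distances are capped at
  \<open>d + 1\<close>.
\<close>

type_synonym summary = "nat \<times> nat \<times> nat \<times> nat \<times> nat set \<times> (nat \<times> nat) set"

locale dp =
  fixes n d :: nat and A :: "nat \<Rightarrow> nat \<Rightarrow> bool"
begin

text \<open>Distances occur only in sums that are compared with \<open>d\<close>, so all values
  above \<open>d\<close> behave alike and \<open>d + 1\<close> represents them.\<close>

definition cap :: "nat \<Rightarrow> nat" where
  "cap v = min v (d + 1)"

text \<open>The promises of the parts are forced: for each of them the outer path continues through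
  the other part. New vertices can always be kept apart, so disjointness is asked of named vertices
  only. The middle terminal becomes inner, hence its arcs in the input must all be present now: an
  arc to an inner vertex was checked at its other end, and an arc to an outer terminal shows as
  distance 1.\<close>

fun ser_ok :: "nat \<Rightarrow> summary \<Rightarrow> summary \<Rightarrow> bool" where
  "ser_ok D (s1, t1, e1, D1, S1, P1) (s2, t2, e2, D2, S2, P2) \<longleftrightarrow>
     t1 = s2 \<and> (s1 \<noteq> t2 \<or> s1 = n) \<and> D1 = cap (D + e2) \<and> D2 = cap (D + e1) \<and>
     (\<forall>v<n. \<not> (v \<in> S1 \<and> v \<in> S2) \<and> \<not> (v = s1 \<and> v \<in> S2) \<and> \<not> (v = t2 \<and> v \<in> S1) \<and>
       (t1 < n \<and> A t1 v \<longrightarrow> v \<in> S1 \<or> v \<in> S2 \<or> v = s1 \<and> e1 = 1 \<or> v = t2 \<and> e2 = 1)) \<and>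
     (\<forall>(a, b)\<in>P1. \<forall>(a', b')\<in>P2. b + a' \<le> d \<or> a + D + b' \<le> d)"

fun ser_res :: "nat \<Rightarrow> summary \<Rightarrow> summary \<Rightarrow> summary" where
  "ser_res D (s1, t1, e1, D1, S1, P1) (s2, t2, e2, D2, S2, P2) =
     (s1, t2, cap (e1 + e2), D, {v. v < n \<and> (v \<in> S1 \<or> v \<in> S2 \<or> v = t1)},
      (\<lambda>(a, b). (a, cap (b + e2))) ` P1 \<union> (\<lambda>(a, b). (cap (a + e1), b)) ` P2)"

text \<open>Both distances being 1 would mean parallel arcs between the terminals. No arc of the
  input is checked, because no vertex becomes inner.\<close>

fun par_ok :: "nat \<Rightarrow> summary \<Rightarrow> summary \<Rightarrow> bool" where
  "par_ok D (s1, t1, e1, D1, S1, P1) (s2, t2, e2, D2, S2, P2) \<longleftrightarrow>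
     s1 = s2 \<and> t1 = t2 \<and> D1 = min D e2 \<and> D2 = min D e1 \<and> \<not> (e1 = 1 \<and> e2 = 1) \<and>
     (\<forall>v<n. \<not> (v \<in> S1 \<and> v \<in> S2)) \<and>
     (\<forall>(a, b)\<in>P1. \<forall>(a', b')\<in>P2. a + a' \<le> d \<or> b + b' \<le> d \<or> a + D + b' \<le> d \<or> b + D + a' \<le> d)"

fun par_res :: "nat \<Rightarrow> summary \<Rightarrow> summary \<Rightarrow> summary" where
  "par_res D (s1, t1, e1, D1, S1, P1) (s2, t2, e2, D2, S2, P2) =
     (s1, t1, min e1 e2, D, {v. v < n \<and> (v \<in> S1 \<or> v \<in> S2)},
      (\<lambda>(a, b). (min a (cap (b + e2)), min b (cap (a + e2)))) ` P1 \<union>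
      (\<lambda>(a, b). (min a (cap (b + e1)), min b (cap (a + e1)))) ` P2)"

definition edge_summary :: "nat \<Rightarrow> nat \<Rightarrow> nat \<Rightarrow> summary" where
  "edge_summary s t D = (s, t, 1, D, {}, {(0, 1), (1, 0)})"

text \<open>The promise of an edge is guessed; a wrong guess merely fails to find a partner later.
  Two terminals named \<open>n\<close> stand for different new vertices, so only names below
  \<open>n\<close> have to differ.\<close>

inductive_set reach :: "summary set" where
  edge: "s \<le> n \<Longrightarrow> t \<le> n \<Longrightarrow> s \<noteq> t \<or> s = n \<Longrightarrow> D \<le> d + 1 \<Longrightarrow> edge_summary s t D \<in> reach"
| series: "x \<in> reach \<Longrightarrow> y \<in> reach \<Longrightarrow> D \<le> d + 1 \<Longrightarrow> ser_ok D x y \<Longrightarrow> ser_res D x y \<in> reach"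
| parallel: "x \<in> reach \<Longrightarrow> y \<in> reach \<Longrightarrow> D \<le> d + 1 \<Longrightarrow> par_ok D x y \<Longrightarrow> par_res D x y \<in> reach"

text \<open>The promise \<open>d + 1\<close> means that no outer path helps. Every arc of the input
  has been checked when one of its ends became inner, except for an arc between the last two
  terminals.\<close>

fun accepting :: "summary \<Rightarrow> bool" where
  "accepting (s, t, e, D, S, P) \<longleftrightarrow> D = d + 1 \<and> (\<forall>v<n. v \<in> S \<or> v = s \<or> v = t) \<and>
     (s < n \<and> t < n \<and> A s t \<longrightarrow> e = 1)"

lemma reach_terminals:
  "(s, t, r) \<in> reach \<Longrightarrow> s \<le> n \<and> t \<le> n \<and> (s \<noteq> t \<or> s = n)"
proof (induction "(s, t, r)" arbitrary: s t r rule: reach.induct)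
  case (series x y D)
  obtain s1 t1 e1 D1 S1 P1 where x: "x = (s1, t1, e1, D1, S1, P1)" by (cases x)
  obtain s2 t2 e2 D2 S2 P2 where y: "y = (s2, t2, e2, D2, S2, P2)" by (cases y)
  show ?case using series.hyps(2)[OF x] series.hyps(4)[OF y] series.hyps(6,7) by (auto simp: x y)
next
  case (parallel x y D)
  obtain s1 t1 e1 D1 S1 P1 where x: "x = (s1, t1, e1, D1, S1, P1)" by (cases x)
  obtain s2 t2 e2 D2 S2 P2 where y: "y = (s2, t2, e2, D2, S2, P2)" by (cases y)
  show ?case using parallel.hyps(2)[OF x] parallel.hyps(4)[OF y] parallel.hyps(6,7) by (auto simp: x y)
qed (auto simp: edge_summary_def)

lemma cap_simps [simp]: "cap (cap v) = cap v" "cap (v + cap w) = cap (v + w)" "cap (cap w + v) = cap (w + v)"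
  "cap v \<le> d \<longleftrightarrow> v \<le> d" "cap v \<le> d + 1" "cap v \<le> Suc d"
  by (auto simp: cap_def)

lemma cap_min: "cap (min v w) = min (cap v) (cap w)"
  by (auto simp: cap_def)

lemma cap_add_le:
  "cap a + cap b \<le> d \<longleftrightarrow> a + b \<le> d" "cap a + D + cap b \<le> d \<longleftrightarrow> a + D + b \<le> d"
  by (auto simp: cap_def)

lemma diam_ok_cap: "diam_ok d V E s t (cap D) \<longleftrightarrow> diam_ok d V E s t D"
proof -
  have "x + cap D + y \<le> d \<longleftrightarrow> x + D + y \<le> d" for x y by (auto simp: cap_def)
  then show ?thesis by (simp add: diam_ok_def)
qed

end

section \<open>Summaries of concrete parts relative to the input graph\<close>

locale dp_graph = dp "length vs" d "\<lambda>i j. (vs ! i, vs ! j) \<in> parcs G"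
  for G :: "nat pair_pre_digraph" and vs :: "nat list" and d +
  assumes G: "pair_graph G" and vs: "distinct vs" "set vs = pverts G" and d: "1 \<le> d"
begin

definition lab :: "nat \<Rightarrow> nat" where
  "lab v = (if v \<in> pverts G then THE i. i < length vs \<and> vs ! i = v else length vs)"

lemma lab_vertex: "v \<in> pverts G \<Longrightarrow> lab v < length vs \<and> vs ! lab v = v"
proof -
  assume v: "v \<in> pverts G"
  then obtain i where i: "i < length vs" "vs ! i = v" using vs(2) by (metis in_set_conv_nth)
  have "\<exists>!i. i < length vs \<and> vs ! i = v"
    using i vs(1) by (metis nth_eq_iff_index_eq)
  from theI'[OF this] show ?thesis using v by (simp add: lab_def)
qed

lemma lab_fresh: "v \<notin> pverts G \<Longrightarrow> lab v = length vs"
  by (simp add: lab_def)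

lemma lab_le: "lab v \<le> length vs"
  using lab_vertex[of v] lab_fresh[of v] by fastforce

lemma nth_vertex: "i < length vs \<Longrightarrow> vs ! i \<in> pverts G \<and> lab (vs ! i) = i"
  using vs lab_vertex[of "vs ! i"] by (metis nth_eq_iff_index_eq nth_mem)

lemma lab_less_iff: "lab v < length vs \<longleftrightarrow> v \<in> pverts G"
  using lab_vertex lab_fresh by fastforce

lemma lab_eqD: "lab u = lab v \<Longrightarrow> u = v \<or> u \<notin> pverts G \<and> v \<notin> pverts G"
  using lab_vertex lab_less_iff by metis

text \<open>A vertex of \<open>G\<close> is fixed by its name and cannot avoid anything; a new one
  can be chosen outside any finite set.\<close>

lemma ex_lab:
  assumes "i \<le> length vs" "finite F"
  shows "\<exists>v. lab v = i \<and> (i = length vs \<longrightarrow> v \<notin> F)"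
proof (cases "i = length vs")
  case True
  have "finite (pverts G \<union> F)" using assms(2) vs(2) by (metis List.finite_set finite_UnI)
  then obtain v where "v \<notin> pverts G \<union> F" using ex_new_if_finite infinite_UNIV_nat by blast
  then show ?thesis using True lab_fresh by auto
next
  case False
  then have "lab (vs ! i) = i" using assms(1) nth_vertex[of i] by simp
  then show ?thesis using False by blast
qed

definition inner :: "nat pair_pre_digraph \<Rightarrow> nat \<Rightarrow> nat \<Rightarrow> nat set" where
  "inner H s t = pverts H - {s, t}"

text \<open>Later compositions add no arcs at inner vertices, so the arcs of \<open>G\<close> there
  must already lie in \<open>H\<close>. Nothing is said about arcs between the terminals.\<close>

definition covered :: "nat pair_pre_digraph \<Rightarrow> nat \<Rightarrow> nat \<Rightarrow> bool" where
  "covered H s t \<longleftrightarrow> (\<forall>u w. (u, w) \<in> parcs G \<and> u \<in> inner H s t \<longrightarrow> (u, w) \<in> parcs H)"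

text \<open>The promise \<open>D\<close> is a parameter because it concerns the surroundings of
  \<open>H\<close> and is not determined by \<open>H\<close>.\<close>

definition summary_of :: "nat pair_pre_digraph \<Rightarrow> nat \<Rightarrow> nat \<Rightarrow> nat \<Rightarrow> summary" where
  "summary_of H s t D = (lab s, lab t, cap (dst (parcs H) s t), D,
     {i. i < length vs \<and> vs ! i \<in> inner H s t},
     (\<lambda>x. (cap (dst (parcs H) x s), cap (dst (parcs H) x t))) ` pverts H)"

text \<open>Here \<open>1 \<le> d\<close> matters: the cap is at least 2, so an arc between
  terminals remains distinguishable from a longer distance.\<close>

lemma cap_eq_1: "cap v = 1 \<longleftrightarrow> v = 1"
  using d by (auto simp: cap_def)

lemma G_sym: "(u, w) \<in> parcs G \<Longrightarrow> (w, u) \<in> parcs G"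
proof -
  interpret pair_graph G by (rule G)
  show "(u, w) \<in> parcs G \<Longrightarrow> (w, u) \<in> parcs G"
    using pair_sym_arcs by (auto simp: symmetric_def dest: symD)
qed

lemma G_arcD: "(u, w) \<in> parcs G \<Longrightarrow> u \<in> pverts G \<and> w \<in> pverts G \<and> u \<noteq> w"
proof -
  interpret pair_graph G by (rule G)
  show "(u, w) \<in> parcs G \<Longrightarrow> u \<in> pverts G \<and> w \<in> pverts G \<and> u \<noteq> w"
    using no_loops' by (auto dest: in_arcsD1 in_arcsD2)
qed

abbreviation join :: "nat pair_pre_digraph \<Rightarrow> nat pair_pre_digraph \<Rightarrow> nat pair_pre_digraph" where
  "join H1 H2 \<equiv> \<lparr> pverts = pverts H1 \<union> pverts H2, parcs = parcs H1 \<union> parcs H2 \<rparr>"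

section \<open>Series composition of concrete parts\<close>

context
  fixes H1 H2 :: "nat pair_pre_digraph" and s m t D :: nat
  assumes H1: "two_terminal_sp H1 s m" and H2: "two_terminal_sp H2 m t"
    and i: "pverts H1 \<inter> pverts H2 = {m}"
begin

lemma series_basics: "finite (pverts H1)" "finite (pverts H2)" "s \<in> pverts H1" "m \<in> pverts H1" "m \<in> pverts H2"
  "t \<in> pverts H2" "s \<noteq> m" "m \<noteq> t" "s \<notin> pverts H2" "t \<notin> pverts H1" "s \<noteq> t"
  "conn_graph (pverts H1) (parcs H1)" "conn_graph (pverts H2) (parcs H2)"
  using two_terminal_sp_graph[OF H1] two_terminal_sp_graph[OF H2] i by auto

lemma inner_series: "inner (join H1 H2) s t = inner H1 s m \<union> inner H2 m t \<union> {m}"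
  using series_basics i by (auto simp: inner_def)

text \<open>Capping before or after an addition gives the same capped result, so the distances in
  the composition can be computed from the summaries of the parts. The promises inserted are those
  that \<open>ser_ok\<close> demands.\<close>

lemma summary_series:
  "summary_of (join H1 H2) s t D =
    ser_res D (summary_of H1 s m (cap (D + dst (parcs H2) m t))) (summary_of H2 m t (cap (D + dst (parcs H1) s m)))"
proof -
  note b = series_basics
  have i': "pverts H2 \<inter> pverts H1 = {m}" using i by auto
  note d1 = dst_series[OF b(12,13) i]
  note d2 = dst_series[OF b(13,12) i', unfolded Un_commute[of "parcs H2"]]
  let ?f = "\<lambda>x. (cap (dst (parcs H1 \<union> parcs H2) x s), cap (dst (parcs H1 \<union> parcs H2) x t))"
  have "{i. i < length vs \<and> vs ! i \<in> inner (join H1 H2) s t} =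
    {v. v < length vs \<and> (v \<in> {i. i < length vs \<and> vs ! i \<in> inner H1 s m} \<or>
       v \<in> {i. i < length vs \<and> vs ! i \<in> inner H2 m t} \<or> v = lab m)}"
    unfolding inner_series using nth_vertex lab_vertex lab_less_iff by auto
  moreover have "?f ` pverts H1 = (\<lambda>(a, b). (a, cap (b + cap (dst (parcs H2) m t)))) `
     (\<lambda>x. (cap (dst (parcs H1) x s), cap (dst (parcs H1) x m))) ` pverts H1"
    unfolding image_image by (rule image_cong) (use b in \<open>auto simp: d1\<close>)
  moreover have "?f ` pverts H2 = (\<lambda>(a, b). (cap (a + cap (dst (parcs H1) s m)), b)) `
     (\<lambda>x. (cap (dst (parcs H2) x m), cap (dst (parcs H2) x t))) ` pverts H2"
    unfolding image_image using cg_sym[OF b(12), of s m]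
    by (intro image_cong) (use b in \<open>auto simp: d2\<close>)
  moreover have "dst (parcs H1 \<union> parcs H2) s t = dst (parcs H1) s m + dst (parcs H2) m t"
    using b by (simp add: d1)
  ultimately show ?thesis by (simp add: summary_of_def image_Un)
qed

text \<open>The link between graphs and rules. It is an equivalence because completeness splits a
  good graph into good parts, while soundness assembles good parts.\<close>

lemma diam_series:
  shows "diam_ok d (pverts H1 \<union> pverts H2) (parcs H1 \<union> parcs H2) s t D \<and> covered (join H1 H2) s t \<longleftrightarrow>
    diam_ok d (pverts H1) (parcs H1) s m (cap (D + dst (parcs H2) m t)) \<and> covered H1 s m \<and>
    diam_ok d (pverts H2) (parcs H2) m t (cap (D + dst (parcs H1) s m)) \<and> covered H2 m t \<and>
    ser_ok D (summary_of H1 s m (cap (D + dst (parcs H2) m t))) (summary_of H2 m t (cap (D + dst (parcs H1) s m)))"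
proof -
  note b = series_basics
  have L: "lab s \<noteq> lab t \<or> lab s = length vs" using lab_eqD[of s t] b lab_fresh by blast
  have e1: "cap (dst (parcs H1) s m) = 1 \<longleftrightarrow> (s, m) \<in> parcs H1"
    using cg_dst_1[OF b(12) b(3,4,7)] by (simp only: cap_eq_1)
  have e2: "cap (dst (parcs H2) m t) = 1 \<longleftrightarrow> (m, t) \<in> parcs H2"
    using cg_dst_1[OF b(13) b(5,6,8)] by (simp only: cap_eq_1)
  have sy: "sym (parcs H1)" "sym (parcs H2)" using b(12,13) by (auto simp: conn_graph_def)
  \<comment> \<open>Coverage of the composition adds to coverage of the parts exactly the arcs at
    \<open>m\<close>, the one vertex that becomes inner.\<close>
  have cov: "covered (join H1 H2) s t \<longleftrightarrow> covered H1 s m \<and> covered H2 m t \<and>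
     (\<forall>v<length vs. lab m < length vs \<and> (vs ! lab m, vs ! v) \<in> parcs G \<longrightarrow>
        vs ! v \<in> inner H1 s m \<or> vs ! v \<in> inner H2 m t \<or> v = lab s \<and> (s, m) \<in> parcs H1 \<or>
        v = lab t \<and> (m, t) \<in> parcs H2)" (is "?L \<longleftrightarrow> ?A \<and> ?B \<and> ?C")
  proof
    assume L: ?L
    have ?A unfolding covered_def
    proof (intro allI impI)
      fix u w assume uw: "(u, w) \<in> parcs G \<and> u \<in> inner H1 s m"
      then have "(u, w) \<in> parcs H1 \<union> parcs H2" using L by (auto simp: covered_def inner_series)
      moreover have "u \<notin> pverts H2" using uw i by (auto simp: inner_def)
      ultimately show "(u, w) \<in> parcs H1" using cg_arcD[OF b(13)] by auto
    qed
    moreover have ?B unfolding covered_def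
    proof (intro allI impI)
      fix u w assume uw: "(u, w) \<in> parcs G \<and> u \<in> inner H2 m t"
      then have "(u, w) \<in> parcs H1 \<union> parcs H2" using L by (auto simp: covered_def inner_series)
      moreover have "u \<notin> pverts H1" using uw i by (auto simp: inner_def)
      ultimately show "(u, w) \<in> parcs H2" using cg_arcD[OF b(12)] by auto
    qed
    moreover have ?C
    proof (intro allI impI)
      fix v assume v: "v < length vs" "lab m < length vs \<and> (vs ! lab m, vs ! v) \<in> parcs G"
      then have m: "vs ! lab m = m" using lab_less_iff lab_vertex by blast
      have "(m, vs ! v) \<in> parcs H1 \<union> parcs H2" using v L by (auto simp: m covered_def inner_series)
      then show "vs ! v \<in> inner H1 s m \<or> vs ! v \<in> inner H2 m t \<or> v = lab s \<and> (s, m) \<in> parcs H1 \<or>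
        v = lab t \<and> (m, t) \<in> parcs H2"
      proof
        assume a: "(m, vs ! v) \<in> parcs H1"
        show ?thesis
        proof (cases "vs ! v = s")
          case True
          then have "v = lab s" using nth_vertex[OF v(1)] by simp
          then show ?thesis using a True symD[OF sy(1)] by auto
        next
          case False
          then have "vs ! v \<in> inner H1 s m"
            using cg_arcD[OF b(12) a] G_arcD v(2) by (auto simp: inner_def m)
          then show ?thesis by blast
        qed
      next
        assume a: "(m, vs ! v) \<in> parcs H2"
        show ?thesis
        proof (cases "vs ! v = t")
          case True
          then have "v = lab t" using nth_vertex[OF v(1)] by simp
          then show ?thesis using a True by auto
        next
          case False
          then have "vs ! v \<in> inner H2 m t"
            using cg_arcD[OF b(13) a] G_arcD v(2) by (auto simp: inner_def m)
          then show ?thesis by blast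
        qed
      qed
    qed
    ultimately show "?A \<and> ?B \<and> ?C" by blast
  next
    assume R: "?A \<and> ?B \<and> ?C"
    \<comment> \<open>If \<open>w\<close> is inner in a part, coverage of that part is applied at
      the end \<open>w\<close> and the arc is reversed; otherwise \<open>w\<close> is an outer
      terminal, and the arc is the one recorded by the test.\<close>
    have "(m, w) \<in> parcs H1 \<union> parcs H2" if mw: "(m, w) \<in> parcs G" for w
    proof -
      have m: "lab m < length vs" "vs ! lab m = m" using G_arcD[OF mw] lab_vertex by auto
      have w: "lab w < length vs" "vs ! lab w = w" using G_arcD[OF mw] lab_vertex by auto
      consider "w \<in> inner H1 s m" | "w \<in> inner H2 m t" | "lab w = lab s" "(s, m) \<in> parcs H1" |
        "lab w = lab t" "(m, t) \<in> parcs H2"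
        using R m w mw by metis
      then show ?thesis
      proof cases
        case 1
        then have "(w, m) \<in> parcs H1" using R G_sym[OF mw] by (auto simp: covered_def)
        then show ?thesis using symD[OF sy(1)] by blast
      next
        case 2
        then have "(w, m) \<in> parcs H2" using R G_sym[OF mw] by (auto simp: covered_def)
        then show ?thesis using symD[OF sy(2)] by blast
      next
        case 3
        then have "w = s" using lab_eqD[of w s] G_arcD[OF mw] by blast
        then show ?thesis using 3 symD[OF sy(1)] by blast
      next
        case 4
        then have "w = t" using lab_eqD[of w t] G_arcD[OF mw] by blast
        then show ?thesis using 4 by blast
      qed
    qed
    then show ?L using R by (auto simp: covered_def inner_series)
  qed
  \<comment> \<open>Parts that meet in \<open>m\<close> only pass the disjointness tests of
    \<open>ser_ok\<close>, so \<open>ok\<close> retains just the conditions on the arcs at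
    \<open>m\<close> and on cross pairs.\<close>
  have S: "\<not> (vs ! v \<in> inner H1 s m \<and> vs ! v \<in> inner H2 m t)"
    "\<not> (v = lab s \<and> vs ! v \<in> inner H2 m t)" "\<not> (v = lab t \<and> vs ! v \<in> inner H1 s m)"
    if v: "v < length vs" for v
  proof -
    show "\<not> (vs ! v \<in> inner H1 s m \<and> vs ! v \<in> inner H2 m t)" using i by (auto simp: inner_def)
    show "\<not> (v = lab s \<and> vs ! v \<in> inner H2 m t)"
      using v b(9) lab_vertex[of s] lab_less_iff[of s] by (auto simp: inner_def)
    show "\<not> (v = lab t \<and> vs ! v \<in> inner H1 s m)"
      using v b(10) lab_vertex[of t] lab_less_iff[of t] by (auto simp: inner_def)
  qed
  have ok: "ser_ok D (summary_of H1 s m (cap (D + dst (parcs H2) m t))) (summary_of H2 m t (cap (D + dst (parcs H1) s m)))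
    \<longleftrightarrow> (\<forall>v<length vs. lab m < length vs \<and> (vs ! lab m, vs ! v) \<in> parcs G \<longrightarrow>
        vs ! v \<in> inner H1 s m \<or> vs ! v \<in> inner H2 m t \<or> v = lab s \<and> (s, m) \<in> parcs H1 \<or>
        v = lab t \<and> (m, t) \<in> parcs H2) \<and>
      (\<forall>x\<in>pverts H1. \<forall>y\<in>pverts H2. dst (parcs H1) x m + dst (parcs H2) y m \<le> d \<or>
         dst (parcs H1) x s + D + dst (parcs H2) y t \<le> d)"
    unfolding summary_of_def ser_ok.simps e1 e2 using L S by (auto simp: cap_add_le)
  show ?thesis
    unfolding cov ok diam_ok_cap using diam_ok_series[OF b(12,13) i b(3,6), of d D] by blast
qed

end

section \<open>Parallel composition of concrete parts\<close>

context
  fixes H1 H2 :: "nat pair_pre_digraph" and s t D :: nat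
  assumes H1: "two_terminal_sp H1 s t" and H2: "two_terminal_sp H2 s t"
    and i: "pverts H1 \<inter> pverts H2 = {s, t}"
begin

lemma parallel_basics: "finite (pverts H1)" "finite (pverts H2)" "s \<in> pverts H1" "t \<in> pverts H1" "s \<in> pverts H2"
  "t \<in> pverts H2" "s \<noteq> t" "conn_graph (pverts H1) (parcs H1)" "conn_graph (pverts H2) (parcs H2)"
  using two_terminal_sp_graph[OF H1] two_terminal_sp_graph[OF H2] by auto

lemma inner_parallel: "inner (join H1 H2) s t = inner H1 s t \<union> inner H2 s t"
  by (auto simp: inner_def)

lemma summary_parallel:
  "summary_of (join H1 H2) s t D =
    par_res D (summary_of H1 s t D1) (summary_of H2 s t D2)"
proof -
  note b = parallel_basics
  have i': "pverts H2 \<inter> pverts H1 = {s, t}" using i by auto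
  note d1 = dst_parallel[OF b(8,9) i]
  note d2 = dst_parallel[OF b(9,8) i', unfolded Un_commute[of "parcs H2"]]
  let ?f = "\<lambda>x. (cap (dst (parcs H1 \<union> parcs H2) x s), cap (dst (parcs H1 \<union> parcs H2) x t))"
  have 1: "dst (parcs H1 \<union> parcs H2) x s = min (dst (parcs H1) x s) (dst (parcs H1) x t + dst (parcs H2) s t)"
    "dst (parcs H1 \<union> parcs H2) x t = min (dst (parcs H1) x t) (dst (parcs H1) x s + dst (parcs H2) s t)"
    if "x \<in> pverts H1" for x using d1(1)[OF that b(3)] d1(1)[OF that b(4)] by (auto simp: min_def)
  have 2: "dst (parcs H1 \<union> parcs H2) x s = min (dst (parcs H2) x s) (dst (parcs H2) x t + dst (parcs H1) s t)"
    "dst (parcs H1 \<union> parcs H2) x t = min (dst (parcs H2) x t) (dst (parcs H2) x s + dst (parcs H1) s t)"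
    if "x \<in> pverts H2" for x using d2(1)[OF that b(5)] d2(1)[OF that b(6)] by (auto simp: min_def)
  have "{i. i < length vs \<and> vs ! i \<in> inner (join H1 H2) s t} =
    {v. v < length vs \<and> (v \<in> {i. i < length vs \<and> vs ! i \<in> inner H1 s t} \<or>
       v \<in> {i. i < length vs \<and> vs ! i \<in> inner H2 s t})}"
    unfolding inner_parallel by auto
  moreover have "?f ` pverts H1 = (\<lambda>(a, b). (min a (cap (b + cap (dst (parcs H2) s t))),
       min b (cap (a + cap (dst (parcs H2) s t))))) `
     (\<lambda>x. (cap (dst (parcs H1) x s), cap (dst (parcs H1) x t))) ` pverts H1"
    unfolding image_image by (rule image_cong) (auto simp: 1 cap_min)
  moreover have "?f ` pverts H2 = (\<lambda>(a, b). (min a (cap (b + cap (dst (parcs H1) s t))),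
       min b (cap (a + cap (dst (parcs H1) s t))))) `
     (\<lambda>x. (cap (dst (parcs H2) x s), cap (dst (parcs H2) x t))) ` pverts H2"
    unfolding image_image by (rule image_cong) (auto simp: 2 cap_min)
  moreover have "cap (dst (parcs H1 \<union> parcs H2) s t) = min (cap (dst (parcs H1) s t)) (cap (dst (parcs H2) s t))"
    using 1(2)[OF b(3)] by (simp add: cap_min)
  ultimately show ?thesis by (simp add: summary_of_def image_Un)
qed

text \<open>Arc-disjointness stands on the graph side of the equivalence because, in terms of
  summaries, it is the test on the two terminal distances.\<close>

lemma diam_parallel:
  assumes D: "D \<le> d + 1"
  shows "diam_ok d (pverts H1 \<union> pverts H2) (parcs H1 \<union> parcs H2) s t D \<and> covered (join H1 H2) s t \<and>
      parcs H1 \<inter> parcs H2 = {} \<longleftrightarrow>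
    diam_ok d (pverts H1) (parcs H1) s t (min D (cap (dst (parcs H2) s t))) \<and> covered H1 s t \<and>
    diam_ok d (pverts H2) (parcs H2) s t (min D (cap (dst (parcs H1) s t))) \<and> covered H2 s t \<and>
    par_ok D (summary_of H1 s t (min D (cap (dst (parcs H2) s t)))) (summary_of H2 s t (min D (cap (dst (parcs H1) s t))))"
proof -
  note b = parallel_basics
  have sy: "sym (parcs H1)" "sym (parcs H2)" using b(8,9) by (auto simp: conn_graph_def)
  have e1: "cap (dst (parcs H1) s t) = 1 \<longleftrightarrow> (s, t) \<in> parcs H1"
    using cg_dst_1[OF b(8) b(3,4,7)] by (simp only: cap_eq_1)
  have e2: "cap (dst (parcs H2) s t) = 1 \<longleftrightarrow> (s, t) \<in> parcs H2"
    using cg_dst_1[OF b(9) b(5,6,7)] by (simp only: cap_eq_1)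
  \<comment> \<open>The parts share only the two terminals, so a common arc must join them.\<close>
  have disj: "parcs H1 \<inter> parcs H2 = {} \<longleftrightarrow> \<not> ((s, t) \<in> parcs H1 \<and> (s, t) \<in> parcs H2)"
  proof -
    have "u \<in> {s, t} \<and> w \<in> {s, t} \<and> u \<noteq> w" if "(u, w) \<in> parcs H1" "(u, w) \<in> parcs H2" for u w
      using that cg_arcD[OF b(8)] cg_arcD[OF b(9)] i two_terminal_sp_graph[OF H1] by blast
    then have "(s, t) \<in> parcs H1 \<and> (s, t) \<in> parcs H2" if "(u, w) \<in> parcs H1" "(u, w) \<in> parcs H2" for u w
      using that symD[OF sy(1)] symD[OF sy(2)] by blast
    then show ?thesis by (auto simp: disjoint_iff)
  qed
  have cov: "covered (join H1 H2) s t \<longleftrightarrow> covered H1 s t \<and> covered H2 s t"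
  proof
    assume L: "covered (join H1 H2) s t"
    have "(u, w) \<in> parcs H1" if "(u, w) \<in> parcs G" "u \<in> inner H1 s t" for u w
    proof -
      have "(u, w) \<in> parcs H1 \<union> parcs H2" using L that by (auto simp: covered_def inner_parallel)
      moreover have "u \<notin> pverts H2" using that i by (auto simp: inner_def)
      ultimately show ?thesis using cg_arcD[OF b(9)] by auto
    qed
    moreover have "(u, w) \<in> parcs H2" if "(u, w) \<in> parcs G" "u \<in> inner H2 s t" for u w
    proof -
      have "(u, w) \<in> parcs H1 \<union> parcs H2" using L that by (auto simp: covered_def inner_parallel)
      moreover have "u \<notin> pverts H1" using that i by (auto simp: inner_def)
      ultimately show ?thesis using cg_arcD[OF b(8)] by auto
    qed
    ultimately show "covered H1 s t \<and> covered H2 s t" by (simp add: covered_def)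
  qed (auto simp: covered_def inner_parallel)
  have S: "\<not> (vs ! v \<in> inner H1 s t \<and> vs ! v \<in> inner H2 s t)" for v using i by (auto simp: inner_def)
  have ok: "par_ok D (summary_of H1 s t (min D (cap (dst (parcs H2) s t)))) (summary_of H2 s t (min D (cap (dst (parcs H1) s t))))
    \<longleftrightarrow> parcs H1 \<inter> parcs H2 = {} \<and>
    (\<forall>x\<in>pverts H1. \<forall>y\<in>pverts H2. dst (parcs H1) x s + dst (parcs H2) y s \<le> d \<or>
       dst (parcs H1) x t + dst (parcs H2) y t \<le> d \<or> dst (parcs H1) x s + D + dst (parcs H2) y t \<le> d \<or>
       dst (parcs H1) x t + D + dst (parcs H2) y s \<le> d)"
    unfolding summary_of_def par_ok.simps e1 e2 disj using S by (simp add: cap_add_le)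
  \<comment> \<open>Since \<open>D\<close> is at most \<open>d + 1\<close>, the minimum taken in
    \<open>par_ok\<close> is itself a capped number, which makes \<open>diam_ok_cap\<close>
    applicable.\<close>
  have c: "min D (cap x) = cap (min D x)" for x using D by (auto simp: cap_def)
  show ?thesis unfolding ok cov unfolding c diam_ok_cap
    using diam_ok_parallel[OF b(8,9) i, of d D] by blast
qed

end

text \<open>Completeness, by induction on the construction of \<open>H\<close>. The promise is
  generalised, because each part receives its own one, computed from the distance in the other
  part.\<close>

lemma summary_in_reach:
  assumes "two_terminal_sp H s t" "D \<le> d + 1" "diam_ok d (pverts H) (parcs H) s t D" "covered H s t"
  shows "summary_of H s t D \<in> reach"
  using assms
proof (induction arbitrary: D)
  case (edge s t)
  let ?E = "{(s, t), (t, s)}"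
  have cg: "conn_graph {s, t} ?E" using two_terminal_sp_graph[OF two_terminal_sp.edge[OF edge(1)]] by simp
  have c: "dst ?E s t = 1" using cg_dst_1[OF cg, of s t] edge(1) by simp
  have "dst ?E t s = 1" using cg_dst_1[OF cg, of t s] edge(1) by simp
  moreover have "cap 1 = 1" "cap 0 = 0" by (auto simp: cap_def)
  ultimately have "summary_of \<lparr>pverts = {s, t}, parcs = ?E\<rparr> s t D = edge_summary (lab s) (lab t) D"
    using c by (simp add: summary_of_def edge_summary_def inner_def)
  moreover have "lab s \<noteq> lab t \<or> lab s = length vs" using lab_eqD[of s t] edge(1) lab_fresh by blast
  ultimately show ?case using reach.edge lab_le edge(2) by simp
next
  case (series H1 s m H2 t)
  note * = series.hyps
  from diam_series[OF *(1,2,3)] series.prems(2,3) series.IH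
  show ?case unfolding summary_series[OF *(1,2,3)] using series.prems(1)
    by (intro reach.series) auto
next
  case (parallel H1 s t H2)
  note * = parallel.hyps
  from diam_parallel[OF *(1,2,3) parallel.prems(1)] parallel.prems(2,3) parallel.IH *(4)
  show ?case unfolding summary_parallel[OF *(1,2,3), of D "min D (cap (dst (parcs H2) s t))"
        "min D (cap (dst (parcs H1) s t))"] using parallel.prems(1)
    by (intro reach.parallel) auto
qed

text \<open>Quantifying over the set \<open>F\<close> of forbidden names lets the two parts of a composition be realised
  by graphs that share nothing but the terminals, without renaming vertices.\<close>

definition realizes :: "nat set \<Rightarrow> nat \<Rightarrow> nat \<Rightarrow> summary \<Rightarrow> nat pair_pre_digraph \<Rightarrow> bool" where
  "realizes F s t x H \<longleftrightarrow> (\<exists>D\<le>d + 1. two_terminal_sp H s t \<and> summary_of H s t D = x \<and>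
     diam_ok d (pverts H) (parcs H) s t D \<and> covered H s t \<and> inner H s t \<inter> F \<subseteq> pverts G)"

text \<open>Soundness, by rebuilding a graph. The terminals are prescribed from outside, so that
  both parts of a composition can be built on the same ones, and the forbidden set grows from the
  first part to the second. Named vertices are exempt from it; for them the tests in
  \<open>ser_ok\<close> and \<open>par_ok\<close> give disjointness.\<close>

lemma reach_realizes:
  assumes "x \<in> reach" "finite F" "s \<noteq> t" "lab s = fst x" "lab t = fst (snd x)"
  shows "\<exists>H. realizes F s t x H"
  using assms
proof (induction arbitrary: F s t)
  case (edge s' t' D)
  let ?E = "{(s, t), (t, s)}"
  note sp = two_terminal_sp.edge[OF edge.prems(2)]
  have cg: "conn_graph {s, t} ?E" using two_terminal_sp_graph[OF sp] by simp
  have c: "dst ?E s t = 1" using cg_dst_1[OF cg, of s t] edge.prems(2) by simp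
  have c': "dst ?E t s = 1" using cg_dst_1[OF cg, of t s] edge.prems(2) by simp
  moreover have "cap 1 = 1" "cap 0 = 0" by (auto simp: cap_def)
  ultimately have "summary_of \<lparr>pverts = {s, t}, parcs = ?E\<rparr> s t D = edge_summary s' t' D"
    using c edge.prems(3,4) by (simp add: summary_of_def edge_summary_def inner_def)
  moreover have "diam_ok d {s, t} ?E s t D" using c c' d by (simp add: diam_ok_def)
  ultimately show ?case unfolding realizes_def using sp edge.hyps(4)
    by (intro exI[of _ "\<lparr>pverts = {s, t}, parcs = ?E\<rparr>"] exI[of _ D]) (auto simp: covered_def inner_def)
next
  case (series x y D)
  obtain s1 t1 e1 D1 S1 P1 where x: "x = (s1, t1, e1, D1, S1, P1)" by (cases x)
  obtain s2 t2 e2 D2 S2 P2 where y: "y = (s2, t2, e2, D2, S2, P2)" by (cases y)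
  note ok = series.hyps(4)[unfolded x y ser_ok.simps]
  have ls: "lab s = s1" "lab t = t2" using series.prems(3,4) by (auto simp: x y)
  have rx: "t1 \<le> length vs" "s1 \<noteq> t1 \<or> s1 = length vs" using reach_terminals series.hyps(1) unfolding x by blast+
  have ry: "s2 \<noteq> t2 \<or> s2 = length vs" using reach_terminals series.hyps(2) unfolding y by blast
  \<comment> \<open>A named middle terminal is determined by its name; a new one is chosen outside
    \<open>F\<close> and different from the outer terminals.\<close>
  obtain m where m: "lab m = t1" "t1 = length vs \<longrightarrow> m \<notin> F \<union> {s, t}"
    using ex_lab[OF rx(1), of "F \<union> {s, t}"] series.prems(1) by auto
  have sm: "s \<noteq> m" "m \<noteq> t" using m ls rx ry ok by auto
  let ?F1 = "F \<union> {s, t, m}"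
  obtain H1 where "realizes ?F1 s m x H1"
    using series.IH(1)[of ?F1 s m] series.prems(1) sm ls m(1) by (auto simp: x)
  then obtain D1' where h1: "two_terminal_sp H1 s m" "summary_of H1 s m D1' = x" "covered H1 s m"
    "diam_ok d (pverts H1) (parcs H1) s m D1'" "inner H1 s m \<inter> ?F1 \<subseteq> pverts G" unfolding realizes_def by blast
  \<comment> \<open>With the vertices of \<open>H1\<close> forbidden, an inner vertex of the second
    part that also lies in \<open>H1\<close> must belong to \<open>G\<close>.\<close>
  let ?F2 = "?F1 \<union> pverts H1"
  have "finite ?F2" using series.prems(1) two_terminal_sp_graph[OF h1(1)] by simp
  then obtain H2 where "realizes ?F2 m t y H2"
    using series.IH(2)[of ?F2 m t] sm ls m(1) ok by (auto simp: y)
  then obtain D2' where h2: "two_terminal_sp H2 m t" "summary_of H2 m t D2' = y" "covered H2 m t"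
    "diam_ok d (pverts H2) (parcs H2) m t D2'" "inner H2 m t \<inter> ?F2 \<subseteq> pverts G" unfolding realizes_def by blast
  note g1 = two_terminal_sp_graph[OF h1(1)] and g2 = two_terminal_sp_graph[OF h2(1)]
  have S: "S1 = {i. i < length vs \<and> vs ! i \<in> inner H1 s m}" "S2 = {i. i < length vs \<and> vs ! i \<in> inner H2 m t}"
    and e: "e1 = cap (dst (parcs H1) s m)" "e2 = cap (dst (parcs H2) m t)" and D': "D1' = D1" "D2' = D2"
    using h1(2) h2(2) unfolding summary_of_def x y by auto
  have inS: "lab v \<in> S1 \<longleftrightarrow> v \<in> inner H1 s m" "lab v \<in> S2 \<longleftrightarrow> v \<in> inner H2 m t" "lab v < length vs"
    if "v \<in> pverts G" for v using lab_vertex[OF that] by (auto simp: S)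
  have okS: "\<not> (lab v \<in> S1 \<and> lab v \<in> S2)" "\<not> (lab v = s1 \<and> lab v \<in> S2)" "\<not> (lab v = t2 \<and> lab v \<in> S1)"
    if "v \<in> pverts G" for v using ok inS(3)[OF that] by simp_all
  \<comment> \<open>A common vertex other than \<open>m\<close> would be a named one. Whether it is
    \<open>t\<close>, \<open>s\<close>, or inner in both parts, one of the facts \<open>okS\<close>
    excludes it.\<close>
  have i: "pverts H1 \<inter> pverts H2 = {m}"
  proof (intro equalityI subsetI)
    fix v assume v: "v \<in> pverts H1 \<inter> pverts H2"
    show "v \<in> {m}"
    proof (rule ccontr)
      assume vm: "v \<notin> {m}"
      have "v \<noteq> t"
      proof
        assume "v = t"
        then have "t \<in> inner H1 s m" using v vm series.prems(2) by (auto simp: inner_def)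
        moreover from this have "t \<in> pverts G" using h1(5) by auto
        ultimately show False using inS(1)[of t] okS(3)[of t] ls(2) by simp
      qed
      with v vm have v2: "v \<in> inner H2 m t" by (auto simp: inner_def)
      then have vG: "v \<in> pverts G" using h2(5) v by auto
      have "v \<noteq> s" using inS(2)[OF vG] okS(2)[OF vG] ls(1) v2 by auto
      with v vm have v1: "v \<in> inner H1 s m" by (auto simp: inner_def)
      show False using inS(1,2)[OF vG] okS(1)[OF vG] v1 v2 by simp
    qed
  qed (use g1 g2 in auto)
  note sp = two_terminal_sp.series[OF h1(1) h2(1) i]
  have D1: "D1 = cap (D + dst (parcs H2) m t)" "D2 = cap (D + dst (parcs H1) s m)" using ok by (simp_all add: e)
  have "ser_ok D (summary_of H1 s m (cap (D + dst (parcs H2) m t))) (summary_of H2 m t (cap (D + dst (parcs H1) s m)))"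
    using series.hyps(4) h1(2) h2(2) unfolding D' D1 by simp
  with diam_series[OF h1(1) h2(1) i] h1(3,4) h2(3,4)
  have "diam_ok d (pverts H1 \<union> pverts H2) (parcs H1 \<union> parcs H2) s t D \<and> covered (join H1 H2) s t"
    unfolding D' D1 by blast
  moreover have "summary_of (join H1 H2) s t D = ser_res D x y"
    using summary_series[OF h1(1) h2(1) i] h1(2) h2(2) unfolding D' D1 by simp
  moreover have "inner (join H1 H2) s t \<inter> F \<subseteq> pverts G"
    unfolding inner_series[OF h1(1) h2(1) i] using h1(5) h2(5) m lab_less_iff[of m] rx(1) by fastforce
  ultimately show ?case unfolding realizes_def using sp series.hyps(3)
    by (intro exI[of _ "join H1 H2"] exI[of _ D]) simp
next
  case (parallel x y D)
  obtain s1 t1 e1 D1 S1 P1 where x: "x = (s1, t1, e1, D1, S1, P1)" by (cases x)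
  obtain s2 t2 e2 D2 S2 P2 where y: "y = (s2, t2, e2, D2, S2, P2)" by (cases y)
  note ok = parallel.hyps(4)[unfolded x y par_ok.simps]
  have ls: "lab s = s1" "lab t = t1" using parallel.prems(3,4) by (auto simp: x y)
  let ?F1 = "F \<union> {s, t}"
  obtain H1 where "realizes ?F1 s t x H1"
    using parallel.IH(1)[of ?F1 s t] parallel.prems(1,2) ls by (auto simp: x)
  then obtain D1' where h1: "two_terminal_sp H1 s t" "summary_of H1 s t D1' = x" "covered H1 s t"
    "diam_ok d (pverts H1) (parcs H1) s t D1'" "inner H1 s t \<inter> ?F1 \<subseteq> pverts G" unfolding realizes_def by blast
  let ?F2 = "?F1 \<union> pverts H1"
  have "finite ?F2" using parallel.prems(1) two_terminal_sp_graph[OF h1(1)] by simp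
  then obtain H2 where "realizes ?F2 s t y H2"
    using parallel.IH(2)[of ?F2 s t] parallel.prems(2) ls ok by (auto simp: y)
  then obtain D2' where h2: "two_terminal_sp H2 s t" "summary_of H2 s t D2' = y" "covered H2 s t"
    "diam_ok d (pverts H2) (parcs H2) s t D2'" "inner H2 s t \<inter> ?F2 \<subseteq> pverts G" unfolding realizes_def by blast
  note g1 = two_terminal_sp_graph[OF h1(1)] and g2 = two_terminal_sp_graph[OF h2(1)]
  have S: "S1 = {i. i < length vs \<and> vs ! i \<in> inner H1 s t}" "S2 = {i. i < length vs \<and> vs ! i \<in> inner H2 s t}"
    and e: "e1 = cap (dst (parcs H1) s t)" "e2 = cap (dst (parcs H2) s t)" and D': "D1' = D1" "D2' = D2"
    using h1(2) h2(2) unfolding summary_of_def x y by auto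
  have i: "pverts H1 \<inter> pverts H2 = {s, t}"
  proof (intro equalityI subsetI)
    fix v assume v: "v \<in> pverts H1 \<inter> pverts H2"
    show "v \<in> {s, t}"
    proof (rule ccontr)
      assume "v \<notin> {s, t}"
      with v have v12: "v \<in> inner H1 s t" "v \<in> inner H2 s t" by (auto simp: inner_def)
      then have "v \<in> pverts G" using h2(5) v by auto
      with lab_vertex have "lab v < length vs" "lab v \<in> S1" "lab v \<in> S2" using v12 by (auto simp: S)
      then show False using ok by blast
    qed
  qed (use g1 g2 in auto)
  have D1: "D1 = min D (cap (dst (parcs H2) s t))" "D2 = min D (cap (dst (parcs H1) s t))" using ok by (simp_all add: e)
  have "par_ok D (summary_of H1 s t (min D (cap (dst (parcs H2) s t)))) (summary_of H2 s t (min D (cap (dst (parcs H1) s t))))"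
    using parallel.hyps(4) h1(2) h2(2) unfolding D' D1 by simp
  with diam_parallel[OF h1(1) h2(1) i parallel.hyps(3)] h1(3,4) h2(3,4)
  have *: "diam_ok d (pverts H1 \<union> pverts H2) (parcs H1 \<union> parcs H2) s t D \<and> covered (join H1 H2) s t \<and>
      parcs H1 \<inter> parcs H2 = {}"
    unfolding D' D1 by blast
  then have sp: "two_terminal_sp (join H1 H2) s t" using two_terminal_sp.parallel[OF h1(1) h2(1) i] by blast
  moreover have "summary_of (join H1 H2) s t D = par_res D x y"
    using summary_parallel[OF h1(1) h2(1) i] h1(2) h2(2) by metis
  moreover have "inner (join H1 H2) s t \<inter> F \<subseteq> pverts G"
    unfolding inner_parallel[OF h1(1) h2(1) i] using h1(5) h2(5) by blast
  ultimately show ?case unfolding realizes_def using * parallel.hyps(3)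
    by (intro exI[of _ "join H1 H2"] exI[of _ D]) simp
qed

lemma realizable:
  assumes "x \<in> reach"
  shows "\<exists>s t H. realizes {} s t x H"
proof -
  obtain s1 t1 r where x: "x = (s1, t1, r)" by (cases x) auto
  have t: "s1 \<le> length vs" "t1 \<le> length vs" "s1 \<noteq> t1 \<or> s1 = length vs"
    using reach_terminals assms unfolding x by blast+
  obtain s where s: "lab s = s1" using ex_lab[OF t(1), of "{}"] by auto
  obtain t where "lab t = t1" "t1 = length vs \<longrightarrow> t \<noteq> s" using ex_lab[OF t(2), of "{s}"] by auto
  with reach_realizes[OF assms, of "{}" s t] s t x show ?thesis by auto
qed

text \<open>Under the promise \<open>d + 1\<close> every route over the outer path is longer than
  \<open>d\<close>, so \<open>diam_ok\<close> is the plain diameter bound.\<close>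

theorem reach_iff_supergraph: "(\<exists>x\<in>reach. accepting x) \<longleftrightarrow> has_sp_supergraph d G"
proof
  assume "\<exists>x\<in>reach. accepting x"
  then obtain x where x: "x \<in> reach" "accepting x" by blast
  from realizable[OF x(1)] obtain s t H D where H: "two_terminal_sp H s t" "summary_of H s t D = x"
    "diam_ok d (pverts H) (parcs H) s t D" "covered H s t" unfolding realizes_def by blast
  note g = two_terminal_sp_graph[OF H(1)] and pg = two_terminal_sp_pair_graph[OF H(1)]
  have cg: "conn_graph (pverts H) (parcs H)" using g by blast
  have D: "D = d + 1" and S: "\<And>v. v < length vs \<Longrightarrow> vs ! v \<in> inner H s t \<or> v = lab s \<or> v = lab t"
    and e: "lab s < length vs \<and> lab t < length vs \<and> (vs ! lab s, vs ! lab t) \<in> parcs G \<longrightarrow> cap (dst (parcs H) s t) = 1"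
    using x(2) H(2)[symmetric] by (auto simp: summary_of_def)
  have V: "v \<in> inner H s t \<or> v = s \<or> v = t" if "v \<in> pverts G" for v
    using S[of "lab v"] lab_vertex[OF that] lab_eqD[of v s] lab_eqD[of v t] that by auto
  have sy: "sym (parcs H)" using cg by (simp add: conn_graph_def)
  have A: "(u, w) \<in> parcs H" if uw: "(u, w) \<in> parcs G" for u w
  proof -
    have st: "(s, t) \<in> parcs H" if "(s, t) \<in> parcs G"
    proof -
      have "cap (dst (parcs H) s t) = 1" using e G_arcD[OF that] lab_vertex that by auto
      then have "dst (parcs H) s t = 1" by (simp only: cap_eq_1)
      then show ?thesis using cg_dst_1[OF cg, of s t] g by blast
    qed
    \<comment> \<open>An arc of \<open>G\<close> either has an inner end, where coverage applies, or
      joins the two terminals, where acceptance applies.\<close>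
    consider "u \<in> inner H s t" | "w \<in> inner H s t" | "u = s" "w = t" | "u = t" "w = s"
      using V[of u] V[of w] G_arcD[OF uw] by auto
    then show ?thesis
    proof cases
      case 1
      then show ?thesis using H(4) uw by (simp add: covered_def)
    next
      case 2
      then have "(w, u) \<in> parcs H" using H(4) G_sym[OF uw] by (simp add: covered_def)
      then show ?thesis using symD[OF sy] by blast
    next
      case 3
      then show ?thesis using st uw by simp
    next
      case 4
      then show ?thesis using st G_sym[OF uw] symD[OF sy] by simp
    qed
  qed
  have "subgraph (with_proj G) (with_proj H)"
  proof -
    interpret G: pair_graph G by (rule G)
    interpret H: pair_graph H by (rule pg)
    have "pverts G \<subseteq> pverts H" using V g by (auto simp: inner_def)
    moreover have "parcs G \<subseteq> parcs H" using A by auto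
    ultimately show ?thesis unfolding subgraph_def compatible_def
      using G.wf_digraph_axioms H.wf_digraph_axioms by (simp add: wf_digraph_wp_iff)
  qed
  moreover have "diameter H \<le> ereal (real d)"
    unfolding diameter_le_iff[OF pg cg] using H(3) by (auto simp: diam_ok_def D)
  ultimately show "has_sp_supergraph d G"
    unfolding has_sp_supergraph_def series_parallel_def using pg H(1) by blast
next
  assume "has_sp_supergraph d G"
  then obtain H s t where H: "pair_graph H" "subgraph (with_proj G) (with_proj H)" "two_terminal_sp H s t"
    "diameter H \<le> ereal (real d)" unfolding has_sp_supergraph_def series_parallel_def by blast
  note g = two_terminal_sp_graph[OF H(3)]
  have cg: "conn_graph (pverts H) (parcs H)" using g by blast
  have sub: "pverts G \<subseteq> pverts H" "parcs G \<subseteq> parcs H" using H(2) by (auto simp: subgraph_def)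
  have "diam_ok d (pverts H) (parcs H) s t (d + 1)"
    using H(4) unfolding diameter_le_iff[OF H(1) cg] by (auto simp: diam_ok_def)
  moreover have "covered H s t" using sub by (auto simp: covered_def)
  ultimately have "summary_of H s t (d + 1) \<in> reach" using summary_in_reach[OF H(3)] by simp
  moreover have "accepting (summary_of H s t (d + 1))"
  proof -
    have "vs ! v \<in> inner H s t \<or> v = lab s \<or> v = lab t" if "v < length vs" for v
      using nth_vertex[OF that] sub(1) by (auto simp: inner_def)
    moreover have "cap (dst (parcs H) s t) = 1" if "lab s < length vs" "lab t < length vs"
      "(vs ! lab s, vs ! lab t) \<in> parcs G"
    proof -
      have "(s, t) \<in> parcs G" using that lab_less_iff lab_vertex by metis
      then show ?thesis unfolding cap_eq_1 using cg_dst_1[OF cg, of s t] g sub(2) by blast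
    qed
    ultimately show ?thesis by (simp add: summary_of_def)
  qed
  ultimately show "\<exists>x\<in>reach. accepting x" by blast
qed

end

section \<open>The number of summaries\<close>

context dp
begin

definition nbrs :: "nat \<Rightarrow> nat set" where
  "nbrs i = {j. i < n \<and> j < n \<and> A i j}"

text \<open>The leading 2 is the weight of \<open>n\<close>, the name of all new vertices.\<close>

definition weight_sum :: nat where
  "weight_sum = 2 + (\<Sum>i<n. 2 ^ card (nbrs i))"

text \<open>The square of \<open>weight_sum\<close> counts the choices of terminals and of
  \<open>S\<close>. Of \<open>4 ^ ((d + 2) ^ 2)\<close>, one factor \<open>2 ^ ((d + 2) ^ 2)\<close>
  counts the sets \<open>P\<close>; the other is a generous estimate for the
  \<open>(d + 2) ^ 2\<close> values of \<open>e\<close> and \<open>D\<close>. This shape can be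
  computed by doubling.\<close>

definition bound :: nat where
  "bound = weight_sum ^ 2 * 4 ^ ((d + 2) ^ 2)"

definition separated :: "nat \<Rightarrow> nat \<Rightarrow> nat set set" where
  "separated s t = {S. S \<subseteq> {..<n} - {s, t} \<and> (\<forall>u\<in>S. \<forall>v\<in>nbrs u. v \<in> S \<union> {s, t})}"

text \<open>The factor 2 for the name \<open>n\<close> serves the case of two new terminals, where
  no neighbourhood determines \<open>S\<close>.\<close>

definition weight :: "nat \<Rightarrow> nat" where
  "weight i = 2 ^ card (nbrs i) * (if i = n then 2 else 1)"

lemma finite_nbrs [simp]: "finite (nbrs i)"
  by (rule finite_subset[of _ "{..<n}"]) (auto simp: nbrs_def)

lemma sum_weight: "(\<Sum>i\<le>n. weight i) = weight_sum"
proof -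
  have "nbrs n = {}" by (auto simp: nbrs_def)
  then have "(\<Sum>i\<le>n. weight i) = (\<Sum>i<n. weight i) + 2"
    by (simp add: lessThan_Suc_atMost[symmetric] weight_def)
  also have "(\<Sum>i<n. weight i) = (\<Sum>i<n. 2 ^ card (nbrs i))" by (simp add: weight_def)
  finally show ?thesis by (simp add: weight_sum_def)
qed

text \<open>
  If \<open>G - {s, t}\<close> has no component that is not adjacent to \<open>s\<close> or \<open>t\<close>, a union of components is
  determined by its members among the neighbours of \<open>s\<close> and \<open>t\<close>. This gives the factor
  \<open>2 ^ O(\<Delta>)\<close>.
\<close>

lemma card_separated:
  assumes sy: "\<And>i j. i < n \<Longrightarrow> j < n \<Longrightarrow> A i j \<Longrightarrow> A j i"
    and conn: "\<And>i j. i < n \<Longrightarrow> j < n \<Longrightarrow> (i, j) \<in> {(i, j). j \<in> nbrs i}\<^sup>*"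
    and st: "s \<le> n" "t \<le> n"
  shows "card (separated s t) \<le> weight s * weight t"
proof -
  let ?R = "{(i, j). j \<in> nbrs i}"
  consider r where "r < n" "r \<in> {s, t}" | "s = n" "t = n"
    using st by (metis insertCI le_neq_implies_less)
  then show ?thesis
  proof cases
    case 1
    let ?N = "nbrs s \<union> nbrs t"
    have sub: "S \<subseteq> S'" if S: "S \<in> separated s t" "S' \<in> separated s t" "S \<inter> ?N = S' \<inter> ?N" for S S'
    proof
      fix u assume u: "u \<in> S"
      then have "u < n" using S(1) by (auto simp: separated_def)
      \<comment> \<open>A walk from \<open>u\<close> to the terminal \<open>r\<close> stays in
        \<open>S\<close> until it meets a terminal. The vertex before that lies in
        \<open>?N\<close>, where \<open>S\<close> and \<open>S'\<close> agree, and closure of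
        \<open>S'\<close> carries membership back along the walk to \<open>u\<close>.\<close>
      then have "(u, r) \<in> ?R\<^sup>*" using conn 1(1) by blast
      then show "u \<in> S'" using u
      proof (induction rule: converse_rtrancl_induct)
        case base
        then show ?case using S(1) 1(2) by (auto simp: separated_def)
      next
        case (step u u')
        have u': "u \<in> nbrs u'" "u' \<in> nbrs u" using step.hyps(1) sy by (auto simp: nbrs_def)
        then have "u' \<in> S \<or> u' = s \<or> u' = t" using step.prems S(1) by (auto simp: separated_def)
        then show ?case
        proof (elim disjE)
          assume "u' \<in> S"
          then have "u' \<in> S'" by (rule step.IH)
          then have "u \<in> S' \<union> {s, t}" using S(2) u'(1) by (auto simp: separated_def)
          then show ?thesis using S(1) step.prems by (auto simp: separated_def)
        qed (use S(3) step.prems u'(1) in auto)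
      qed
    qed
    then have "inj_on (\<lambda>S. S \<inter> ?N) (separated s t)"
      by (intro inj_onI equalityI) auto
    moreover have "(\<lambda>S. S \<inter> ?N) ` separated s t \<subseteq> Pow ?N" by auto
    ultimately have "card (separated s t) \<le> card (Pow ?N)" by (intro card_inj_on_le) auto
    also have "\<dots> = 2 ^ card ?N" by (simp add: card_Pow)
    also have "\<dots> \<le> 2 ^ (card (nbrs s) + card (nbrs t))" by (intro power_increasing card_Un_le) auto
    also have "\<dots> = 2 ^ card (nbrs s) * 1 * (2 ^ card (nbrs t) * 1)" by (simp add: power_add)
    also have "\<dots> \<le> weight s * weight t" unfolding weight_def by (intro mult_mono) auto
    finally show ?thesis .
  next
    case 2
    \<comment> \<open>Without a named terminal \<open>S\<close> is closed under adjacency, so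
      connectivity leaves only the empty and the full set.\<close>
    have "S = {..<n}" if S: "S \<in> separated s t" "S \<noteq> {}" for S
    proof -
      from S obtain u where u: "u \<in> S" "u < n" by (auto simp: separated_def)
      have "v \<in> S" if "(u, v) \<in> ?R\<^sup>*" for v
        using that u(1)
      proof (induction rule: rtrancl_induct)
        case (step v w)
        then have "w < n" "w \<in> S \<union> {s, t}" using S(1) by (auto simp: separated_def nbrs_def)
        then show ?case using 2 by auto
      qed
      then show ?thesis using S(1) conn[OF u(2)] by (auto simp: separated_def)
    qed
    then have "separated s t \<subseteq> {{}, {..<n}}" by blast
    then have "card (separated s t) \<le> card {{}, {..<n}}" by (intro card_mono) auto
    also have "\<dots> \<le> 2" by (simp add: card_insert_if)
    also have "\<dots> \<le> weight s * weight t" using 2 by (simp add: weight_def nbrs_def)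
    finally show ?thesis .
  qed
qed

definition universe :: "summary set" where
  "universe = (\<Union>(s, t)\<in>{..n} \<times> {..n}.
     {s} \<times> {t} \<times> {..d + 1} \<times> {..d + 1} \<times> separated s t \<times> Pow ({..d + 1} \<times> {..d + 1}))"

lemma finite_separated: "finite (separated s t)"
  by (rule finite_subset[of _ "Pow {..<n}"]) (auto simp: separated_def)

lemma finite_universe: "finite universe"
  unfolding universe_def using finite_separated by auto

lemma card_universe:
  assumes sy: "\<And>i j. i < n \<Longrightarrow> j < n \<Longrightarrow> A i j \<Longrightarrow> A j i"
    and conn: "\<And>i j. i < n \<Longrightarrow> j < n \<Longrightarrow> (i, j) \<in> {(i, j). j \<in> nbrs i}\<^sup>*"
  shows "card universe \<le> bound"
proof -
  let ?q = "(d + 2) ^ 2"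
  let ?X = "\<lambda>(s, t). {s} \<times> {t} \<times> {..d + 1} \<times> {..d + 1} \<times> separated s t \<times> Pow ({..d + 1} \<times> {..d + 1})"
  have "card universe \<le> (\<Sum>p\<in>{..n} \<times> {..n}. card (?X p))"
    unfolding universe_def by (rule card_UN_le) simp
  also have "\<dots> \<le> (\<Sum>p\<in>{..n} \<times> {..n}. (case p of (s, t) \<Rightarrow> weight s * weight t) * 4 ^ ?q)"
  proof (rule sum_mono)
    fix p assume "p \<in> {..n} \<times> {..n}"
    then obtain s t where p: "p = (s, t)" "s \<le> n" "t \<le> n" by auto
    have "card (?X p) = (d + 2) * ((d + 2) * (card (separated s t) * 2 ^ ((d + 2) * (d + 2))))"
      by (simp add: p card_cartesian_product card_Pow)
    also have "\<dots> = card (separated s t) * (?q * 2 ^ ?q)" by (simp only: power2_eq_square mult_ac)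
    also have "\<dots> \<le> (weight s * weight t) * (2 ^ ?q * 2 ^ ?q)"
      using card_separated[OF sy conn p(2,3)] less_exp[of ?q] by (intro mult_mono) auto
    also have "(2::nat) ^ ?q * 2 ^ ?q = 4 ^ ?q" by (simp add: power_mult_distrib[symmetric])
    finally show "card (?X p) \<le> (case p of (s, t) \<Rightarrow> weight s * weight t) * 4 ^ ?q" by (simp add: p)
  qed
  also have "\<dots> = (\<Sum>p\<in>{..n} \<times> {..n}. (case p of (s, t) \<Rightarrow> weight s * weight t)) * 4 ^ ?q"
    by (simp add: sum_distrib_right)
  also have "(\<Sum>p\<in>{..n} \<times> {..n}. (case p of (s, t) \<Rightarrow> weight s * weight t)) = (\<Sum>s\<le>n. \<Sum>t\<le>n. weight s * weight t)"
    by (simp add: sum.cartesian_product)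
  also have "\<dots> = weight_sum ^ 2" by (simp add: sum_product[symmetric] sum_weight power2_eq_square)
  finally show ?thesis by (simp add: bound_def)
qed

text \<open>One number is to bound every loop of the program: \<open>n + 4 + (d + 2) ^ 2\<close> is
  the length of a record and exceeds the smaller loop bounds, and \<open>weight_sum\<close> is the
  factor of a multiplication carried out by repeated addition.\<close>

lemma bound_ge: "n + 4 + (d + 2) ^ 2 \<le> bound" "weight_sum \<le> bound"
proof -
  let ?q = "(d + 2) ^ 2"
  have "(\<Sum>i<n. 1) \<le> (\<Sum>i<n. (2::nat) ^ card (nbrs i))" by (rule sum_mono) simp
  then have w: "n + 2 \<le> weight_sum" by (simp add: weight_sum_def)
  have q: "?q < 4 ^ ?q" "1 \<le> (4::nat) ^ ?q" 
    using less_le_trans[OF less_exp[of ?q] power_mono[of 2 "4::nat" ?q]] by simp_all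
  have w2: "n + 4 \<le> weight_sum ^ 2" "weight_sum \<le> weight_sum ^ 2"
  proof -
    have "2 * (n + 2) \<le> weight_sum * weight_sum" using w by (intro mult_mono) auto
    then show "n + 4 \<le> weight_sum ^ 2" by (simp add: power2_eq_square)
  qed (simp add: power2_eq_square)
  have "(n + 4) * (1 + ?q) \<le> weight_sum ^ 2 * 4 ^ ?q" using w2 q by (intro mult_mono) auto
  then show "n + 4 + ?q \<le> bound" unfolding bound_def by (simp add: algebra_simps)
  have "weight_sum * 1 \<le> weight_sum ^ 2 * 4 ^ ?q" using w2 q by (intro mult_mono) auto
  then show "weight_sum \<le> bound" unfolding bound_def by simp
qed

end

section \<open>The count for the input graph and its dependence on the degree\<close>

context dp_graph
begin

text \<open>A reachable summary is realised by an actual part, and coverage of that part shows that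
  \<open>S\<close> has neighbours only in itself and in the terminals.\<close>

lemma reach_universe: "reach \<subseteq> universe"
proof
  fix x assume x: "x \<in> reach"
  from realizable[OF x] obtain s t H D where H: "two_terminal_sp H s t" "D \<le> d + 1" "summary_of H s t D = x"
    "covered H s t" unfolding realizes_def by blast
  note g = two_terminal_sp_graph[OF H(1)]
  let ?S = "{i. i < length vs \<and> vs ! i \<in> inner H s t}"
  have "?S \<in> separated (lab s) (lab t)"
    unfolding separated_def
  proof (intro CollectI conjI ballI)
    show "?S \<subseteq> {..<length vs} - {lab s, lab t}"
      using lab_less_iff lab_vertex by (auto simp: inner_def)
    fix u v assume u: "u \<in> ?S" and v: "v \<in> nbrs u"
    then have "(vs ! u, vs ! v) \<in> parcs H" "v < length vs" using H(4) by (auto simp: covered_def nbrs_def)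
    then have "vs ! v \<in> pverts H" "lab (vs ! v) = v" using g nth_vertex by (auto simp: conn_graph_def)
    then show "v \<in> ?S \<union> {lab s, lab t}" using \<open>v < length vs\<close> by (auto simp: inner_def)
  qed
  moreover have "(\<lambda>x. (cap (dst (parcs H) x s), cap (dst (parcs H) x t))) ` pverts H \<in> Pow ({..d + 1} \<times> {..d + 1})"
    by auto
  ultimately show "x \<in> universe"
    unfolding H(3)[symmetric] summary_of_def universe_def using lab_le H(2) by auto
qed

lemma connected_indices:
  assumes "connected (with_proj G)" "i < length vs" "j < length vs"
  shows "(i, j) \<in> {(i, j). j \<in> nbrs i}\<^sup>*"
proof -
  interpret pair_graph G by (rule G)
  have "parcs (mk_symmetric (with_proj G)) \<subseteq> parcs G"
    using G_sym by (auto simp: parcs_mk_symmetric)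
  moreover have "reachable (with_proj (mk_symmetric (with_proj G))) (vs ! i) (vs ! j)"
    using assms nth_vertex by (simp add: connected_def strongly_connected_def)
  ultimately have "(vs ! i, vs ! j) \<in> (parcs G)\<^sup>*"
    unfolding reachable_def with_proj_simps
    by (meson rtrancl_on_rtranclI rtrancl_mono subsetD)
  then have "(lab (vs ! i), lab (vs ! j)) \<in> {(i, j). j \<in> nbrs i}\<^sup>*"
  proof (induction rule: rtrancl_induct)
    case (step u w)
    then have "(lab u, lab w) \<in> {(i, j). j \<in> nbrs i}"
      using G_arcD[OF step.hyps(2)] lab_vertex by (auto simp: nbrs_def)
    with step.IH show ?case by (rule rtrancl_into_rtrancl)
  qed simp
  then show ?thesis using nth_vertex assms(2,3) by simp
qed

lemma card_reach:
  assumes "connected (with_proj G)"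
  shows "card reach \<le> bound"
proof -
  have "card reach \<le> card universe" by (rule card_mono[OF finite_universe reach_universe])
  also have "\<dots> \<le> bound" by (rule card_universe) (use connected_indices[OF assms] G_sym in auto)
  finally show ?thesis .
qed

text \<open>As there is a vertex, the additive 2 is at most twice the main term; hence the factor
  3.\<close>

lemma weight_sum_le:
  assumes "vs \<noteq> []"
  shows "weight_sum \<le> 3 * 2 ^ max_degree G * length vs"
proof -
  interpret pair_graph G by (rule G)
  have deg: "card (nbrs i) \<le> max_degree G" if i: "i < length vs" for i
  proof -
    have "card (nbrs i) \<le> card (out_arcs (with_proj G) (vs ! i))"
    proof (rule card_inj_on_le)
      show "inj_on (\<lambda>j. (vs ! i, vs ! j)) (nbrs i)"
        using vs(1) by (auto simp: inj_on_def nbrs_def nth_eq_iff_index_eq)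
    qed (auto simp: nbrs_def out_arcs_def)
    also have "\<dots> \<le> max_degree G"
      unfolding max_degree_def using nth_vertex[OF i] pair_finite_verts
      by (intro Max_ge) (auto simp: out_degree_def)
    finally show ?thesis .
  qed
  have l: "1 \<le> length vs" using assms by (simp add: Suc_leI)
  have "weight_sum \<le> 2 + (\<Sum>i<length vs. 2 ^ max_degree G)"
    unfolding weight_sum_def using deg by (intro add_left_mono sum_mono power_increasing) auto
  also have "\<dots> = 2 * 1 + length vs * 2 ^ max_degree G" by simp
  also have "2 * 1 \<le> 2 * (length vs * 2 ^ max_degree G)" using l by (intro mult_left_mono) auto
  finally show ?thesis by (simp add: algebra_simps)
qed

end

declare split_paired_Ex [simp del] split_paired_All [simp del]

section \<open>A language of bounded loops\<close>

text \<open>The machine has no multiplication. \<open>EMul\<close> takes a register as its first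
  factor, whose value is the number of additions and is treated like a loop bound.\<close>

datatype aexp =
    EV nat
  | EN nat
  | EAdd aexp aexp
  | ESub aexp aexp
  | ELd aexp
  | EMul nat aexp

datatype com =
    CAsg nat aexp
  | CWr aexp aexp
  | CSeq com com (infixr ";;" 60)
  | CIf aexp com com
  | CFor nat nat com

primrec aval :: "aexp \<Rightarrow> state \<Rightarrow> nat" where
  "aval (EV x) \<sigma> = fst \<sigma> x"
| "aval (EN c) \<sigma> = c"
| "aval (EAdd a b) \<sigma> = aval a \<sigma> + aval b \<sigma>"
| "aval (ESub a b) \<sigma> = aval a \<sigma> - aval b \<sigma>"
| "aval (ELd a) \<sigma> = snd \<sigma> (aval a \<sigma>)"
| "aval (EMul y a) \<sigma> = fst \<sigma> y * aval a \<sigma>"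

definition upd :: "nat \<Rightarrow> nat \<Rightarrow> state \<Rightarrow> state" where
  "upd x v \<sigma> = ((fst \<sigma>)(x := v), snd \<sigma>)"

text \<open>Bounded loops always terminate, so the semantics is a total function. The bound of
  \<open>CFor\<close> is read once at the start, and the counter is set afresh before each
  round.\<close>

primrec sem :: "com \<Rightarrow> state \<Rightarrow> state" where
  "sem (CAsg x e) \<sigma> = upd x (aval e \<sigma>) \<sigma>"
| "sem (CWr a e) \<sigma> = (fst \<sigma>, (snd \<sigma>)(aval a \<sigma> := aval e \<sigma>))"
| "sem (c ;; c') \<sigma> = sem c' (sem c \<sigma>)"
| "sem (CIf e c c') \<sigma> = (if aval e \<sigma> \<noteq> 0 then sem c \<sigma> else sem c' \<sigma>)"
| "sem (CFor x y c) \<sigma> = fold (\<lambda>i \<sigma>. sem c (upd x i \<sigma>)) [0..<fst \<sigma> y] \<sigma>"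

primrec evars :: "aexp \<Rightarrow> nat set" where
  "evars (EV x) = {x}"
| "evars (EN c) = {}"
| "evars (EAdd a b) = evars a \<union> evars b"
| "evars (ESub a b) = evars a \<union> evars b"
| "evars (ELd a) = evars a"
| "evars (EMul y a) = insert y (evars a)"

primrec eloops :: "aexp \<Rightarrow> nat set" where
  "eloops (EV x) = {}"
| "eloops (EN c) = {}"
| "eloops (EAdd a b) = eloops a \<union> eloops b"
| "eloops (ESub a b) = eloops a \<union> eloops b"
| "eloops (ELd a) = eloops a"
| "eloops (EMul y a) = insert y (eloops a)"

primrec cvars :: "com \<Rightarrow> nat set" where
  "cvars (CAsg x e) = insert x (evars e)"
| "cvars (CWr a e) = evars a \<union> evars e"
| "cvars (c ;; c') = cvars c \<union> cvars c'"
| "cvars (CIf e c c') = evars e \<union> cvars c \<union> cvars c'"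
| "cvars (CFor x y c) = insert x (insert y (cvars c))"

primrec cloops :: "com \<Rightarrow> nat set" where
  "cloops (CAsg x e) = eloops e"
| "cloops (CWr a e) = eloops a \<union> eloops e"
| "cloops (c ;; c') = cloops c \<union> cloops c'"
| "cloops (CIf e c c') = eloops e \<union> cloops c \<union> cloops c'"
| "cloops (CFor x y c) = insert y (cloops c)"

primrec asgd :: "com \<Rightarrow> nat set" where
  "asgd (CAsg x e) = {x}"
| "asgd (CWr a e) = {}"
| "asgd (c ;; c') = asgd c \<union> asgd c'"
| "asgd (CIf e c c') = asgd c \<union> asgd c'"
| "asgd (CFor x y c) = insert x (asgd c)"

lemma upd_simps [simp]: "fst (upd x v \<sigma>) = (fst \<sigma>)(x := v)" "snd (upd x v \<sigma>) = snd \<sigma>"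
  by (simp_all add: upd_def)

lemma sem_frame: "x \<notin> asgd c \<Longrightarrow> fst (sem c \<sigma>) x = fst \<sigma> x"
proof (induction c arbitrary: \<sigma>)
  case (CFor z y c)
  have "fst (fold (\<lambda>i \<sigma>. sem c (upd z i \<sigma>)) is \<sigma>) x = fst \<sigma> x" for "is"
    using CFor by (induction "is" arbitrary: \<sigma>) auto
  then show ?case by simp
qed auto

lemma sem_For:
  assumes "I 0 \<sigma>"
    and "\<And>i \<tau>. i < fst \<sigma> y \<Longrightarrow> I i \<tau> \<Longrightarrow> I (Suc i) (sem c (upd x i \<tau>))"
  shows "I (fst \<sigma> y) (sem (CFor x y c) \<sigma>)"
proof -
  have "j \<le> fst \<sigma> y \<Longrightarrow> I j (fold (\<lambda>i \<sigma>. sem c (upd x i \<sigma>)) [0..<j] \<sigma>)" for j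
    using assms by (induction j) auto
  then show ?thesis by simp
qed

section \<open>Compilation\<close>

text \<open>The result is left in register \<open>t\<close>, and registers above \<open>t\<close>
  are scratch. The machine has no move instruction; copying is zeroing followed by an
  addition.\<close>

primrec cexp :: "aexp \<Rightarrow> nat \<Rightarrow> program" where
  "cexp (EV x) t = Seq (Const t 0) (Add t t x)"
| "cexp (EN c) t = Const t c"
| "cexp (EAdd a b) t = Seq (cexp a t) (Seq (cexp b (t + 1)) (Add t t (t + 1)))"
| "cexp (ESub a b) t = Seq (cexp a t) (Seq (cexp b (t + 1)) (Sub t t (t + 1)))"
| "cexp (ELd a) t = Seq (cexp a t) (Load t t)"
| "cexp (EMul y a) t = Seq (cexp a (t + 1)) (Seq (Const t 0) (Seq (Const (t + 2) 0)
     (Seq (Add (t + 2) (t + 2) y) (Seq (Const (t + 3) 1)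
     (While (t + 2) (Seq (Add t t (t + 1)) (Sub (t + 2) (t + 2) (t + 3))))))))"

text \<open>A loop keeps its counter in \<open>t\<close>, the constant 1 in \<open>t + 1\<close> and
  the remaining rounds in \<open>t + 2\<close>; its body is compiled from \<open>t + 3\<close> on,
  so that these survive.\<close>

primrec compile :: "com \<Rightarrow> nat \<Rightarrow> program" where
  "compile (CAsg x e) t = Seq (cexp e t) (Seq (Const x 0) (Add x x t))"
| "compile (CWr a e) t = Seq (cexp a t) (Seq (cexp e (t + 1)) (Store t (t + 1)))"
| "compile (c ;; c') t = Seq (compile c t) (compile c' t)"
| "compile (CIf e c c') t = Seq (cexp e t) (Cond t (compile c t) (compile c' t))"
| "compile (CFor x y c) t = Seq (Const t 0) (Seq (Const (t + 1) 1) (Seq (Const (t + 2) 0)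
     (Seq (Add (t + 2) (t + 2) y)
     (While (t + 2) (Seq (Const x 0) (Seq (Add x x t) (Seq (compile c (t + 3))
       (Seq (Add t t (t + 1)) (Sub (t + 2) (t + 2) (t + 1))))))))))"

text \<open>For a multiplication: four steps of preparation, the final test, and three steps for
  each of at most \<open>B\<close> additions.\<close>

primrec ecost :: "aexp \<Rightarrow> nat \<Rightarrow> nat" where
  "ecost (EV x) B = 2"
| "ecost (EN c) B = 1"
| "ecost (EAdd a b) B = ecost a B + ecost b B + 1"
| "ecost (ESub a b) B = ecost a B + ecost b B + 1"
| "ecost (ELd a) B = ecost a B + 1"
| "ecost (EMul y a) B = ecost a B + 5 + 3 * B"

text \<open>A loop takes four steps of preparation and a final test; each round adds one test and
  four steps of bookkeeping. A conditional is charged for both branches.\<close>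

primrec ccost :: "com \<Rightarrow> nat \<Rightarrow> nat" where
  "ccost (CAsg x e) B = ecost e B + 2"
| "ccost (CWr a e) B = ecost a B + ecost e B + 1"
| "ccost (c ;; c') B = ccost c B + ccost c' B"
| "ccost (CIf e c c') B = ecost e B + 1 + ccost c B + ccost c' B"
| "ccost (CFor x y c) B = 5 + B * (ccost c B + 5)"

lemma exec_Const: "exec (Const x c) \<sigma> 1 (upd x c \<sigma>)"
  and exec_Add: "exec (Add x y z) \<sigma> 1 (upd x (fst \<sigma> y + fst \<sigma> z) \<sigma>)"
  and exec_Sub: "exec (Sub x y z) \<sigma> 1 (upd x (fst \<sigma> y - fst \<sigma> z) \<sigma>)"
  and exec_Load: "exec (Load x y) \<sigma> 1 (upd x (snd \<sigma> (fst \<sigma> y)) \<sigma>)"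
  and exec_Store: "exec (Store x y) \<sigma> 1 (fst \<sigma>, (snd \<sigma>)(fst \<sigma> x := fst \<sigma> y))"
  by (cases \<sigma>, simp add: upd_def exec.intros(2-6)[simplified])+

lemmas exec_Seq = exec.intros(7)

lemma aval_cong: "\<forall>x\<in>evars e. fst \<sigma> x = fst \<tau> x \<Longrightarrow> snd \<sigma> = snd \<tau> \<Longrightarrow> aval e \<sigma> = aval e \<tau>"
  by (induction e) auto

lemma exec_mul_loop:
  assumes "fst \<sigma> (t + 3) = 1"
  shows "\<exists>\<tau>. exec (While (t + 2) (Seq (Add t t (t + 1)) (Sub (t + 2) (t + 2) (t + 3)))) \<sigma>
      (3 * fst \<sigma> (t + 2) + 1) \<tau> \<and> snd \<tau> = snd \<sigma> \<and>
      fst \<tau> t = fst \<sigma> t + fst \<sigma> (t + 2) * fst \<sigma> (t + 1) \<and> (\<forall>x<t. fst \<tau> x = fst \<sigma> x)"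
  using assms
proof (induction "fst \<sigma> (t + 2)" arbitrary: \<sigma>)
  case 0
  then show ?case using exec.intros(10)[of \<sigma> "t + 2"] by auto
next
  case (Suc j)
  define \<sigma>1 where "\<sigma>1 = upd t (fst \<sigma> t + fst \<sigma> (t + 1)) \<sigma>"
  define \<sigma>2 where "\<sigma>2 = upd (t + 2) (fst \<sigma>1 (t + 2) - fst \<sigma>1 (t + 3)) \<sigma>1"
  have e: "exec (Seq (Add t t (t + 1)) (Sub (t + 2) (t + 2) (t + 3))) \<sigma> (1 + 1) \<sigma>2"
    unfolding \<sigma>1_def \<sigma>2_def by (rule exec_Seq exec_Add exec_Sub)+
  have j: "j = fst \<sigma>2 (t + 2)" "fst \<sigma>2 (t + 3) = 1"
    using Suc.hyps(2) Suc.prems by (simp_all add: \<sigma>1_def \<sigma>2_def)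
  from Suc.hyps(1)[OF this] obtain \<tau> where
    t: "exec (While (t + 2) (Seq (Add t t (t + 1)) (Sub (t + 2) (t + 2) (t + 3)))) \<sigma>2
      (3 * fst \<sigma>2 (t + 2) + 1) \<tau>" "snd \<tau> = snd \<sigma>2"
      "fst \<tau> t = fst \<sigma>2 t + fst \<sigma>2 (t + 2) * fst \<sigma>2 (t + 1)" "\<forall>x<t. fst \<tau> x = fst \<sigma>2 x"
    by auto
  have nz: "fst \<sigma> (t + 2) \<noteq> 0" using Suc.hyps(2) by simp
  from exec.intros(11)[OF this e t(1)]
  have "exec (While (t + 2) (Seq (Add t t (t + 1)) (Sub (t + 2) (t + 2) (t + 3)))) \<sigma>
      (3 * fst \<sigma> (t + 2) + 1) \<tau>"
    unfolding j(1)[symmetric] Suc.hyps(2)[symmetric] by (simp add: numeral_3_eq_3)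
  moreover have "fst \<tau> t = fst \<sigma> t + fst \<sigma> (t + 2) * fst \<sigma> (t + 1)"
  proof -
    have "fst \<sigma>2 t = fst \<sigma> t + fst \<sigma> (t + 1)" "fst \<sigma>2 (t + 1) = fst \<sigma> (t + 1)"
      by (simp_all add: \<sigma>1_def \<sigma>2_def)
    then show ?thesis using t(3) unfolding j(1)[symmetric] Suc.hyps(2)[symmetric] by simp
  qed
  ultimately show ?case using t(2,4) by (intro exI[of _ \<tau>]) (auto simp: \<sigma>1_def \<sigma>2_def)
qed

lemma eloops_evars: "eloops e \<subseteq> evars e"
  by (induction e) auto

text \<open>That registers below \<open>t\<close> are kept lets the first operand wait in
  \<open>t\<close> while the second is evaluated at \<open>t + 1\<close>.\<close>

lemma exec_cexp:
  assumes "\<forall>x\<in>evars e. x < t" "\<forall>y\<in>eloops e. fst \<sigma> y \<le> B"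
  shows "\<exists>k \<tau>. exec (cexp e t) \<sigma> k \<tau> \<and> k \<le> ecost e B \<and> snd \<tau> = snd \<sigma> \<and>
    fst \<tau> t = aval e \<sigma> \<and> (\<forall>x<t. fst \<tau> x = fst \<sigma> x)"
  using assms
proof (induction e arbitrary: t \<sigma>)
  case (EV x)
  have "exec (cexp (EV x) t) \<sigma> (1 + 1) (upd t (fst (upd t 0 \<sigma>) t + fst (upd t 0 \<sigma>) x) (upd t 0 \<sigma>))"
    by (simp only: cexp.simps) (rule exec_Seq exec_Const exec_Add)+
  then show ?case using EV by (intro exI conjI) (assumption, auto)
next
  case (EN c)
  then show ?case using exec_Const[of t c \<sigma>] by (intro exI conjI) (simp, auto)
next
  case (EAdd a b)
  obtain k1 s1 where 1: "exec (cexp a t) \<sigma> k1 s1" "k1 \<le> ecost a B" "snd s1 = snd \<sigma>"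
    "fst s1 t = aval a \<sigma>" "\<forall>x<t. fst s1 x = fst \<sigma> x" using EAdd.IH(1)[of t \<sigma>] EAdd.prems by auto
  have p: "\<forall>x\<in>evars b. x < t + 1" "\<forall>y\<in>eloops b. fst s1 y \<le> B"
    using EAdd.prems 1(5) eloops_evars[of b] by (auto simp: less_Suc_eq)
  obtain k2 s2 where 2: "exec (cexp b (t + 1)) s1 k2 s2" "k2 \<le> ecost b B" "snd s2 = snd s1"
    "fst s2 (t + 1) = aval b s1" "\<forall>x<t + 1. fst s2 x = fst s1 x"
    using EAdd.IH(2)[OF p] by blast
  have b: "aval b s1 = aval b \<sigma>" using 1 EAdd.prems by (intro aval_cong) auto
  have "exec (cexp (EAdd a b) t) \<sigma> (k1 + (k2 + 1)) (upd t (fst s2 t + fst s2 (t + 1)) s2)"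
    by (simp only: cexp.simps) (rule exec_Seq 1(1) 2(1) exec_Add)+
  then show ?case using 1 2 b by (intro exI conjI) (assumption, auto)
next
  case (ESub a b)
  obtain k1 s1 where 1: "exec (cexp a t) \<sigma> k1 s1" "k1 \<le> ecost a B" "snd s1 = snd \<sigma>"
    "fst s1 t = aval a \<sigma>" "\<forall>x<t. fst s1 x = fst \<sigma> x" using ESub.IH(1)[of t \<sigma>] ESub.prems by auto
  have p: "\<forall>x\<in>evars b. x < t + 1" "\<forall>y\<in>eloops b. fst s1 y \<le> B"
    using ESub.prems 1(5) eloops_evars[of b] by (auto simp: less_Suc_eq)
  obtain k2 s2 where 2: "exec (cexp b (t + 1)) s1 k2 s2" "k2 \<le> ecost b B" "snd s2 = snd s1"
    "fst s2 (t + 1) = aval b s1" "\<forall>x<t + 1. fst s2 x = fst s1 x"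
    using ESub.IH(2)[OF p] by blast
  have b: "aval b s1 = aval b \<sigma>" using 1 ESub.prems by (intro aval_cong) auto
  have "exec (cexp (ESub a b) t) \<sigma> (k1 + (k2 + 1)) (upd t (fst s2 t - fst s2 (t + 1)) s2)"
    by (simp only: cexp.simps) (rule exec_Seq 1(1) 2(1) exec_Sub)+
  then show ?case using 1 2 b by (intro exI conjI) (assumption, auto)
next
  case (ELd a)
  obtain k1 s1 where 1: "exec (cexp a t) \<sigma> k1 s1" "k1 \<le> ecost a B" "snd s1 = snd \<sigma>"
    "fst s1 t = aval a \<sigma>" "\<forall>x<t. fst s1 x = fst \<sigma> x" using ELd.IH[of t \<sigma>] ELd.prems by auto
  have "exec (cexp (ELd a) t) \<sigma> (k1 + 1) (upd t (snd s1 (fst s1 t)) s1)"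
    by (simp only: cexp.simps) (rule exec_Seq 1(1) exec_Load)+
  then show ?case using 1 by (intro exI conjI) (assumption, auto)
next
  case (EMul y a)
  obtain k1 s1 where 1: "exec (cexp a (t + 1)) \<sigma> k1 s1" "k1 \<le> ecost a B" "snd s1 = snd \<sigma>"
    "fst s1 (t + 1) = aval a \<sigma>" "\<forall>x<t + 1. fst s1 x = fst \<sigma> x"
    using EMul.IH[of "t + 1" \<sigma>] EMul.prems by (auto simp: less_Suc_eq)
  define s2 where "s2 = upd t 0 s1"
  define s3 where "s3 = upd (t + 2) 0 s2"
  define s4 where "s4 = upd (t + 2) (fst s3 (t + 2) + fst s3 y) s3"
  define s5 where "s5 = upd (t + 3) 1 s4"
  have "fst s5 (t + 3) = 1" by (simp add: s5_def)
  from exec_mul_loop[OF this] obtain \<tau> where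
    t: "exec (While (t + 2) (Seq (Add t t (t + 1)) (Sub (t + 2) (t + 2) (t + 3)))) s5
      (3 * fst s5 (t + 2) + 1) \<tau>" "snd \<tau> = snd s5"
      "fst \<tau> t = fst s5 t + fst s5 (t + 2) * fst s5 (t + 1)" "\<forall>x<t. fst \<tau> x = fst s5 x" by blast
  have y: "y < t" "fst \<sigma> y \<le> B" using EMul.prems by auto
  have v: "fst s5 (t + 2) = fst \<sigma> y"
    using y 1(5) by (simp add: s5_def s4_def s3_def s2_def)
  have "exec (cexp (EMul y a) t) \<sigma> (k1 + (1 + (1 + (1 + (1 + (3 * fst s5 (t + 2) + 1)))))) \<tau>"
    unfolding cexp.simps
    by (rule exec_Seq[OF 1(1) exec_Seq[OF exec_Const[of t 0 s1, folded s2_def]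
          exec_Seq[OF exec_Const[of "t + 2" 0 s2, folded s3_def]
          exec_Seq[OF exec_Add[of "t + 2" "t + 2" y s3, folded s4_def]
          exec_Seq[OF exec_Const[of "t + 3" 1 s4, folded s5_def] t(1)]]]]])
  moreover have "fst \<tau> t = aval (EMul y a) \<sigma>"
    using t(3) 1 v y by (simp add: s5_def s4_def s3_def s2_def)
  moreover have "k1 + (1 + (1 + (1 + (1 + (3 * fst s5 (t + 2) + 1))))) \<le> ecost (EMul y a) B"
    using 1(2) y(2) unfolding v by simp
  moreover have "snd \<tau> = snd \<sigma>" "\<forall>x<t. fst \<tau> x = fst \<sigma> x"
    using 1 t(2,4) by (auto simp: s5_def s4_def s3_def s2_def)
  ultimately show ?case by blast
qed

text \<open>The registers from \<open>K\<close> on are temporaries of the compiled code.\<close>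

definition simul :: "nat \<Rightarrow> state \<Rightarrow> state \<Rightarrow> bool" where
  "simul K \<sigma> \<rho> \<longleftrightarrow> snd \<rho> = snd \<sigma> \<and> (\<forall>x<K. fst \<rho> x = fst \<sigma> x)"

lemma simul_aval: "simul K \<sigma> \<rho> \<Longrightarrow> \<forall>x\<in>evars e. x < K \<Longrightarrow> aval e \<rho> = aval e \<sigma>"
  unfolding simul_def by (intro aval_cong) auto

lemma exec_cexp_simul:
  assumes "\<forall>x\<in>evars e. x < K" "K \<le> t" "\<forall>y\<in>eloops e. fst \<sigma> y \<le> B" "simul K \<sigma> \<rho>"
  shows "\<exists>k \<tau>. exec (cexp e t) \<rho> k \<tau> \<and> k \<le> ecost e B \<and> simul K \<sigma> \<tau> \<and>
    fst \<tau> t = aval e \<sigma> \<and> (\<forall>x<t. fst \<tau> x = fst \<rho> x)"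
proof -
  have "\<forall>y\<in>eloops e. fst \<rho> y \<le> B" using assms eloops_evars[of e] by (auto simp: simul_def)
  with exec_cexp[of e t \<rho> B] assms obtain k \<tau> where
    t: "exec (cexp e t) \<rho> k \<tau>" "k \<le> ecost e B" "snd \<tau> = snd \<rho>" "fst \<tau> t = aval e \<rho>" "\<forall>x<t. fst \<tau> x = fst \<rho> x"
    by force
  have "simul K \<sigma> \<tau>" using t assms(2,4) by (auto simp: simul_def)
  with t simul_aval[OF assms(4,1)] show ?thesis by auto
qed

text \<open>Since \<open>c\<close> assigns none of its loop bounds, their initial values remain
  valid throughout and give the time bound. The last conjunct protects the control registers of
  enclosing loops.\<close>

lemma exec_compile:
  assumes "\<forall>x\<in>cvars c. x < K" "K \<le> t" "\<forall>y\<in>cloops c. fst \<sigma> y \<le> B" "cloops c \<inter> asgd c = {}"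
    and "simul K \<sigma> \<rho>"
  shows "\<exists>k \<tau>. exec (compile c t) \<rho> k \<tau> \<and> k \<le> ccost c B \<and> simul K (sem c \<sigma>) \<tau> \<and>
    (\<forall>x. K \<le> x \<and> x < t \<longrightarrow> fst \<tau> x = fst \<rho> x)"
  using assms
proof (induction c arbitrary: t \<sigma> \<rho>)
  case (CAsg x e)
  then obtain k \<tau> where t: "exec (cexp e t) \<rho> k \<tau>" "k \<le> ecost e B" "simul K \<sigma> \<tau>"
    "fst \<tau> t = aval e \<sigma>" "\<forall>x<t. fst \<tau> x = fst \<rho> x"
    using exec_cexp_simul[of e K t \<sigma> B \<rho>] by auto
  have "exec (compile (CAsg x e) t) \<rho> (k + (1 + 1)) (upd x (fst (upd x 0 \<tau>) x + fst (upd x 0 \<tau>) t) (upd x 0 \<tau>))"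
    by (simp only: compile.simps) (rule exec_Seq t(1) exec_Const exec_Add)+
  then show ?case using t CAsg.prems by (intro exI conjI) (assumption, auto simp: simul_def)
next
  case (CWr a e)
  obtain k \<tau> where t: "exec (cexp a t) \<rho> k \<tau>" "k \<le> ecost a B" "simul K \<sigma> \<tau>"
    "fst \<tau> t = aval a \<sigma>" "\<forall>x<t. fst \<tau> x = fst \<rho> x"
    using exec_cexp_simul[of a K t \<sigma> B \<rho>] CWr.prems by auto
  obtain k' \<tau>' where t': "exec (cexp e (t + 1)) \<tau> k' \<tau>'" "k' \<le> ecost e B" "simul K \<sigma> \<tau>'"
    "fst \<tau>' (t + 1) = aval e \<sigma>" "\<forall>x<t + 1. fst \<tau>' x = fst \<tau> x"
    using exec_cexp_simul[of e K "t + 1" \<sigma> B \<tau>] CWr.prems t by auto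
  have "exec (compile (CWr a e) t) \<rho> (k + (k' + 1)) (fst \<tau>', (snd \<tau>')(fst \<tau>' t := fst \<tau>' (t + 1)))"
    by (simp only: compile.simps) (rule exec_Seq t(1) t'(1) exec_Store)+
  then show ?case using t t' by (intro exI conjI) (assumption, auto simp: simul_def)
next
  case (CSeq c1 c2)
  have p: "\<forall>x\<in>cvars c1. x < K" "\<forall>x\<in>cvars c2. x < K" "\<forall>y\<in>cloops c1. fst \<sigma> y \<le> B"
    "cloops c1 \<inter> asgd c1 = {}" "cloops c2 \<inter> asgd c2 = {}" using CSeq.prems(1,3,4) by auto
  obtain k \<tau> where t: "exec (compile c1 t) \<rho> k \<tau>" "k \<le> ccost c1 B" "simul K (sem c1 \<sigma>) \<tau>"
    "\<forall>x. K \<le> x \<and> x < t \<longrightarrow> fst \<tau> x = fst \<rho> x"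
    using CSeq.IH(1)[OF p(1) CSeq.prems(2) p(3,4) CSeq.prems(5)] by blast
  have f: "\<forall>y\<in>cloops c2. fst (sem c1 \<sigma>) y \<le> B"
  proof
    fix y assume y: "y \<in> cloops c2"
    then have "y \<notin> asgd c1" using CSeq.prems(4) by auto
    then show "fst (sem c1 \<sigma>) y \<le> B" using CSeq.prems(3) y by (simp add: sem_frame)
  qed
  obtain k' \<tau>' where t': "exec (compile c2 t) \<tau> k' \<tau>'" "k' \<le> ccost c2 B" "simul K (sem c2 (sem c1 \<sigma>)) \<tau>'"
    "\<forall>x. K \<le> x \<and> x < t \<longrightarrow> fst \<tau>' x = fst \<tau> x"
    using CSeq.IH(2)[OF p(2) CSeq.prems(2) f p(5) t(3)] by blast
  show ?case using exec_Seq[OF t(1) t'(1)] t t' by (intro exI conjI) (simp, auto)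
next
  case (CIf e c1 c2)
  have p: "\<forall>x\<in>cvars c1. x < K" "\<forall>x\<in>cvars c2. x < K" "\<forall>y\<in>cloops c1. fst \<sigma> y \<le> B"
    "\<forall>y\<in>cloops c2. fst \<sigma> y \<le> B" "cloops c1 \<inter> asgd c1 = {}" "cloops c2 \<inter> asgd c2 = {}"
    using CIf.prems(1,3,4) by auto
  obtain k \<tau> where t: "exec (cexp e t) \<rho> k \<tau>" "k \<le> ecost e B" "simul K \<sigma> \<tau>"
    "fst \<tau> t = aval e \<sigma>" "\<forall>x<t. fst \<tau> x = fst \<rho> x"
    using exec_cexp_simul[of e K t \<sigma> B \<rho>] CIf.prems by auto
  show ?case
  proof (cases "aval e \<sigma> = 0")
    case True
    obtain k' \<tau>' where t': "exec (compile c2 t) \<tau> k' \<tau>'" "k' \<le> ccost c2 B" "simul K (sem c2 \<sigma>) \<tau>'"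
      "\<forall>x. K \<le> x \<and> x < t \<longrightarrow> fst \<tau>' x = fst \<tau> x"
      using CIf.IH(2)[OF p(2) CIf.prems(2) p(4,6) t(3)] by blast
    have "exec (Cond t (compile c1 t) (compile c2 t)) \<tau> (1 + k') \<tau>'"
      by (rule exec.intros(9)) (use t t' True in auto)
    from exec_Seq[OF t(1) this] show ?thesis using t t' True by (intro exI conjI) (simp, auto)
  next
    case False
    obtain k' \<tau>' where t': "exec (compile c1 t) \<tau> k' \<tau>'" "k' \<le> ccost c1 B" "simul K (sem c1 \<sigma>) \<tau>'"
      "\<forall>x. K \<le> x \<and> x < t \<longrightarrow> fst \<tau>' x = fst \<tau> x"
      using CIf.IH(1)[OF p(1) CIf.prems(2) p(3,5) t(3)] by blast
    have "exec (Cond t (compile c1 t) (compile c2 t)) \<tau> (1 + k') \<tau>'"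
      by (rule exec.intros(8)) (use t t' False in auto)
    from exec_Seq[OF t(1) this] show ?thesis using t t' False by (intro exI conjI) (simp, auto)
  qed
next
  case (CFor x y c)
  let ?body = "Seq (Const x 0) (Seq (Add x x t) (Seq (compile c (t + 3))
       (Seq (Add t t (t + 1)) (Sub (t + 2) (t + 2) (t + 1)))))"
  let ?f = "\<lambda>i \<sigma>. sem c (upd x i \<sigma>)"
  have x: "x < K" "y < K" "K \<le> t" using CFor.prems by auto
  have p: "\<forall>x\<in>cvars c. x < K" "K \<le> t + 3" "cloops c \<inter> asgd c = {}" using CFor.prems by auto
  \<comment> \<open>Induction on the remaining rounds \<open>j\<close>, with the counter starting at
    an arbitrary \<open>i\<close>, because state and counter change from round to round.\<close>
  have loop: "\<exists>k \<tau>'. exec (While (t + 2) ?body) \<tau> k \<tau>' \<and> k \<le> 1 + j * (ccost c B + 5) \<and>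
      simul K (fold ?f [i..<i + j] \<sigma>) \<tau>' \<and> (\<forall>x. K \<le> x \<and> x < t \<longrightarrow> fst \<tau>' x = fst \<tau> x)"
    if "simul K \<sigma> \<tau>" "fst \<tau> t = i" "fst \<tau> (t + 1) = 1" "fst \<tau> (t + 2) = j"
      "\<forall>y\<in>cloops c. fst \<sigma> y \<le> B" for i j \<sigma> \<tau>
    using that
  proof (induction j arbitrary: i \<sigma> \<tau>)
    case 0
    then show ?case using exec.intros(10)[of \<tau> "t + 2" ?body] by auto
  next
    case (Suc j)
    define \<tau>1 where "\<tau>1 = upd x 0 \<tau>"
    define \<tau>2 where "\<tau>2 = upd x (fst \<tau>1 x + fst \<tau>1 t) \<tau>1"
    have s2: "simul K (upd x i \<sigma>) \<tau>2" "fst \<tau>2 t = i" "fst \<tau>2 (t + 1) = 1" "fst \<tau>2 (t + 2) = Suc j"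
      "\<forall>x. K \<le> x \<and> x < t \<longrightarrow> fst \<tau>2 x = fst \<tau> x"
      using Suc.prems x by (auto simp: \<tau>1_def \<tau>2_def simul_def)
    have "\<forall>y\<in>cloops c. fst (upd x i \<sigma>) y \<le> B" using Suc.prems(5) CFor.prems(4) by auto
    then obtain k \<tau>3 where t3: "exec (compile c (t + 3)) \<tau>2 k \<tau>3" "k \<le> ccost c B"
      "simul K (?f i \<sigma>) \<tau>3" "\<forall>x. K \<le> x \<and> x < t + 3 \<longrightarrow> fst \<tau>3 x = fst \<tau>2 x"
      using CFor.IH[OF p(1,2) _ p(3) s2(1)] by blast
    define \<tau>4 where "\<tau>4 = upd t (fst \<tau>3 t + fst \<tau>3 (t + 1)) \<tau>3"
    define \<tau>5 where "\<tau>5 = upd (t + 2) (fst \<tau>4 (t + 2) - fst \<tau>4 (t + 1)) \<tau>4"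
    have e: "exec ?body \<tau> (1 + (1 + (k + (1 + 1)))) \<tau>5"
      by (rule exec_Seq[OF exec_Const[of x 0 \<tau>, folded \<tau>1_def]
            exec_Seq[OF exec_Add[of x x t \<tau>1, folded \<tau>2_def]
            exec_Seq[OF t3(1) exec_Seq[OF exec_Add[of t t "t + 1" \<tau>3, folded \<tau>4_def]
              exec_Sub[of "t + 2" "t + 2" "t + 1" \<tau>4, folded \<tau>5_def]]]]])
    have s5: "simul K (?f i \<sigma>) \<tau>5" "fst \<tau>5 t = Suc i" "fst \<tau>5 (t + 1) = 1" "fst \<tau>5 (t + 2) = j"
      "\<forall>x. K \<le> x \<and> x < t \<longrightarrow> fst \<tau>5 x = fst \<tau> x"
      using s2 t3 x by (auto simp: \<tau>4_def \<tau>5_def simul_def)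
    have "\<forall>y\<in>cloops c. fst (?f i \<sigma>) y \<le> B"
    proof
      fix z assume z: "z \<in> cloops c"
      then have "z \<notin> asgd c" "z \<noteq> x" using CFor.prems(4) by auto
      then show "fst (?f i \<sigma>) z \<le> B" using Suc.prems(5) z by (simp add: sem_frame)
    qed
    from Suc.IH[OF s5(1-4) this] obtain k' \<tau>6 where t6: "exec (While (t + 2) ?body) \<tau>5 k' \<tau>6"
      "k' \<le> 1 + j * (ccost c B + 5)" "simul K (fold ?f [Suc i..<Suc i + j] (?f i \<sigma>)) \<tau>6"
      "\<forall>x. K \<le> x \<and> x < t \<longrightarrow> fst \<tau>6 x = fst \<tau>5 x" by auto
    have nz: "fst \<tau> (t + 2) \<noteq> 0" using Suc.prems(4) by simp
    have "fold ?f [i..<i + Suc j] \<sigma> = fold ?f [Suc i..<Suc i + j] (?f i \<sigma>)"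
      by (simp add: upt_conv_Cons del: upt_Suc)
    with exec.intros(11)[OF nz e t6(1)] t6 s5(5) t3(2) show ?case
      by (intro exI conjI) (assumption, auto simp del: upt_Suc)
  qed
  define \<tau>1 where "\<tau>1 = upd t 0 \<rho>"
  define \<tau>2 where "\<tau>2 = upd (t + 1) 1 \<tau>1"
  define \<tau>3 where "\<tau>3 = upd (t + 2) 0 \<tau>2"
  define \<tau>4 where "\<tau>4 = upd (t + 2) (fst \<tau>3 (t + 2) + fst \<tau>3 y) \<tau>3"
  have s4: "simul K \<sigma> \<tau>4" "fst \<tau>4 t = 0" "fst \<tau>4 (t + 1) = 1" "fst \<tau>4 (t + 2) = fst \<sigma> y"
    "\<forall>x. K \<le> x \<and> x < t \<longrightarrow> fst \<tau>4 x = fst \<rho> x"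
    using CFor.prems x by (auto simp: simul_def \<tau>1_def \<tau>2_def \<tau>3_def \<tau>4_def)
  from loop[OF s4(1-4)] CFor.prems(3) obtain k \<tau> where
    t: "exec (While (t + 2) ?body) \<tau>4 k \<tau>" "k \<le> 1 + fst \<sigma> y * (ccost c B + 5)"
      "simul K (fold ?f [0..<0 + fst \<sigma> y] \<sigma>) \<tau>" "\<forall>x. K \<le> x \<and> x < t \<longrightarrow> fst \<tau> x = fst \<tau>4 x"
    by auto
  have "exec (compile (CFor x y c) t) \<rho> (1 + (1 + (1 + (1 + k)))) \<tau>"
    unfolding compile.simps
    by (rule exec_Seq[OF exec_Const[of t 0 \<rho>, folded \<tau>1_def]
          exec_Seq[OF exec_Const[of "t + 1" 1 \<tau>1, folded \<tau>2_def]
          exec_Seq[OF exec_Const[of "t + 2" 0 \<tau>2, folded \<tau>3_def]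
          exec_Seq[OF exec_Add[of "t + 2" "t + 2" y \<tau>3, folded \<tau>4_def] t(1)]]]])
  moreover have "fst \<sigma> y * (ccost c B + 5) \<le> B * (ccost c B + 5)"
    using CFor.prems(3) by (intro mult_right_mono) auto
  then have "1 + (1 + (1 + (1 + k))) \<le> ccost (CFor x y c) B"
    unfolding ccost.simps using t(2) by linarith
  ultimately show ?case using t(3,4) s4(5) by (intro exI conjI) (assumption, auto)
qed

corollary run_compile:
  assumes "\<forall>x\<in>cvars c. x < K" "\<forall>y\<in>cloops c. fst \<sigma> y \<le> B" "cloops c \<inter> asgd c = {}" "simul K \<sigma> \<rho>"
  obtains k \<tau> where "exec (compile c K) \<rho> k \<tau>" "k \<le> ccost c B" "simul K (sem c \<sigma>) \<tau>"
  using exec_compile[OF assms(1) order_refl assms(2-4)] by blast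

lemma ecost_poly: "\<exists>c. \<forall>B. ecost e B \<le> c * (B + 1)"
proof (induction e)
  case (EAdd a b)
  then obtain c c' where "\<forall>B. ecost a B \<le> c * (B + 1)" "\<forall>B. ecost b B \<le> c' * (B + 1)" by blast
  then have "ecost (EAdd a b) B \<le> (c + c' + 1) * (B + 1)" for B
    using add_mono[of "ecost a B" "c * (B + 1)" "ecost b B" "c' * (B + 1)"] by (simp add: algebra_simps)
  then show ?case by blast
next
  case (ESub a b)
  then obtain c c' where "\<forall>B. ecost a B \<le> c * (B + 1)" "\<forall>B. ecost b B \<le> c' * (B + 1)" by blast
  then have "ecost (ESub a b) B \<le> (c + c' + 1) * (B + 1)" for B
    using add_mono[of "ecost a B" "c * (B + 1)" "ecost b B" "c' * (B + 1)"] by (simp add: algebra_simps)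
  then show ?case by blast
next
  case (ELd a)
  then obtain c where c: "ecost a B \<le> c * (B + 1)" for B by blast
  have "ecost (ELd a) B \<le> (c + 1) * (B + 1)" for B
    using c[of B] by (simp add: algebra_simps)
  then show ?case by blast
next
  case (EMul y a)
  then obtain c where c: "ecost a B \<le> c * (B + 1)" for B by blast
  have "ecost (EMul y a) B \<le> (c + 5) * (B + 1)" for B
    using c[of B] by (simp add: algebra_simps)
  then show ?case by blast
qed (auto intro: exI[of _ 2])

text \<open>For a fixed program a loop multiplies the cost by at most \<open>B\<close> up to
  constants, so the degree is determined by the program text alone.\<close>

lemma ccost_poly: "\<exists>c h. \<forall>B. ccost p B \<le> c * (B + 1) ^ h"
proof -
  have pw: "\<exists>c h. \<forall>B. f B + g B + k \<le> c * (B + 1) ^ h"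
    if "\<exists>c h. \<forall>B. f B \<le> c * (B + 1) ^ h" "\<exists>c h. \<forall>B. g B \<le> c * (B + 1) ^ h"
    for f g :: "nat \<Rightarrow> nat" and k
  proof -
    from that obtain c h c' h' where *: "\<And>B. f B \<le> c * (B + 1) ^ h" "\<And>B. g B \<le> c' * (B + 1) ^ h'"
      by blast
    have "f B + g B + k \<le> (c + c' + k) * (B + 1) ^ (h + h')" for B
    proof -
      have "(B + 1) ^ h \<le> (B + 1) ^ (h + h')" "(B + 1) ^ h' \<le> (B + 1) ^ (h + h')" "1 \<le> (B + 1) ^ (h + h')"
        by (auto intro: power_increasing)
      then have "c * (B + 1) ^ h \<le> c * (B + 1) ^ (h + h')" "c' * (B + 1) ^ h' \<le> c' * (B + 1) ^ (h + h')"
        "k * 1 \<le> k * (B + 1) ^ (h + h')" by (auto intro!: mult_left_mono simp del: One_nat_def)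
      with *(1)[of B] *(2)[of B]
      have "f B + g B + k \<le> c * (B + 1) ^ (h + h') + c' * (B + 1) ^ (h + h') + k * (B + 1) ^ (h + h')"
        by linarith
      then show ?thesis by (simp only: add_mult_distrib)
    qed
    then show ?thesis by blast
  qed
  have e: "\<exists>c h. \<forall>B. ecost a B \<le> c * (B + 1) ^ h" for a
    using ecost_poly[of a] by (metis power_one_right)
  have z: "\<exists>c h. \<forall>B. (0::nat) \<le> c * (B + 1) ^ h" by blast
  show ?thesis
  proof (induction p)
    case (CAsg x a)
    then show ?case using pw[OF e[of a] z, of 2] by simp
  next
    case (CWr a b)
    then show ?case using pw[OF e[of a] e[of b], of 1] by simp
  next
    case (CSeq p1 p2)
    then show ?case using pw[OF CSeq.IH, of 0] by simp
  next
    case (CIf a p1 p2)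
    then show ?case using pw[OF pw[OF e[of a] CIf.IH(1), of 1] CIf.IH(2), of 0] by simp
  next
    case (CFor x y p)
    then obtain c h where *: "\<And>B. ccost p B \<le> c * (B + 1) ^ h" by blast
    have "ccost (CFor x y p) B \<le> (c + 10) * (B + 1) ^ (h + 1)" for B
    proof -
      have 1: "1 \<le> (B + 1) ^ h" by simp
      have "B * (ccost p B + 5) \<le> (B + 1) * ((c + 5) * (B + 1) ^ h)"
        using add_mono[OF *[of B] mult_left_mono[OF 1, of 5]]
        by (intro mult_mono) (auto simp: add_mult_distrib)
      also have "\<dots> = (c + 5) * (B + 1) ^ (h + 1)" by (simp add: algebra_simps)
      moreover have "1 \<le> (B + 1) ^ (h + 1)" by (rule one_le_power) simp
      ultimately have "5 + B * (ccost p B + 5) \<le> 5 * (B + 1) ^ (h + 1) + (c + 5) * (B + 1) ^ (h + 1)"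
        by linarith
      also have "\<dots> = (c + 10) * (B + 1) ^ (h + 1)" by (simp add: add_mult_distrib del: power_Suc)
      finally show ?thesis by simp
    qed
    then show ?case by blast
  qed
qed

section \<open>Program fragments\<close>

text \<open>Nonzero means true, and truncated subtraction does the logic: \<open>1 - a\<close>
  negates, and \<open>a - b\<close> is zero exactly if \<open>a \<le> b\<close>.\<close>

definition enot :: "aexp \<Rightarrow> aexp" where "enot a = ESub (EN 1) a"
definition eand :: "aexp \<Rightarrow> aexp \<Rightarrow> aexp" where "eand a b = enot (EAdd (enot a) (enot b))"
definition eor :: "aexp \<Rightarrow> aexp \<Rightarrow> aexp" where "eor a b = enot (enot (EAdd a b))"
definition ele :: "aexp \<Rightarrow> aexp \<Rightarrow> aexp" where "ele a b = enot (ESub a b)"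
definition eeq :: "aexp \<Rightarrow> aexp \<Rightarrow> aexp" where "eeq a b = enot (EAdd (ESub a b) (ESub b a))"
definition emin :: "aexp \<Rightarrow> aexp \<Rightarrow> aexp" where "emin a b = ESub a (ESub a b)"

lemmas ebool_defs = enot_def eand_def eor_def ele_def eeq_def emin_def

lemma aval_ebool [simp]:
  "aval (enot a) \<sigma> = of_bool (aval a \<sigma> = 0)"
  "aval (eand a b) \<sigma> = of_bool (aval a \<sigma> \<noteq> 0 \<and> aval b \<sigma> \<noteq> 0)"
  "aval (eor a b) \<sigma> = of_bool (aval a \<sigma> \<noteq> 0 \<or> aval b \<sigma> \<noteq> 0)"
  "aval (ele a b) \<sigma> = of_bool (aval a \<sigma> \<le> aval b \<sigma>)"
  "aval (eeq a b) \<sigma> = of_bool (aval a \<sigma> = aval b \<sigma>)"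
  "aval (emin a b) \<sigma> = min (aval a \<sigma>) (aval b \<sigma>)"
  by (auto simp: ebool_defs)

lemma evars_ebool [simp]:
  "evars (enot a) = evars a" "evars (eand a b) = evars a \<union> evars b" "evars (eor a b) = evars a \<union> evars b"
  "evars (ele a b) = evars a \<union> evars b" "evars (eeq a b) = evars a \<union> evars b"
  "evars (emin a b) = evars a \<union> evars b"
  "eloops (enot a) = eloops a" "eloops (eand a b) = eloops a \<union> eloops b" "eloops (eor a b) = eloops a \<union> eloops b"
  "eloops (ele a b) = eloops a \<union> eloops b" "eloops (eeq a b) = eloops a \<union> eloops b"
  "eloops (emin a b) = eloops a \<union> eloops b"
  by (auto simp: ebool_defs)

primrec nest :: "(nat \<times> nat) list \<Rightarrow> com \<Rightarrow> com" where
  "nest [] c = c"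
| "nest (p # l) c = CFor (fst p) (snd p) (nest l c)"

text \<open>A bounded universal quantifier over several counters as a program, with the truth value
  left in \<open>r\<close>. Existential statements are obtained by negation.\<close>

definition call :: "nat \<Rightarrow> (nat \<times> nat) list \<Rightarrow> aexp \<Rightarrow> com" where
  "call r l e = CAsg r (EN 1) ;; nest l (CAsg r (eand (EV r) e))"

primrec allv :: "(nat \<times> nat) list \<Rightarrow> aexp \<Rightarrow> state \<Rightarrow> bool" where
  "allv [] e \<sigma> \<longleftrightarrow> aval e \<sigma> \<noteq> 0"
| "allv (p # l) e \<sigma> \<longleftrightarrow> (\<forall>i<fst \<sigma> (snd p). allv l e (upd (fst p) i \<sigma>))"

lemma asgd_nest [simp]: "asgd (nest l c) = fst ` set l \<union> asgd c"
  by (induction l) auto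

lemma asgd_call [simp]: "asgd (call r l e) = insert r (fst ` set l)"
  by (auto simp: call_def)

lemma allv_cong:
  assumes "\<And>x. x \<in> evars e \<union> snd ` set l \<Longrightarrow> x \<notin> fst ` set l \<Longrightarrow> fst \<sigma> x = fst \<tau> x" "snd \<sigma> = snd \<tau>"
    "fst ` set l \<inter> snd ` set l = {}"
  shows "allv l e \<sigma> \<longleftrightarrow> allv l e \<tau>"
  using assms
proof (induction l arbitrary: \<sigma> \<tau>)
  case Nil
  then show ?case using aval_cong[of e \<sigma> \<tau>] by simp
next
  case (Cons p l)
  have y: "fst \<sigma> (snd p) = fst \<tau> (snd p)" using Cons.prems by auto
  have "allv l e (upd (fst p) i \<sigma>) \<longleftrightarrow> allv l e (upd (fst p) i \<tau>)" for i
    by (rule Cons.IH) (use Cons.prems in auto)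
  then show ?case by (simp add: y)
qed

text \<open>The loops change only \<open>r\<close> and the counters, on whose initial values
  \<open>allv\<close> does not depend. That \<open>r\<close> stays at most 1 makes its final value
  exactly a truth value.\<close>

lemma sem_nest_all:
  assumes "r \<notin> evars e" "r \<notin> fst ` set l" "r \<notin> snd ` set l" "fst ` set l \<inter> snd ` set l = {}"
  shows "snd (sem (nest l (CAsg r (eand (EV r) e))) \<sigma>) = snd \<sigma> \<and>
    (fst (sem (nest l (CAsg r (eand (EV r) e))) \<sigma>) r \<noteq> 0 \<longleftrightarrow> fst \<sigma> r \<noteq> 0 \<and> allv l e \<sigma>) \<and>
    (fst \<sigma> r \<le> 1 \<longrightarrow> fst (sem (nest l (CAsg r (eand (EV r) e))) \<sigma>) r \<le> 1)"
  using assms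
proof (induction l arbitrary: \<sigma>)
  case (Cons p l)
  let ?c = "nest l (CAsg r (eand (EV r) e))"
  have pp: "r \<notin> evars e" "r \<notin> fst ` set l" "r \<notin> snd ` set l" "fst ` set l \<inter> snd ` set l = {}"
    "r \<noteq> fst p" "r \<noteq> snd p" using Cons.prems by auto
  have "(\<forall>x. x \<notin> insert r (fst ` set (p # l)) \<longrightarrow> fst (sem (CFor (fst p) (snd p) ?c) \<sigma>) x = fst \<sigma> x) \<and>
      snd (sem (CFor (fst p) (snd p) ?c) \<sigma>) = snd \<sigma> \<and>
      (fst (sem (CFor (fst p) (snd p) ?c) \<sigma>) r \<noteq> 0 \<longleftrightarrow>
         fst \<sigma> r \<noteq> 0 \<and> (\<forall>i<fst \<sigma> (snd p). allv l e (upd (fst p) i \<sigma>))) \<and>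
      (fst \<sigma> r \<le> 1 \<longrightarrow> fst (sem (CFor (fst p) (snd p) ?c) \<sigma>) r \<le> 1)"
  proof (rule sem_For[where I = "\<lambda>i \<tau>. (\<forall>x. x \<notin> insert r (fst ` set (p # l)) \<longrightarrow> fst \<tau> x = fst \<sigma> x) \<and> snd \<tau> = snd \<sigma> \<and>
      (fst \<tau> r \<noteq> 0 \<longleftrightarrow> fst \<sigma> r \<noteq> 0 \<and> (\<forall>j<i. allv l e (upd (fst p) j \<sigma>))) \<and> (fst \<sigma> r \<le> 1 \<longrightarrow> fst \<tau> r \<le> 1)"])
    fix i \<tau>
    assume i: "i < fst \<sigma> (snd p)"
    assume I: "(\<forall>x. x \<notin> insert r (fst ` set (p # l)) \<longrightarrow> fst \<tau> x = fst \<sigma> x) \<and> snd \<tau> = snd \<sigma> \<and>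
      (fst \<tau> r \<noteq> 0 \<longleftrightarrow> fst \<sigma> r \<noteq> 0 \<and> (\<forall>j<i. allv l e (upd (fst p) j \<sigma>))) \<and> (fst \<sigma> r \<le> 1 \<longrightarrow> fst \<tau> r \<le> 1)"
    have a: "allv l e (upd (fst p) i \<tau>) \<longleftrightarrow> allv l e (upd (fst p) i \<sigma>)"
      by (rule allv_cong) (use I pp Cons.prems in auto)
    note IH = Cons.IH[OF pp(1-4), of "upd (fst p) i \<tau>"]
    show "(\<forall>x. x \<notin> insert r (fst ` set (p # l)) \<longrightarrow> fst (sem ?c (upd (fst p) i \<tau>)) x = fst \<sigma> x) \<and>
      snd (sem ?c (upd (fst p) i \<tau>)) = snd \<sigma> \<and>
      (fst (sem ?c (upd (fst p) i \<tau>)) r \<noteq> 0 \<longleftrightarrow> fst \<sigma> r \<noteq> 0 \<and> (\<forall>j<Suc i. allv l e (upd (fst p) j \<sigma>))) \<and>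
      (fst \<sigma> r \<le> 1 \<longrightarrow> fst (sem ?c (upd (fst p) i \<tau>)) r \<le> 1)"
    proof (intro conjI allI impI)
      fix x assume "x \<notin> insert r (fst ` set (p # l))"
      then show "fst (sem ?c (upd (fst p) i \<tau>)) x = fst \<sigma> x" using I by (simp add: sem_frame)
    next
      show "snd (sem ?c (upd (fst p) i \<tau>)) = snd \<sigma>" using IH I by simp
      show "fst (sem ?c (upd (fst p) i \<tau>)) r \<noteq> 0 \<longleftrightarrow> fst \<sigma> r \<noteq> 0 \<and> (\<forall>j<Suc i. allv l e (upd (fst p) j \<sigma>))"
        using IH I pp(5) a by (auto simp: less_Suc_eq)
      assume "fst \<sigma> r \<le> 1"
      then show "fst (sem ?c (upd (fst p) i \<tau>)) r \<le> 1" using IH I pp(5) by simp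
    qed
  qed simp
  then show ?case unfolding nest.simps allv.simps by blast
qed simp

lemma sem_call:
  assumes "r \<notin> evars e" "r \<notin> fst ` set l" "r \<notin> snd ` set l" "fst ` set l \<inter> snd ` set l = {}"
  shows "snd (sem (call r l e) \<sigma>) = snd \<sigma>"
    and "fst (sem (call r l e) \<sigma>) r = of_bool (allv l e \<sigma>)"
proof -
  let ?\<sigma> = "upd r 1 \<sigma>"
  have "allv l e ?\<sigma> \<longleftrightarrow> allv l e \<sigma>" by (rule allv_cong) (use assms in auto)
  then show "fst (sem (call r l e) \<sigma>) r = of_bool (allv l e \<sigma>)"
    using sem_nest_all[OF assms, of ?\<sigma>] by (auto simp: call_def of_bool_def)
  show "snd (sem (call r l e) \<sigma>) = snd \<sigma>"
    using sem_nest_all[OF assms, of ?\<sigma>] by (simp add: call_def)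
qed

text \<open>
  Registers 2 to 8 and 19 do not change in the main loop, and those from 20 on are temporaries.
\<close>

abbreviation (input) "rn \<equiv> 19 :: nat"
abbreviation (input) "rd1 \<equiv> 2 :: nat"
abbreviation (input) "rd2 \<equiv> 3 :: nat"
abbreviation (input) "rn1 \<equiv> 4 :: nat"
abbreviation (input) "rtwo \<equiv> 5 :: nat"
abbreviation (input) "rQ \<equiv> 6 :: nat"
abbreviation (input) "rW \<equiv> 7 :: nat"
abbreviation (input) "rM \<equiv> 8 :: nat"
abbreviation (input) "rT \<equiv> 9 :: nat"
abbreviation (input) "rlen \<equiv> 10 :: nat"
abbreviation (input) "ri \<equiv> 11 :: nat"
abbreviation (input) "rj \<equiv> 12 :: nat"
abbreviation (input) "ro \<equiv> 13 :: nat"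
abbreviation (input) "rD \<equiv> 14 :: nat"
abbreviation (input) "rx \<equiv> 15 :: nat"
abbreviation (input) "ry \<equiv> 16 :: nat"
abbreviation (input) "rs \<equiv> 17 :: nat"
abbreviation (input) "rt \<equiv> 18 :: nat"
abbreviation (input) "rv \<equiv> 20 :: nat"
abbreviation (input) "ra \<equiv> 21 :: nat"
abbreviation (input) "rb \<equiv> 22 :: nat"
abbreviation (input) "ra' \<equiv> 23 :: nat"
abbreviation (input) "rb' \<equiv> 24 :: nat"
abbreviation (input) "rr \<equiv> 25 :: nat"
abbreviation (input) "rk \<equiv> 26 :: nat"
abbreviation (input) "rw \<equiv> 27 :: nat"
abbreviation (input) "req \<equiv> 28 :: nat"
abbreviation (input) "rfr \<equiv> 29 :: nat"

definition nop :: com where "nop = CAsg rr (EN 0)"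

definition eadr :: "aexp \<Rightarrow> aexp \<Rightarrow> aexp" where
  "eadr i k = EAdd (EAdd (EV rQ) (EMul rW i)) k"

text \<open>Loop bounds must stay constant, so the candidate is compared with all \<open>rM\<close>
  slots; the test against \<open>rlen\<close> discards the slots that are not yet filled.\<close>

definition insert_com :: com where
  "insert_com =
     CAsg rfr (EN 1) ;;
     CFor rk rM
       (call req [(rw, rW)] (eeq (ELd (eadr (EN 0) (EV rw))) (ELd (eadr (EAdd (EV rk) (EN 1)) (EV rw)))) ;;
        CAsg rfr (eand (EV rfr) (enot (eand (ele (EAdd (EV rk) (EN 1)) (EV rlen)) (EV req))))) ;;
     CIf (EV rfr)
       (CFor rw rW (CWr (eadr (EAdd (EV rlen) (EN 1)) (EV rw)) (ELd (eadr (EN 0) (EV rw)))) ;;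
        CAsg rlen (EAdd (EV rlen) (EN 1)))
       nop"

text \<open>\<open>S\<close> and \<open>P\<close> are stored as bit tables. Membership in the new
  \<open>P\<close> needs a quantifier, which an expression cannot contain, so the command
  \<open>pc\<close> runs before \<open>pe\<close> is evaluated.\<close>

definition write_com :: "aexp \<Rightarrow> aexp \<Rightarrow> aexp \<Rightarrow> aexp \<Rightarrow> com \<Rightarrow> aexp \<Rightarrow> com" where
  "write_com hs ht he sv pc pe =
     CWr (EV rQ) hs ;; CWr (EAdd (EV rQ) (EN 1)) ht ;; CWr (EAdd (EV rQ) (EN 2)) he ;;
     CWr (EAdd (EV rQ) (EN 3)) (EV rD) ;;
     CFor rv rn (CWr (EAdd (EV rQ) (EAdd (EN 4) (EV rv))) sv) ;;
     CFor ra rd2 (CFor rb rd2 (pc ;;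
       CWr (EAdd (EV rQ) (EAdd (EAdd (EN 4) (EV rn)) (EAdd (EMul rd2 (EV ra)) (EV rb)))) pe))"

definition comb_com :: "aexp \<Rightarrow> aexp \<Rightarrow> aexp \<Rightarrow> com \<Rightarrow> com" where
  "comb_com gl vx cr wr =
     CIf gl
       (call rr [(rv, rn)] vx ;;
        CIf (EV rr)
          (call rr [(ra, rd2), (rb, rd2), (ra', rd2), (rb', rd2)] cr ;;
           CIf (EV rr) (wr ;; insert_com) nop)
          nop)
       nop"

definition efld :: "nat \<Rightarrow> nat \<Rightarrow> aexp" where
  "efld r k = ELd (EAdd (EV r) (EN k))"

definition eS :: "nat \<Rightarrow> aexp \<Rightarrow> aexp" where
  "eS r v = ELd (EAdd (EV r) (EAdd (EN 4) v))"

definition eP :: "nat \<Rightarrow> aexp \<Rightarrow> aexp \<Rightarrow> aexp" where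
  "eP r a b = ELd (EAdd (EV r) (EAdd (EAdd (EN 4) (EV rn)) (EAdd (EMul rd2 a) b)))"

definition eA :: "aexp \<Rightarrow> aexp \<Rightarrow> aexp" where
  "eA i j = ELd (EAdd (EAdd (EN 2) (EMul rn i)) j)"

definition ecap :: "aexp \<Rightarrow> aexp" where
  "ecap a = emin a (EV rd1)"

text \<open>The memory holds the input below \<open>R 0\<close>, a candidate summary at \<open>R 0\<close>, and the summaries
  found so far at \<open>R 1\<close>, \<open>R 2\<close>, and so on.\<close>

context dp
begin

text \<open>The length of a record: four numbers, \<open>n\<close> bits for \<open>S\<close>, and a
  matrix of bits for \<open>P\<close>.\<close>

definition W :: nat where
  "W = 4 + n + (d + 2) * (d + 2)"

definition R :: "nat \<Rightarrow> nat" where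
  "R i = 2 + n * n + W * i"

fun enc :: "summary \<Rightarrow> nat \<Rightarrow> nat" where
  "enc (s, t, e, D, S, P) k =
     (if k = 0 then s else if k = 1 then t else if k = 2 then e else if k = 3 then D
      else if k < 4 + n then of_bool (k - 4 \<in> S)
      else of_bool (((k - 4 - n) div (d + 2), (k - 4 - n) mod (d + 2)) \<in> P))"

definition holds :: "(nat \<Rightarrow> nat) \<Rightarrow> nat \<Rightarrow> summary \<Rightarrow> bool" where
  "holds m p x \<longleftrightarrow> (\<forall>k<W. m (p + k) = enc x k)"

definition env :: "state \<Rightarrow> bool" where
  "env \<sigma> \<longleftrightarrow> fst \<sigma> rn = n \<and> fst \<sigma> rd1 = d + 1 \<and> fst \<sigma> rd2 = d + 2 \<and> fst \<sigma> rn1 = n + 1 \<and>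
     fst \<sigma> rtwo = 2 \<and> fst \<sigma> rQ = R 0 \<and> fst \<sigma> rW = W \<and> fst \<sigma> rM = bound \<and>
     (\<forall>i<n. \<forall>j<n. snd \<sigma> (2 + n * i + j) = of_bool (A i j))"

text \<open>A distinct list inside \<open>reach\<close> has at most \<open>card reach\<close>
  elements, so loops up to the constant \<open>rM\<close> see every record once
  \<open>card reach \<le> bound\<close> is known.\<close>

definition inv :: "state \<Rightarrow> summary list \<Rightarrow> bool" where
  "inv \<sigma> xs \<longleftrightarrow> env \<sigma> \<and> fst \<sigma> rlen = length xs \<and> distinct xs \<and> set xs \<subseteq> reach \<and>
     (\<forall>i<length xs. holds (snd \<sigma>) (R (Suc i)) (xs ! i))"

text \<open>Code that prepares a candidate may spoil the temporaries and the candidate slot;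
  \<open>inv\<close> depends on neither.\<close>

definition near :: "state \<Rightarrow> state \<Rightarrow> bool" where
  "near \<sigma> \<tau> \<longleftrightarrow> (\<forall>r<20. fst \<tau> r = fst \<sigma> r) \<and> (\<forall>p. p < R 0 \<or> R 1 \<le> p \<longrightarrow> snd \<tau> p = snd \<sigma> p)"

lemma R_Suc: "R (Suc i) = R i + W"
  by (simp add: R_def)

lemma R_mono: "i \<le> j \<Longrightarrow> R i \<le> R j"
  by (simp add: R_def)

lemma R_less: "i < j \<Longrightarrow> R i + W \<le> R j"
  using R_mono[of "Suc i" j] by (simp add: R_Suc)

lemma enc_fields:
  "enc (s, t, e, D, S, P) 0 = s" "enc (s, t, e, D, S, P) (Suc 0) = t"
  "enc (s, t, e, D, S, P) 2 = e" "enc (s, t, e, D, S, P) 3 = D"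
  "v < n \<Longrightarrow> enc (s, t, e, D, S, P) (4 + v) = of_bool (v \<in> S)"
  by auto

lemma enc_P: "b < d + 2 \<Longrightarrow> enc (s, t, e, D, S, P) (4 + n + ((d + 2) * a + b)) = of_bool ((a, b) \<in> P)"
proof -
  assume b: "b < d + 2"
  have "(4 + n + ((d + 2) * a + b)) - 4 - n = (d + 2) * a + b" by simp
  moreover have "((d + 2) * a + b) div (d + 2) = a" "((d + 2) * a + b) mod (d + 2) = b"
    using b by (simp_all del: add_2_eq_Suc' add_2_eq_Suc)
  ultimately show ?thesis by (simp del: add_2_eq_Suc' add_2_eq_Suc)
qed

lemma P_index_less: "a < d + 2 \<Longrightarrow> b < d + 2 \<Longrightarrow> 4 + n + ((d + 2) * a + b) < W"
proof -
  assume ab: "a < d + 2" "b < d + 2"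
  then have "(d + 2) * a + b < (d + 2) * Suc a" by simp
  also have "(d + 2) * Suc a \<le> (d + 2) * (d + 2)" using ab by (intro mult_le_mono2) simp
  finally have "(d + 2) * a + b < (d + 2) * (d + 2)" .
  then show ?thesis unfolding W_def by (intro add_strict_left_mono)
qed

text \<open>A record shows \<open>S\<close> and \<open>P\<close> only within its index ranges. The
  inclusions make this lossless, so summaries can be compared cell by cell.\<close>

lemma enc_inj:
  assumes "S \<subseteq> {..<n}" "S' \<subseteq> {..<n}" "P \<subseteq> {..d + 1} \<times> {..d + 1}" "P' \<subseteq> {..d + 1} \<times> {..d + 1}"
    and eq: "\<And>k. k < W \<Longrightarrow> enc (s, t, e, D, S, P) k = enc (s', t', e', D', S', P') k"
  shows "(s, t, e, D, S, P) = (s', t', e', D', S', P')"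
proof -
  have "4 < W" by (simp add: W_def)
  then have "s = s'" "t = t'" "e = e'" "D = D'" using eq[of 0] eq[of 1] eq[of 2] eq[of 3] by auto
  moreover have "v \<in> S \<longleftrightarrow> v \<in> S'" if "v < n" for v
    using eq[of "4 + v"] that by (simp only: enc_fields) (simp add: W_def of_bool_eq_iff)
  then have "S = S'" using assms(1,2) by blast
  moreover have P: "(a, b) \<in> P \<longleftrightarrow> (a, b) \<in> P'" if "a < d + 2" "b < d + 2" for a b
    using eq[OF P_index_less[OF that]] that(2) by (simp only: enc_P of_bool_eq_iff)
  have "P = P'"
  proof (rule set_eqI)
    fix p :: "nat \<times> nat"
    obtain a b where p: "p = (a, b)" by (cases p)
    have "a < d + 2 \<and> b < d + 2" if "p \<in> P \<union> P'" using that assms(3,4) p by auto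
    then show "p \<in> P \<longleftrightarrow> p \<in> P'" using P p by blast
  qed
  ultimately show ?thesis by simp
qed

lemma near_refl [simp]: "near \<sigma> \<sigma>"
  by (simp add: near_def)

lemma near_env: "near \<sigma> \<tau> \<Longrightarrow> env \<sigma> \<Longrightarrow> env \<tau>"
proof -
  assume *: "near \<sigma> \<tau>" "env \<sigma>"
  have "2 + n * i + j < R 0" if "i < n" "j < n" for i j
  proof -
    have "n * i + j < n * Suc i" using that by simp
    also have "n * Suc i \<le> n * n" using that by (intro mult_le_mono2) simp
    finally have "n * i + j < n * n" .
    then show ?thesis by (simp add: R_def)
  qed
  then show ?thesis using * by (simp add: env_def near_def)
qed

lemma near_holds: "near \<sigma> \<tau> \<Longrightarrow> holds (snd \<sigma>) (R (Suc i)) x \<Longrightarrow> holds (snd \<tau>) (R (Suc i)) x"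
  using R_mono[of 1 "Suc i"] by (simp add: near_def holds_def)

lemma near_inv: "near \<sigma> \<tau> \<Longrightarrow> inv \<sigma> xs \<Longrightarrow> inv \<tau> xs"
  using near_env near_holds by (simp add: inv_def) (simp add: near_def)

lemma near_trans: "near \<sigma> \<tau> \<Longrightarrow> near \<tau> \<rho> \<Longrightarrow> near \<sigma> \<rho>"
  by (simp add: near_def)

lemma near_upd: "near \<sigma> \<tau> \<Longrightarrow> 20 \<le> x \<Longrightarrow> near \<sigma> (upd x v \<tau>)"
  by (simp add: near_def)

lemma near_wr: "near \<sigma> \<tau> \<Longrightarrow> R 0 \<le> p \<Longrightarrow> p < R 1 \<Longrightarrow> near \<sigma> (fst \<tau>, (snd \<tau>)(p := v))"
  by (auto simp: near_def)

lemma near_call: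
  assumes "near \<sigma> \<tau>" "r \<notin> evars e" "r \<notin> fst ` set l" "r \<notin> snd ` set l" "fst ` set l \<inter> snd ` set l = {}"
    "20 \<le> r" "\<forall>x\<in>fst ` set l. 20 \<le> x"
  shows "near \<sigma> (sem (call r l e) \<tau>)"
proof -
  have "fst (sem (call r l e) \<tau>) x = fst \<tau> x" if "x < 20" for x
    by (rule sem_frame) (use that assms(6,7) in auto)
  then show ?thesis using assms(1) sem_call(1)[OF assms(2-5), of \<tau>] by (simp add: near_def)
qed

lemma env_near_regs:
  assumes "env \<sigma>" "near \<sigma> \<tau>"
  shows "fst \<tau> rn = n" "fst \<tau> rd1 = d + 1" "fst \<tau> rd2 = d + 2" "fst \<tau> rQ = R 0" "fst \<tau> rW = W" "fst \<tau> rM = bound"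
  using near_env[OF assms(2,1)] by (simp_all add: env_def)

text \<open>Cells are written in address order, so the number of finished cells is the invariant of
  all loops. The expressions are evaluated while the record is half written, hence they are required
  to be right in every state that is \<open>near\<close> the initial one.\<close>

lemma sem_write:
  assumes env: "env \<sigma>"
    and h: "\<And>\<tau>. near \<sigma> \<tau> \<Longrightarrow> aval hs \<tau> = s \<and> aval ht \<tau> = t \<and> aval he \<tau> = e" "fst \<sigma> rD = D"
    and sv: "\<And>\<tau>. near \<sigma> \<tau> \<Longrightarrow> fst \<tau> rv < n \<Longrightarrow> aval sv \<tau> = of_bool (fst \<tau> rv \<in> S)"
    and pc: "\<And>\<tau>. near \<sigma> \<tau> \<Longrightarrow> fst \<tau> ra < d + 2 \<Longrightarrow> fst \<tau> rb < d + 2 \<Longrightarrow>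
      snd (sem pc \<tau>) = snd \<tau> \<and> aval pe (sem pc \<tau>) = of_bool ((fst \<tau> ra, fst \<tau> rb) \<in> P)"
    and pr: "\<forall>x\<in>asgd pc. 20 \<le> x" "ra \<notin> asgd pc" "rb \<notin> asgd pc"
  shows "near \<sigma> (sem (write_com hs ht he sv pc pe) \<sigma>) \<and>
    holds (snd (sem (write_com hs ht he sv pc pe) \<sigma>)) (R 0) (s, t, e, D, S, P)"
proof -
  let ?z = "(s, t, e, D, S, P)"
  have R1: "R (Suc 0) = R 0 + W" "4 < W" by (simp_all add: R_Suc W_def)
  define I where "I k \<tau> \<longleftrightarrow> near \<sigma> \<tau> \<and> (\<forall>k'<k. snd \<tau> (R 0 + k') = enc ?z k')" for k \<tau>
  have Q: "fst \<tau> rQ = R 0" if "near \<sigma> \<tau>" for \<tau> using env that by (simp add: env_def near_def)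
  have step: "I (Suc k) (fst \<tau>, (snd \<tau>)(R 0 + k := v))"
    if "I k \<tau>" "k < W" "v = enc ?z k" for k \<tau> v
    using that near_wr[of \<sigma> \<tau> "R 0 + k" v] R1 by (auto simp: I_def less_Suc_eq)
  have Iupd: "I k (upd x v \<tau>)" if "I k \<tau>" "20 \<le> x" for k x v \<tau>
    using that near_upd by (simp add: I_def)
  have Iw: "I (Suc k) (sem (CWr (EAdd (EV rQ) a) b) \<tau>)"
    if "I k \<tau>" "aval a \<tau> = k" "k < W" "aval b \<tau> = enc ?z k" for a b k \<tau>
    using step[OF that(1,3,4)] Q[of \<tau>] that(1,2) by (simp add: I_def)
  define \<tau>1 where "\<tau>1 = sem (CWr (EV rQ) hs) \<sigma>"
  define \<tau>2 where "\<tau>2 = sem (CWr (EAdd (EV rQ) (EN 1)) ht) \<tau>1"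
  define \<tau>3 where "\<tau>3 = sem (CWr (EAdd (EV rQ) (EN 2)) he) \<tau>2"
  define \<tau>4 where "\<tau>4 = sem (CWr (EAdd (EV rQ) (EN 3)) (EV rD)) \<tau>3"
  have "I (Suc 0) \<tau>1"
    using step[of 0 \<sigma> s] h(1)[of \<sigma>] Q[of \<sigma>] R1(2) by (simp add: I_def \<tau>1_def)
  then have "I (Suc 1) \<tau>2"
    unfolding \<tau>2_def by (intro Iw) (use h(1)[of \<tau>1] R1(2) in \<open>auto simp: I_def\<close>)
  then have "I (Suc 2) \<tau>3"
    unfolding \<tau>3_def by (intro Iw) (use h(1)[of \<tau>2] R1(2) in \<open>auto simp: I_def numeral_2_eq_2\<close>)
  then have "I (Suc 3) \<tau>4"
    unfolding \<tau>4_def by (intro Iw) (use h(2) R1(2) in \<open>auto simp: I_def near_def numeral_3_eq_3\<close>)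
  then have I4: "I (4 + 0) \<tau>4" by simp
  define \<tau>5 where "\<tau>5 = sem (CFor rv rn (CWr (EAdd (EV rQ) (EAdd (EN 4) (EV rv))) sv)) \<tau>4"
  have "I (4 + fst \<tau>4 rn) \<tau>5"
    unfolding \<tau>5_def
  proof (rule sem_For[where I = "\<lambda>i. I (4 + i)"])
    fix i \<tau> assume i: "i < fst \<tau>4 rn" "I (4 + i) \<tau>"
    have "near \<sigma> \<tau>4" using I4 by (simp add: I_def)
    then have "i < n" using i(1) env_near_regs[OF env] by simp
    then show "I (4 + Suc i) (sem (CWr (EAdd (EV rQ) (EAdd (EN 4) (EV rv))) sv) (upd rv i \<tau>))"
      unfolding add_Suc_right
      by (intro Iw Iupd i(2)) (use sv[of "upd rv i \<tau>"] near_upd[of \<sigma> \<tau> rv i] i(2) in \<open>auto simp: W_def I_def\<close>)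
  qed (rule I4)
  then have I5: "I (4 + n + (d + 2) * 0) \<tau>5"
    using I4 env_near_regs(1)[OF env, of \<tau>4] by (simp add: I_def)
  let ?w = "CWr (EAdd (EV rQ) (EAdd (EAdd (EN 4) (EV rn)) (EAdd (EMul rd2 (EV ra)) (EV rb)))) pe"
  define \<tau>6 where "\<tau>6 = sem (CFor ra rd2 (CFor rb rd2 (pc ;; ?w))) \<tau>5"
  have d2: "fst \<tau>5 rd2 = d + 2" using I5 env_near_regs[OF env, of \<tau>5] by (simp add: I_def)
  have "I (4 + n + (d + 2) * fst \<tau>5 rd2) \<tau>6"
    unfolding \<tau>6_def
  proof (rule sem_For[where I = "\<lambda>i. I (4 + n + (d + 2) * i)"])
    fix i \<tau> assume i: "i < fst \<tau>5 rd2" "I (4 + n + (d + 2) * i) \<tau>"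
    let ?\<tau> = "upd ra i \<tau>"
    have "near \<sigma> ?\<tau>" using i(2) near_upd by (simp add: I_def)
    then have d2': "fst ?\<tau> rd2 = d + 2" by (rule env_near_regs(3)[OF env])
    have "I (4 + n + ((d + 2) * i + fst ?\<tau> rd2)) (sem (CFor rb rd2 (pc ;; ?w)) ?\<tau>) \<and>
        fst (sem (CFor rb rd2 (pc ;; ?w)) ?\<tau>) ra = i"
    proof (rule sem_For[where I = "\<lambda>j \<tau>. I (4 + n + ((d + 2) * i + j)) \<tau> \<and> fst \<tau> ra = i"])
      show "I (4 + n + ((d + 2) * i + 0)) ?\<tau> \<and> fst ?\<tau> ra = i" using Iupd[OF i(2)] by simp
    next
      fix j \<rho> assume j: "j < fst ?\<tau> rd2" "I (4 + n + ((d + 2) * i + j)) \<rho> \<and> fst \<rho> ra = i"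
      let ?\<rho> = "upd rb j \<rho>"
      have ij: "i < d + 2" "j < d + 2" using i(1) d2 j(1) d2' by auto
      have n\<rho>: "near \<sigma> ?\<rho>" "fst ?\<rho> ra = i" "fst ?\<rho> rb = j" using j(2) near_upd by (auto simp: I_def)
      have p: "snd (sem pc ?\<rho>) = snd \<rho>" "aval pe (sem pc ?\<rho>) = of_bool ((i, j) \<in> P)"
        using pc[OF n\<rho>(1)] n\<rho>(2,3) ij by auto
      have r: "\<forall>r<20. fst (sem pc ?\<rho>) r = fst \<rho> r" "fst (sem pc ?\<rho>) ra = i" "fst (sem pc ?\<rho>) rb = j"
      proof -
        show "\<forall>r<20. fst (sem pc ?\<rho>) r = fst \<rho> r"
        proof (intro allI impI)
          fix r :: nat assume r: "r < 20"
          then have "r \<notin> asgd pc" using pr(1) by auto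
          then show "fst (sem pc ?\<rho>) r = fst \<rho> r" using r by (simp add: sem_frame)
        qed
      qed (use pr n\<rho>(2,3) in \<open>simp_all add: sem_frame\<close>)
      have I: "I (4 + n + ((d + 2) * i + j)) (sem pc ?\<rho>)"
        using j(2) r(1) p(1) by (auto simp: I_def near_def)
      have ns: "near \<sigma> (sem pc ?\<rho>)" using I by (simp add: I_def)
      have "I (Suc (4 + n + ((d + 2) * i + j))) (sem ?w (sem pc ?\<rho>))"
      proof (rule Iw[OF I _ P_index_less[OF ij]])
        show "aval pe (sem pc ?\<rho>) = enc ?z (4 + n + ((d + 2) * i + j))"
          unfolding p(2) by (rule enc_P[OF ij(2), symmetric])
      qed (simp add: r env_near_regs[OF env ns])
      then show "I (4 + n + ((d + 2) * i + Suc j)) (sem (pc ;; ?w) ?\<rho>) \<and> fst (sem (pc ;; ?w) ?\<rho>) ra = i"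
        using r by simp
    qed
    then show "I (4 + n + (d + 2) * Suc i) (sem (CFor rb rd2 (pc ;; ?w)) ?\<tau>)"
      unfolding d2' by (simp add: algebra_simps)
  qed (rule I5)
  then have "I W \<tau>6" unfolding d2 W_def .
  moreover have "sem (write_com hs ht he sv pc pe) \<sigma> = \<tau>6"
    by (simp only: write_com_def sem.simps(3) \<tau>6_def \<tau>5_def \<tau>4_def \<tau>3_def \<tau>2_def \<tau>1_def)
  ultimately show ?thesis by (simp add: I_def holds_def)
qed

end

text \<open>The two facts about the graph on which the program relies: the first makes records
  faithful, the second makes \<open>rM\<close> rounds sufficient.\<close>

locale dp_prog = dp +
  assumes reach_universe: "reach \<subseteq> universe" and card_reach: "card reach \<le> bound"
begin

lemma holds_inj:
  assumes "holds m p x" "holds m p' y" "x \<in> reach" "y \<in> reach"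
  shows "(\<forall>k<W. m (p + k) = m (p' + k)) \<longleftrightarrow> x = y"
proof
  assume eq: "\<forall>k<W. m (p + k) = m (p' + k)"
  obtain s t e D S P s' t' e' D' S' P' where xy: "x = (s, t, e, D, S, P)" "y = (s', t', e', D', S', P')"
    by (cases x, cases y)
  have "S \<subseteq> {..<n}" "S' \<subseteq> {..<n}" "P \<subseteq> {..d + 1} \<times> {..d + 1}" "P' \<subseteq> {..d + 1} \<times> {..d + 1}"
    using assms(3,4) reach_universe by (fastforce simp: xy universe_def separated_def)+
  then show "x = y" unfolding xy by (rule enc_inj) (use eq assms(1,2) in \<open>auto simp: holds_def xy\<close>)
qed (use assms in \<open>simp add: holds_def\<close>)

lemma length_le_bound:
  assumes "distinct xs" "set xs \<subseteq> reach"
  shows "length xs \<le> bound"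
proof -
  have "finite reach" using reach_universe finite_universe by (rule finite_subset)
  then have "card (set xs) \<le> card reach" using assms(2) by (intro card_mono)
  then show ?thesis using assms(1) card_reach by (simp add: distinct_card)
qed

definition ins :: "summary \<Rightarrow> summary list \<Rightarrow> summary list" where
  "ins x xs = (if x \<in> set xs then xs else xs @ [x])"

lemma asgd_insert: "asgd insert_com = {rfr, rk, req, rw, rlen, rr}"
  by (auto simp: insert_com_def nop_def)

lemma sem_insert:
  assumes inv: "inv \<sigma> xs" and z: "holds (snd \<sigma>) (R 0) z" "z \<in> reach"
  shows "inv (sem insert_com \<sigma>) (ins z xs)"
proof -
  have env: "env \<sigma>" and len: "fst \<sigma> rlen = length xs" using inv by (auto simp: inv_def)
  let ?e = "eeq (ELd (eadr (EN 0) (EV rw))) (ELd (eadr (EAdd (EV rk) (EN 1)) (EV rw)))"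
  let ?b = "call req [(rw, rW)] ?e ;;
        CAsg rfr (eand (EV rfr) (enot (eand (ele (EAdd (EV rk) (EN 1)) (EV rlen)) (EV req))))"
  define \<tau>0 where "\<tau>0 = upd rfr 1 \<sigma>"
  define \<tau> where "\<tau> = sem (CFor rk rM ?b) \<tau>0"
  have M: "fst \<tau>0 rM = bound" using env by (simp add: env_def \<tau>0_def)
  have "near \<sigma> \<tau> \<and> snd \<tau> = snd \<sigma> \<and> (fst \<tau> rfr \<noteq> 0 \<longleftrightarrow> (\<forall>k<fst \<tau>0 rM. k < length xs \<longrightarrow> xs ! k \<noteq> z))"
    unfolding \<tau>_def
  proof (rule sem_For)
    show "near \<sigma> \<tau>0 \<and> snd \<tau>0 = snd \<sigma> \<and> (fst \<tau>0 rfr \<noteq> 0 \<longleftrightarrow> (\<forall>k<0. k < length xs \<longrightarrow> xs ! k \<noteq> z))"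
      by (simp add: \<tau>0_def near_upd)
  next
    fix k \<rho> assume "k < fst \<tau>0 rM"
    assume I: "near \<sigma> \<rho> \<and> snd \<rho> = snd \<sigma> \<and> (fst \<rho> rfr \<noteq> 0 \<longleftrightarrow> (\<forall>j<k. j < length xs \<longrightarrow> xs ! j \<noteq> z))"
    let ?\<rho> = "upd rk k \<rho>"
    let ?\<rho>' = "sem (call req [(rw, rW)] ?e) ?\<rho>"
    have n: "near \<sigma> ?\<rho>" using I near_upd by simp
    have c: "req \<notin> evars ?e" "req \<notin> fst ` set [(rw, rW)]" "req \<notin> snd ` set [(rw, rW)]"
      "fst ` set [(rw, rW)] \<inter> snd ` set [(rw, rW)] = {}" by (auto simp: eadr_def)
    have n': "near \<sigma> ?\<rho>'" by (rule near_call[OF n c]) auto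
    have s': "snd ?\<rho>' = snd \<sigma>" using sem_call(1)[OF c, of ?\<rho>] I by simp
    have "allv [(rw, rW)] ?e ?\<rho> \<longleftrightarrow> (\<forall>w<W. snd \<sigma> (R 0 + w) = snd \<sigma> (R (Suc k) + w))"
      using env_near_regs[OF env n] I by (simp add: eadr_def R_def)
    then have q: "fst ?\<rho>' req = of_bool (\<forall>w<W. snd \<sigma> (R 0 + w) = snd \<sigma> (R (Suc k) + w))"
      using sem_call(2)[OF c, of ?\<rho>] by simp
    have fr: "fst ?\<rho>' rfr = fst \<rho> rfr" "fst ?\<rho>' rk = k" by (simp_all add: sem_frame)
    have l: "fst ?\<rho>' rlen = length xs" using n' len by (simp add: near_def)
    have z': "(\<forall>w<W. snd \<sigma> (R 0 + w) = snd \<sigma> (R (Suc k) + w)) \<longleftrightarrow> z = xs ! k" if "k < length xs"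
      using that inv z by (intro holds_inj) (auto simp: inv_def)
    show "near \<sigma> (sem ?b ?\<rho>) \<and> snd (sem ?b ?\<rho>) = snd \<sigma> \<and>
      (fst (sem ?b ?\<rho>) rfr \<noteq> 0 \<longleftrightarrow> (\<forall>j<Suc k. j < length xs \<longrightarrow> xs ! j \<noteq> z))"
      using n' s' q fr l z' I by (auto simp: near_upd less_Suc_eq)
  qed
  \<comment> \<open>The list is never longer than \<open>bound\<close>, so the fixed number of
    comparisons misses no record.\<close>
  moreover have "(\<forall>k<bound. k < length xs \<longrightarrow> xs ! k \<noteq> z) \<longleftrightarrow> (\<forall>k<length xs. xs ! k \<noteq> z)"
    using length_le_bound[of xs] inv less_le_trans unfolding inv_def by blast
  ultimately have n\<tau>: "near \<sigma> \<tau>" "snd \<tau> = snd \<sigma>" and fr: "fst \<tau> rfr \<noteq> 0 \<longleftrightarrow> z \<notin> set xs"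
    unfolding M in_set_conv_nth by blast+
  have inv\<tau>: "inv \<tau> xs" by (rule near_inv[OF n\<tau>(1) inv])
  let ?cp = "CFor rw rW (CWr (eadr (EAdd (EV rlen) (EN 1)) (EV rw)) (ELd (eadr (EN 0) (EV rw))))"
  have sem: "sem insert_com \<sigma> = (if fst \<tau> rfr \<noteq> 0 then sem (?cp ;; CAsg rlen (EAdd (EV rlen) (EN 1))) \<tau>
    else upd rr 0 \<tau>)"
    by (simp add: insert_com_def \<tau>_def \<tau>0_def nop_def del: sem.simps(5))
  show ?thesis
  proof (cases "z \<in> set xs")
    case True
    then have "sem insert_com \<sigma> = upd rr 0 \<tau>" using sem fr by simp
    then show ?thesis using near_inv[OF near_upd[OF near_refl] inv\<tau>] True by (simp add: ins_def)
  next
    case False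
    define \<rho> where "\<rho> = sem ?cp \<tau>"
    have W: "fst \<tau> rW = W" using env_near_regs[OF env n\<tau>(1)] by simp
    let ?p = "R (Suc (length xs))"
    \<comment> \<open>The copy goes to the first slot behind the list, which \<open>inv\<close> does
      not mention yet; its source, the candidate slot, lies below and stays intact.\<close>
    have "(\<forall>r<20. fst \<rho> r = fst \<tau> r) \<and> (\<forall>p<?p. snd \<rho> p = snd \<tau> p) \<and> (\<forall>w<fst \<tau> rW. snd \<rho> (?p + w) = enc z w)"
      unfolding \<rho>_def
    proof (rule sem_For)
      fix w \<rho> assume w: "w < fst \<tau> rW"
        and I: "(\<forall>r<20. fst \<rho> r = fst \<tau> r) \<and> (\<forall>p<?p. snd \<rho> p = snd \<tau> p) \<and> (\<forall>w'<w. snd \<rho> (?p + w') = enc z w')"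
      have regs: "fst \<rho> rQ = R 0" "fst \<rho> rW = W" "fst \<rho> rlen = length xs"
        using I env_near_regs[OF env n\<tau>(1)] inv\<tau> by (auto simp: inv_def)
      have "R 0 + w < ?p" using w W R_less[of 0 "Suc (length xs)"] by simp
      then have v: "snd \<rho> (R 0 + w) = enc z w" using I z(1) w W n\<tau>(2) by (auto simp: holds_def)
      have a: "R 0 + W * (length xs + 1) = ?p" by (simp add: R_def)
      let ?c = "CWr (eadr (EAdd (EV rlen) (EN 1)) (EV rw)) (ELd (eadr (EN 0) (EV rw)))"
      have "sem ?c (upd rw w \<rho>) = (fst (upd rw w \<rho>), (snd \<rho>)(?p + w := enc z w))"
        using regs v a by (simp add: eadr_def)
      then show "(\<forall>r<20. fst (sem ?c (upd rw w \<rho>)) r = fst \<tau> r) \<and> (\<forall>p<?p. snd (sem ?c (upd rw w \<rho>)) p = snd \<tau> p) \<and>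
          (\<forall>w'<Suc w. snd (sem ?c (upd rw w \<rho>)) (?p + w') = enc z w')"
        using I by (auto simp: less_Suc_eq)
    qed simp
    then have \<rho>: "\<And>r. r < 20 \<Longrightarrow> fst \<rho> r = fst \<tau> r" "\<And>p. p < ?p \<Longrightarrow> snd \<rho> p = snd \<tau> p" "holds (snd \<rho>) ?p z"
      using W by (auto simp: holds_def)
    have s: "sem insert_com \<sigma> = upd rlen (length xs + 1) \<rho>"
      using sem fr False \<rho>(1)[of rlen] inv\<tau> by (simp add: \<rho>_def inv_def del: sem.simps(5))
    have "env (upd rlen (length xs + 1) \<rho>)"
    proof -
      have "2 + n * i + j < ?p" if "i < n" "j < n" for i j
      proof -
        have "n * i + j < n * Suc i" using that by simp
    also have "n * Suc i \<le> n * n" using that by (intro mult_le_mono2) simp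
        finally have "n * i + j < n * n" .
        then show ?thesis by (simp add: R_def)
      qed
      then show ?thesis using inv\<tau> \<rho>(1,2) by (simp add: inv_def env_def)
    qed
    moreover have "holds (snd \<rho>) (R (Suc i)) ((xs @ [z]) ! i)" if "i < length (xs @ [z])" for i
    proof (cases "i = length xs")
      case True
      then show ?thesis using \<rho>(3) by simp
    next
      case i: False
      then have i: "i < length xs" using that by simp
      then have "R (Suc i) + W \<le> ?p" by (intro R_less) simp
      then show ?thesis using i inv\<tau> \<rho>(2) by (auto simp: inv_def holds_def nth_append)
    qed
    ultimately have "inv (upd rlen (length xs + 1) \<rho>) (xs @ [z])"
      using inv False z(2) by (auto simp: inv_def)
    then show ?thesis using s False by (simp add: ins_def)
  qed
qed

end

section \<open>The main loop\<close>

definition elt :: "aexp \<Rightarrow> aexp \<Rightarrow> aexp" where "elt a b = ele (EAdd a (EN 1)) b"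

lemma aval_elt [simp]: "aval (elt a b) \<sigma> = of_bool (aval a \<sigma> < aval b \<sigma>)"
  and evars_elt [simp]: "evars (elt a b) = evars a \<union> evars b" "eloops (elt a b) = eloops a \<union> eloops b"
  by (auto simp: elt_def)

lemma evars_access [simp]:
  "evars (efld r k) = {r}" "evars (eS r v) = insert r (evars v)"
  "evars (eP r a b) = {r, rn, rd2} \<union> evars a \<union> evars b" "evars (eA a b) = insert rn (evars a \<union> evars b)"
  "evars (ecap a) = insert rd1 (evars a)"
  "eloops (efld r k) = {}" "eloops (eS r v) = eloops v"
  "eloops (eP r a b) = insert rd2 (eloops a \<union> eloops b)" "eloops (eA a b) = insert rn (eloops a \<union> eloops b)"
  "eloops (ecap a) = eloops a" "eloops (eadr a b) = insert rW (eloops a \<union> eloops b)"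
  "evars (eadr a b) = {rQ, rW} \<union> evars a \<union> evars b"
  by (auto simp: efld_def eS_def eP_def eA_def ecap_def eadr_def)

text \<open>The new \<open>P\<close> is tabulated by asking for each pair \<open>ra\<close>,
  \<open>rb\<close> whether it has a preimage in the \<open>P\<close> of either part, with
  \<open>ra'\<close>, \<open>rb'\<close> searching for it.\<close>

definition ser_wr :: com where
  "ser_wr = write_com (efld rx 0) (efld ry 1) (ecap (EAdd (efld rx 2) (efld ry 2)))
       (eor (eS rx (EV rv)) (eor (eS ry (EV rv)) (eeq (EV rv) (efld rx 1))))
       (call rr [(ra', rd2), (rb', rd2)] (enot (eor
          (eand (eP rx (EV ra') (EV rb')) (eand (eeq (EV ra') (EV ra))
            (eeq (ecap (EAdd (EV rb') (efld ry 2))) (EV rb))))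
          (eand (eP ry (EV ra') (EV rb')) (eand (eeq (ecap (EAdd (EV ra') (efld rx 2))) (EV ra))
            (eeq (EV rb') (EV rb)))))))
       (enot (EV rr))"

definition ser_com :: com where
  "ser_com = comb_com
     (eand (eeq (efld rx 1) (efld ry 0)) (eand (eor (enot (eeq (efld rx 0) (efld ry 1))) (eeq (efld rx 0) (EV rn)))
       (eand (eeq (efld rx 3) (ecap (EAdd (EV rD) (efld ry 2)))) (eeq (efld ry 3) (ecap (EAdd (EV rD) (efld rx 2)))))))
     (eand (enot (eand (eS rx (EV rv)) (eS ry (EV rv))))
       (eand (enot (eand (eeq (EV rv) (efld rx 0)) (eS ry (EV rv))))
       (eand (enot (eand (eeq (EV rv) (efld ry 1)) (eS rx (EV rv))))
         (eor (enot (eand (elt (efld rx 1) (EV rn)) (eA (efld rx 1) (EV rv))))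
         (eor (eS rx (EV rv)) (eor (eS ry (EV rv))
         (eor (eand (eeq (EV rv) (efld rx 0)) (eeq (efld rx 2) (EN 1)))
           (eand (eeq (EV rv) (efld ry 1)) (eeq (efld ry 2) (EN 1))))))))))
     (eor (enot (eand (eP rx (EV ra) (EV rb)) (eP ry (EV ra') (EV rb'))))
       (eor (elt (EAdd (EV rb) (EV ra')) (EV rd1)) (elt (EAdd (EAdd (EV ra) (EV rD)) (EV rb')) (EV rd1))))
     ser_wr"

definition par_wr :: com where
  "par_wr = write_com (efld rx 0) (efld rx 1) (emin (efld rx 2) (efld ry 2))
       (eor (eS rx (EV rv)) (eS ry (EV rv)))
       (call rr [(ra', rd2), (rb', rd2)] (enot (eor
          (eand (eP rx (EV ra') (EV rb')) (eand
            (eeq (emin (EV ra') (ecap (EAdd (EV rb') (efld ry 2)))) (EV ra))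
            (eeq (emin (EV rb') (ecap (EAdd (EV ra') (efld ry 2)))) (EV rb))))
          (eand (eP ry (EV ra') (EV rb')) (eand
            (eeq (emin (EV ra') (ecap (EAdd (EV rb') (efld rx 2)))) (EV ra))
            (eeq (emin (EV rb') (ecap (EAdd (EV ra') (efld rx 2)))) (EV rb)))))))
       (enot (EV rr))"

definition par_com :: com where
  "par_com = comb_com
     (eand (eeq (efld rx 0) (efld ry 0)) (eand (eeq (efld rx 1) (efld ry 1))
       (eand (eeq (efld rx 3) (emin (EV rD) (efld ry 2))) (eand (eeq (efld ry 3) (emin (EV rD) (efld rx 2)))
         (enot (eand (eeq (efld rx 2) (EN 1)) (eeq (efld ry 2) (EN 1))))))))
     (enot (eand (eS rx (EV rv)) (eS ry (EV rv))))
     (eor (enot (eand (eP rx (EV ra) (EV rb)) (eP ry (EV ra') (EV rb'))))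
       (eor (elt (EAdd (EV ra) (EV ra')) (EV rd1)) (eor (elt (EAdd (EV rb) (EV rb')) (EV rd1))
       (eor (elt (EAdd (EAdd (EV ra) (EV rD)) (EV rb')) (EV rd1))
         (elt (EAdd (EAdd (EV rb) (EV rD)) (EV ra')) (EV rd1))))))
     par_wr"

definition pair_com :: com where
  "pair_com = CFor rD rd2 (ser_com ;; par_com)"

definition swap_com :: com where
  "swap_com = CFor ro rtwo
     (CIf (EV ro)
        (CAsg rx (eadr (EAdd (EV rj) (EN 1)) (EN 0)) ;; CAsg ry (eadr (EAdd (EV ri) (EN 1)) (EN 0)))
        (CAsg rx (eadr (EAdd (EV ri) (EN 1)) (EN 0)) ;; CAsg ry (eadr (EAdd (EV rj) (EN 1)) (EN 0))) ;;
      pair_com)"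

text \<open>Records are only appended, so a pair of positions has to be treated just once: position
  \<open>i\<close> is combined with all \<open>j \<le> i\<close>, in both orders. Records appended
  meanwhile have later positions and get their own turn, as \<open>ri\<close> runs to
  \<open>rM\<close> and not to the current length.\<close>

definition sat_com :: com where
  "sat_com = CFor ri rM (CFor rj rM
     (CIf (eand (ele (EV rj) (EV ri)) (elt (EV ri) (EV rlen))) swap_com nop))"

definition edge_com :: com where
  "edge_com = CFor rs rn1 (CFor rt rn1 (CFor rD rd2
     (CIf (eor (enot (eeq (EV rs) (EV rt))) (eeq (EV rs) (EV rn)))
       (write_com (EV rs) (EV rt) (EN 1) (EN 0)
         (CAsg rr (eor (eand (eeq (EV ra) (EN 0)) (eeq (EV rb) (EN 1)))
           (eand (eeq (EV ra) (EN 1)) (eeq (EV rb) (EN 0)))))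
         (EV rr) ;;
        insert_com)
       nop)))"

definition accept_com :: com where
  "accept_com = CAsg 0 (EN 0) ;; CFor ri rM
     (CIf (elt (EV ri) (EV rlen))
       (CAsg rx (eadr (EAdd (EV ri) (EN 1)) (EN 0)) ;;
        CIf (eand (eeq (efld rx 3) (EV rd1))
            (enot (eand (elt (efld rx 0) (EV rn)) (eand (elt (efld rx 1) (EV rn))
              (eand (eA (efld rx 0) (efld rx 1)) (enot (eeq (efld rx 2) (EN 1))))))))
          (call rr [(rv, rn)] (eor (eS rx (EV rv)) (eor (eeq (EV rv) (efld rx 0)) (eeq (EV rv) (efld rx 1)))) ;;
           CIf (EV rr) (CAsg 0 (EN 1)) nop)
          nop)
       nop)"

definition main_com :: com where
  "main_com = CAsg rlen (EN 0) ;; edge_com ;; sat_com ;; accept_com"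

lemma asgd_write [simp]: "asgd (write_com hs ht he sv pc pe) = {rv, ra, rb} \<union> asgd pc"
  by (auto simp: write_com_def)

section \<open>Correctness of a single composition of two records\<close>

context dp_prog
begin

lemma asgd_comb:
  "asgd ser_com \<subseteq> insert rlen {20..}" "asgd par_com \<subseteq> insert rlen {20..}"
  by (auto simp: ser_com_def par_com_def ser_wr_def par_wr_def comb_com_def asgd_insert nop_def)

text \<open>\<open>gP\<close>, \<open>vP\<close> and \<open>cP\<close> are the parts of a rule's
  condition without quantifier, over vertices, and over pairs of distance pairs. Until a candidate
  is complete only \<open>near\<close> changes occur, so every early exit leaves the list as it
  was.\<close>

lemma sem_comb:
  assumes inv: "inv \<sigma> xs"
    and gl: "aval gl \<sigma> \<noteq> 0 \<longleftrightarrow> gP"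
    and vx: "allv [(rv, rn)] vx \<sigma> \<longleftrightarrow> vP" "rr \<notin> evars vx"
    and cr: "\<And>\<tau>. near \<sigma> \<tau> \<Longrightarrow> allv [(ra, rd2), (rb, rd2), (ra', rd2), (rb', rd2)] cr \<tau> \<longleftrightarrow> cP" "rr \<notin> evars cr"
    and wr: "\<And>\<tau>. near \<sigma> \<tau> \<Longrightarrow> near \<tau> (sem wr \<tau>) \<and> holds (snd (sem wr \<tau>)) (R 0) z"
    and z: "gP \<Longrightarrow> vP \<Longrightarrow> cP \<Longrightarrow> z \<in> reach"
  shows "inv (sem (comb_com gl vx cr wr) \<sigma>) (if gP \<and> vP \<and> cP then ins z xs else xs)"
proof -
  let ?l = "[(ra, rd2), (rb, rd2), (ra', rd2), (rb', rd2)]"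
  define \<tau>1 where "\<tau>1 = sem (call rr [(rv, rn)] vx) \<sigma>"
  define \<tau>2 where "\<tau>2 = sem (call rr ?l cr) \<tau>1"
  define \<tau>3 where "\<tau>3 = sem wr \<tau>2"
  have n1: "near \<sigma> \<tau>1" unfolding \<tau>1_def by (rule near_call) (use vx(2) in auto)
  have n2: "near \<sigma> \<tau>2" unfolding \<tau>2_def by (rule near_call[OF n1]) (use cr(2) in auto)
  have r1: "fst \<tau>1 rr = of_bool vP"
    unfolding \<tau>1_def vx(1)[symmetric] by (rule sem_call(2)) (use vx(2) in auto)
  have r2: "fst \<tau>2 rr = of_bool cP"
    unfolding \<tau>2_def cr(1)[OF n1, symmetric] by (rule sem_call(2)) (use cr(2) in auto)
  note w = wr[OF n2, folded \<tau>3_def]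
  have "sem (comb_com gl vx cr wr) \<sigma> = (if aval gl \<sigma> \<noteq> 0 then if aval (EV rr) \<tau>1 \<noteq> 0 then
      if aval (EV rr) \<tau>2 \<noteq> 0 then sem insert_com \<tau>3 else sem nop \<tau>2 else sem nop \<tau>1 else sem nop \<sigma>)"
    by (simp only: comb_com_def sem.simps(3,4) \<tau>3_def \<tau>2_def \<tau>1_def)
  then have sem: "sem (comb_com gl vx cr wr) \<sigma> = (if gP then if vP then if cP then sem insert_com \<tau>3
    else upd rr 0 \<tau>2 else upd rr 0 \<tau>1 else upd rr 0 \<sigma>)"
    using gl r1 r2 by (simp add: nop_def)
  have i: "inv (upd rr v \<tau>) xs" if "near \<sigma> \<tau>" for v \<tau>
    by (rule near_inv[OF near_upd[OF that] inv]) simp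
  have "inv (sem insert_com \<tau>3) (ins z xs)" if "gP" "vP" "cP"
    by (rule sem_insert[OF near_inv[OF near_trans[OF n2] inv]]) (use w z that in auto)
  then show ?thesis using i[OF near_refl] i[OF n1] i[OF n2] by (simp add: sem)
qed

lemma access:
  assumes "holds (snd \<tau>) (fst \<tau> r) (s, t, e, D, S, P)" "fst \<tau> rn = n" "fst \<tau> rd2 = d + 2"
  shows "aval (efld r 0) \<tau> = s" "aval (efld r (Suc 0)) \<tau> = t" "aval (efld r 2) \<tau> = e" "aval (efld r 3) \<tau> = D"
    and "aval v \<tau> < n \<Longrightarrow> aval (eS r v) \<tau> = of_bool (aval v \<tau> \<in> S)"
    and "aval a \<tau> < d + 2 \<Longrightarrow> aval b \<tau> < d + 2 \<Longrightarrow> aval (eP r a b) \<tau> = of_bool ((aval a \<tau>, aval b \<tau>) \<in> P)"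
proof -
  have W: "4 + n \<le> W" by (simp add: W_def)
  have h: "snd \<tau> (fst \<tau> r + k) = enc (s, t, e, D, S, P) k" if "k < W" for k
    using assms(1) that by (simp add: holds_def)
  show "aval (efld r 0) \<tau> = s" "aval (efld r (Suc 0)) \<tau> = t" "aval (efld r 2) \<tau> = e" "aval (efld r 3) \<tau> = D"
    using h[of 0] h[of "Suc 0"] h[of 2] h[of 3] W by (simp_all add: efld_def)
  show "aval (eS r v) \<tau> = of_bool (aval v \<tau> \<in> S)" if "aval v \<tau> < n"
  proof -
    have "aval (eS r v) \<tau> = enc (s, t, e, D, S, P) (4 + aval v \<tau>)"
      using h[of "4 + aval v \<tau>"] that W by (simp add: eS_def del: enc.simps)
    then show ?thesis using enc_fields(5)[OF that] by simp
  qed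
  show "aval (eP r a b) \<tau> = of_bool ((aval a \<tau>, aval b \<tau>) \<in> P)" if "aval a \<tau> < d + 2" "aval b \<tau> < d + 2"
  proof -
    have "aval (eP r a b) \<tau> = snd \<tau> (fst \<tau> r + (4 + n + ((d + 2) * aval a \<tau> + aval b \<tau>)))"
      by (simp only: eP_def aval.simps assms fst_conv snd_conv)
    then show ?thesis using h[OF P_index_less[OF that]] enc_P[OF that(2)] by metis
  qed
qed

lemma eA_access:
  assumes "env \<tau>" "aval a \<tau> < n" "aval b \<tau> < n"
  shows "aval (eA a b) \<tau> = of_bool (A (aval a \<tau>) (aval b \<tau>))"
  using assms by (simp add: eA_def env_def)

context
  fixes \<sigma> xs i j D s1 t1 e1 D1 S1 P1 s2 t2 e2 D2 S2 P2
  assumes inv: "inv \<sigma> xs" and ij: "i < length xs" "j < length xs"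
    and regs: "fst \<sigma> rx = R (Suc i)" "fst \<sigma> ry = R (Suc j)" "fst \<sigma> rD = D" "D \<le> d + 1"
    and X: "xs ! i = (s1, t1, e1, D1, S1, P1)" and Y: "xs ! j = (s2, t2, e2, D2, S2, P2)"
begin

lemma near_env': "near \<sigma> \<tau> \<Longrightarrow> env \<tau>"
  using near_env inv by (auto simp: inv_def)

lemma near_regs:
  assumes "near \<sigma> \<tau>"
  shows "fst \<tau> rn = n" "fst \<tau> rd1 = d + 1" "fst \<tau> rd2 = d + 2" "fst \<tau> rD = D"
  using near_env'[OF assms] assms regs by (simp_all add: env_def) (simp add: near_def)

lemma near_X: "near \<sigma> \<tau> \<Longrightarrow> holds (snd \<tau>) (fst \<tau> rx) (s1, t1, e1, D1, S1, P1)"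
  using near_holds[of \<sigma> \<tau> i "xs ! i"] inv ij regs X by (auto simp: inv_def near_def)

lemma near_Y: "near \<sigma> \<tau> \<Longrightarrow> holds (snd \<tau>) (fst \<tau> ry) (s2, t2, e2, D2, S2, P2)"
  using near_holds[of \<sigma> \<tau> j "xs ! j"] inv ij regs Y by (auto simp: inv_def near_def)

lemma in_reach: "(s1, t1, e1, D1, S1, P1) \<in> reach" "(s2, t2, e2, D2, S2, P2) \<in> reach"
  using inv ij X Y by (auto simp: inv_def) (metis nth_mem subsetD)+

lemma P_bounds: "P1 \<subseteq> {..<d + 2} \<times> {..<d + 2}" "P2 \<subseteq> {..<d + 2} \<times> {..<d + 2}"
  using in_reach reach_universe by (fastforce simp: universe_def)+

lemma P_less: "(a, b) \<in> P1 \<Longrightarrow> a < d + 2 \<and> b < d + 2" "(a, b) \<in> P2 \<Longrightarrow> a < d + 2 \<and> b < d + 2"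
  using P_bounds by auto

text \<open>The program quantifies over all numbers below \<open>d + 2\<close>, the rule over
  \<open>P1\<close> and \<open>P2\<close>; the two agree because the pairs of reachable summaries
  lie in that range.\<close>

lemma allv_cross:
  assumes "near \<sigma> \<tau>"
    and "\<And>a b a' b' \<rho>. near \<sigma> \<rho> \<Longrightarrow> fst \<rho> ra = a \<Longrightarrow> fst \<rho> rb = b \<Longrightarrow> fst \<rho> ra' = a' \<Longrightarrow> fst \<rho> rb' = b' \<Longrightarrow>
      aval c \<rho> \<noteq> 0 \<longleftrightarrow> Q a b a' b'"
  shows "allv [(ra, rd2), (rb, rd2), (ra', rd2), (rb', rd2)]
      (eor (enot (eand (eP rx (EV ra) (EV rb)) (eP ry (EV ra') (EV rb')))) c) \<tau> \<longleftrightarrow>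
    (\<forall>(a, b)\<in>P1. \<forall>(a', b')\<in>P2. Q a b a' b')"
proof -
  let ?u = "\<lambda>a b a' b'. upd rb' b' (upd ra' a' (upd rb b (upd ra a \<tau>)))"
  have u: "near \<sigma> (?u a b a' b')" for a b a' b' by (intro near_upd assms(1)) auto
  have "aval (eor (enot (eand (eP rx (EV ra) (EV rb)) (eP ry (EV ra') (EV rb')))) c) (?u a b a' b') \<noteq> 0 \<longleftrightarrow>
      ((a, b) \<in> P1 \<and> (a', b') \<in> P2 \<longrightarrow> Q a b a' b')"
    if "a < d + 2" "b < d + 2" "a' < d + 2" "b' < d + 2" for a b a' b'
    using that assms(2)[OF u[of b' a' b a], of a b a' b'] access(6)[where a = "EV ra" and b = "EV rb", OF near_X[OF u[of b' a' b a]] near_regs(1,3)[OF u[of b' a' b a]]]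
      access(6)[where a = "EV ra'" and b = "EV rb'", OF near_Y[OF u[of b' a' b a]] near_regs(1,3)[OF u[of b' a' b a]]] by auto
  then have "allv [(ra, rd2), (rb, rd2), (ra', rd2), (rb', rd2)]
      (eor (enot (eand (eP rx (EV ra) (EV rb)) (eP ry (EV ra') (EV rb')))) c) \<tau> \<longleftrightarrow>
    (\<forall>a<d + 2. \<forall>b<d + 2. \<forall>a'<d + 2. \<forall>b'<d + 2. (a, b) \<in> P1 \<and> (a', b') \<in> P2 \<longrightarrow> Q a b a' b')"
    using near_regs[OF assms(1)] by auto
  also have "\<dots> \<longleftrightarrow> (\<forall>a b. (a, b) \<in> P1 \<longrightarrow> (\<forall>a' b'. (a', b') \<in> P2 \<longrightarrow> Q a b a' b'))"
    using P_less by blast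
  also have "\<dots> \<longleftrightarrow> (\<forall>(a, b)\<in>P1. \<forall>(a', b')\<in>P2. Q a b a' b')" by auto
  finally show ?thesis .
qed

lemma sem_pairs:
  assumes "near \<sigma> \<tau>" "rr \<notin> evars c1" "rr \<notin> evars c2"
    and c: "\<And>\<rho>. near \<sigma> \<rho> \<Longrightarrow> fst \<rho> ra = fst \<tau> ra \<Longrightarrow> fst \<rho> rb = fst \<tau> rb \<Longrightarrow>
      (aval c1 \<rho> \<noteq> 0 \<longleftrightarrow> f1 (fst \<rho> ra', fst \<rho> rb') = (fst \<tau> ra, fst \<tau> rb)) \<and>
      (aval c2 \<rho> \<noteq> 0 \<longleftrightarrow> f2 (fst \<rho> ra', fst \<rho> rb') = (fst \<tau> ra, fst \<tau> rb))"
  defines "pc \<equiv> call rr [(ra', rd2), (rb', rd2)] (enot (eor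
          (eand (eP rx (EV ra') (EV rb')) c1) (eand (eP ry (EV ra') (EV rb')) c2)))"
  shows "snd (sem pc \<tau>) = snd \<tau> \<and>
    aval (enot (EV rr)) (sem pc \<tau>) = of_bool ((fst \<tau> ra, fst \<tau> rb) \<in> f1 ` P1 \<union> f2 ` P2)"
proof -
  let ?e = "enot (eor (eand (eP rx (EV ra') (EV rb')) c1) (eand (eP ry (EV ra') (EV rb')) c2))"
  let ?u = "\<lambda>a' b'. upd rb' b' (upd ra' a' \<tau>)"
  let ?p = "(fst \<tau> ra, fst \<tau> rb)"
  have u: "near \<sigma> (?u a' b')" for a' b' by (intro near_upd assms(1)) auto
  have "aval ?e (?u a' b') \<noteq> 0 \<longleftrightarrow>
      \<not> ((a', b') \<in> P1 \<and> f1 (a', b') = ?p \<or> (a', b') \<in> P2 \<and> f2 (a', b') = ?p)"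
    if "a' < d + 2" "b' < d + 2" for a' b'
    using that c[OF u[of b' a']] access(6)[where a = "EV ra'" and b = "EV rb'", OF near_X[OF u[of b' a']] near_regs(1,3)[OF u[of b' a']]]
      access(6)[where a = "EV ra'" and b = "EV rb'", OF near_Y[OF u[of b' a']] near_regs(1,3)[OF u[of b' a']]] by simp
  then have "allv [(ra', rd2), (rb', rd2)] ?e \<tau> \<longleftrightarrow> (\<forall>a'<d + 2. \<forall>b'<d + 2.
      \<not> ((a', b') \<in> P1 \<and> f1 (a', b') = ?p \<or> (a', b') \<in> P2 \<and> f2 (a', b') = ?p))"
    using near_regs[OF assms(1)] by simp
  also have "\<dots> \<longleftrightarrow> (\<forall>a' b'. \<not> ((a', b') \<in> P1 \<and> f1 (a', b') = ?p \<or> (a', b') \<in> P2 \<and> f2 (a', b') = ?p))"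
    using P_less by blast
  also have "\<dots> \<longleftrightarrow> ?p \<notin> f1 ` P1 \<union> f2 ` P2"
  proof -
    have "(\<forall>q. \<not> (q \<in> P1 \<and> f1 q = r \<or> q \<in> P2 \<and> f2 q = r)) \<longleftrightarrow> r \<notin> f1 ` P1 \<union> f2 ` P2" for r by blast
    then show ?thesis by (simp only: split_paired_All)
  qed
  finally have a: "allv [(ra', rd2), (rb', rd2)] ?e \<tau> \<longleftrightarrow> ?p \<notin> f1 ` P1 \<union> f2 ` P2" .
  have "snd (sem pc \<tau>) = snd \<tau>" unfolding pc_def by (rule sem_call) (use assms(2,3) in auto)
  moreover have "fst (sem pc \<tau>) rr = of_bool (allv [(ra', rd2), (rb', rd2)] ?e \<tau>)"
    unfolding pc_def by (rule sem_call) (use assms(2,3) in auto)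
  ultimately show ?thesis unfolding a by simp
qed

lemma aval_ecap: "fst \<tau> rd1 = d + 1 \<Longrightarrow> aval (ecap a) \<tau> = cap (aval a \<tau>)"
  by (simp add: ecap_def cap_def)

lemma near_fields:
  assumes "near \<sigma> \<tau>"
  shows "aval (efld rx 0) \<tau> = s1" "aval (efld rx (Suc 0)) \<tau> = t1" "aval (efld rx 2) \<tau> = e1" "aval (efld rx 3) \<tau> = D1"
    "aval (efld ry 0) \<tau> = s2" "aval (efld ry (Suc 0)) \<tau> = t2" "aval (efld ry 2) \<tau> = e2" "aval (efld ry 3) \<tau> = D2"
    "aval v \<tau> < n \<Longrightarrow> aval (eS rx v) \<tau> = of_bool (aval v \<tau> \<in> S1)"
    "aval v \<tau> < n \<Longrightarrow> aval (eS ry v) \<tau> = of_bool (aval v \<tau> \<in> S2)"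
    "aval (ecap a) \<tau> = cap (aval a \<tau>)"
  using access[OF near_X[OF assms] near_regs(1,3)[OF assms]] access[OF near_Y[OF assms] near_regs(1,3)[OF assms]]
    aval_ecap near_regs(2)[OF assms] by auto

lemma sem_ser_wr:
  assumes n: "near \<sigma> \<tau>"
  shows "near \<tau> (sem ser_wr \<tau>) \<and> holds (snd (sem ser_wr \<tau>)) (R 0)
    (ser_res D (s1, t1, e1, D1, S1, P1) (s2, t2, e2, D2, S2, P2))"
  unfolding ser_res.simps ser_wr_def
proof (rule sem_write[OF near_env'[OF n]])
  show "fst \<tau> rD = D" using near_regs[OF n] by simp
next
  fix \<rho> assume m: "near \<tau> \<rho>"
  note n' = near_trans[OF n m]
  show "aval (efld rx 0) \<rho> = s1 \<and> aval (efld ry 1) \<rho> = t2 \<and> aval (ecap (EAdd (efld rx 2) (efld ry 2))) \<rho> = cap (e1 + e2)"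
    using near_fields[OF n'] by simp
  show "aval (eor (eS rx (EV rv)) (eor (eS ry (EV rv)) (eeq (EV rv) (efld rx 1)))) \<rho> =
      of_bool (fst \<rho> rv \<in> {v. v < n \<and> (v \<in> S1 \<or> v \<in> S2 \<or> v = t1)})" if "fst \<rho> rv < n"
    using near_fields[OF n'] that by simp
qed (rule sem_pairs, auto simp: near_fields near_fields[OF near_trans[OF n]] intro: near_trans[OF n])

lemma sem_ser:
  "inv (sem ser_com \<sigma>) (if ser_ok D (s1, t1, e1, D1, S1, P1) (s2, t2, e2, D2, S2, P2)
     then ins (ser_res D (s1, t1, e1, D1, S1, P1) (s2, t2, e2, D2, S2, P2)) xs else xs)"
proof -
  let ?gP = "t1 = s2 \<and> (s1 \<noteq> t2 \<or> s1 = n) \<and> D1 = cap (D + e2) \<and> D2 = cap (D + e1)"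
  let ?vP = "\<forall>v<n. \<not> (v \<in> S1 \<and> v \<in> S2) \<and> \<not> (v = s1 \<and> v \<in> S2) \<and> \<not> (v = t2 \<and> v \<in> S1) \<and>
       (t1 < n \<and> A t1 v \<longrightarrow> v \<in> S1 \<or> v \<in> S2 \<or> v = s1 \<and> e1 = 1 \<or> v = t2 \<and> e2 = 1)"
  let ?cP = "\<forall>(a, b)\<in>P1. \<forall>(a', b')\<in>P2. b + a' \<le> d \<or> a + D + b' \<le> d"
  let ?z = "ser_res D (s1, t1, e1, D1, S1, P1) (s2, t2, e2, D2, S2, P2)"
  have ok: "ser_ok D (s1, t1, e1, D1, S1, P1) (s2, t2, e2, D2, S2, P2) \<longleftrightarrow> ?gP \<and> ?vP \<and> ?cP" by auto
  show ?thesis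
    unfolding ok ser_com_def
  proof (rule sem_comb[OF inv], goal_cases)
    case 1
    show ?case using near_fields[OF near_refl] near_regs[OF near_refl] by auto
  next
    case 2
    have u: "near \<sigma> (upd rv v \<sigma>)" for v by (rule near_upd) auto
    have "aval (eA (efld rx 1) (EV rv)) (upd rv v \<sigma>) = of_bool (A t1 v)" if "v < n" "t1 < n" for v
      using eA_access[OF near_env'[OF u[of v]], of "efld rx 1" "EV rv"] near_fields[OF u[of v]] that by simp
    then show ?case using near_fields[OF u] near_regs[OF near_refl] near_regs[OF u] by auto
  next
    case (4 \<tau>)
    show ?case by (rule allv_cross[OF 4]) (simp add: near_regs less_Suc_eq_le; argo)
  next
    case (6 \<tau>)
    then show ?case by (rule sem_ser_wr)
  next
    case 7
    then show ?case using reach.series[OF in_reach regs(4)] ok by blast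
  qed auto
qed

lemma sem_par_wr:
  assumes n: "near \<sigma> \<tau>"
  shows "near \<tau> (sem par_wr \<tau>) \<and> holds (snd (sem par_wr \<tau>)) (R 0)
    (par_res D (s1, t1, e1, D1, S1, P1) (s2, t2, e2, D2, S2, P2))"
  unfolding par_res.simps par_wr_def
proof (rule sem_write[OF near_env'[OF n]])
  show "fst \<tau> rD = D" using near_regs[OF n] by simp
next
  fix \<rho> assume m: "near \<tau> \<rho>"
  note n' = near_trans[OF n m]
  show "aval (efld rx 0) \<rho> = s1 \<and> aval (efld rx 1) \<rho> = t1 \<and> aval (emin (efld rx 2) (efld ry 2)) \<rho> = min e1 e2"
    using near_fields[OF n'] by simp
  show "aval (eor (eS rx (EV rv)) (eS ry (EV rv))) \<rho> = of_bool (fst \<rho> rv \<in> {v. v < n \<and> (v \<in> S1 \<or> v \<in> S2)})"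
    if "fst \<rho> rv < n" using near_fields[OF n'] that by simp
qed (rule sem_pairs, auto simp: near_fields near_fields[OF near_trans[OF n]] intro: near_trans[OF n])

lemma sem_par:
  "inv (sem par_com \<sigma>) (if par_ok D (s1, t1, e1, D1, S1, P1) (s2, t2, e2, D2, S2, P2)
     then ins (par_res D (s1, t1, e1, D1, S1, P1) (s2, t2, e2, D2, S2, P2)) xs else xs)"
proof -
  let ?gP = "s1 = s2 \<and> t1 = t2 \<and> D1 = min D e2 \<and> D2 = min D e1 \<and> \<not> (e1 = 1 \<and> e2 = 1)"
  let ?vP = "\<forall>v<n. \<not> (v \<in> S1 \<and> v \<in> S2)"
  let ?cP = "\<forall>(a, b)\<in>P1. \<forall>(a', b')\<in>P2. a + a' \<le> d \<or> b + b' \<le> d \<or> a + D + b' \<le> d \<or> b + D + a' \<le> d"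
  have ok: "par_ok D (s1, t1, e1, D1, S1, P1) (s2, t2, e2, D2, S2, P2) \<longleftrightarrow> ?gP \<and> ?vP \<and> ?cP" by auto
  show ?thesis
    unfolding ok par_com_def
  proof (rule sem_comb[OF inv], goal_cases)
    case 1
    show ?case using near_fields[OF near_refl] near_regs[OF near_refl] by auto
  next
    case 2
    have u: "near \<sigma> (upd rv v \<sigma>)" for v by (rule near_upd) auto
    show ?case using near_fields[OF u] near_regs[OF near_refl] near_regs[OF u] by auto
  next
    case (4 \<tau>)
    show ?case by (rule allv_cross[OF 4]) (simp add: near_regs less_Suc_eq_le; argo)
  next
    case (6 \<tau>)
    then show ?case by (rule sem_par_wr)
  next
    case 7
    then show ?case using reach.parallel[OF in_reach regs(4)] ok by blast
  qed auto
qed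

end

end

section \<open>Saturation of the list and acceptance\<close>

context dp_prog
begin

lemma inv_upd:
  assumes "inv \<sigma> xs" "r \<notin> {rd1, rd2, rn1, rtwo, rQ, rW, rM, rlen, rn}"
  shows "inv (upd r v \<sigma>) xs"
  using assms by (simp add: inv_def env_def)

lemma inv_regs:
  assumes "inv \<sigma> xs"
  shows "fst \<sigma> rn = n" "fst \<sigma> rd1 = d + 1" "fst \<sigma> rd2 = d + 2" "fst \<sigma> rn1 = n + 1" "fst \<sigma> rtwo = 2"
    "fst \<sigma> rQ = R 0" "fst \<sigma> rW = W" "fst \<sigma> rM = bound" "fst \<sigma> rlen = length xs"
  using assms by (simp_all add: inv_def env_def)

lemma eadr_record: "inv \<sigma> xs \<Longrightarrow> aval (eadr (EAdd e (EN 1)) (EN 0)) \<sigma> = R (Suc (aval e \<sigma>))"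
  by (simp add: eadr_def inv_regs) (simp add: R_def)

lemma length_inv: "inv \<sigma> xs \<Longrightarrow> length xs \<le> bound"
  using length_le_bound by (simp add: inv_def)

definition closed_at :: "summary set \<Rightarrow> nat \<Rightarrow> summary \<Rightarrow> summary \<Rightarrow> bool" where
  "closed_at Z D x y \<longleftrightarrow> (ser_ok D x y \<longrightarrow> ser_res D x y \<in> Z) \<and> (par_ok D x y \<longrightarrow> par_res D x y \<in> Z)"

definition closed :: "summary set \<Rightarrow> summary \<Rightarrow> summary \<Rightarrow> bool" where
  "closed Z x y \<longleftrightarrow> (\<forall>D\<le>d + 1. closed_at Z D x y)"

text \<open>Only membership is asked, so a pair treated early stays closed while the list
  grows.\<close>

lemma closed_mono: "closed Z x y \<Longrightarrow> Z \<subseteq> Z' \<Longrightarrow> closed Z' x y"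
  by (auto simp: closed_def closed_at_def)

lemma ins_append: "\<exists>ys. (if b then ins x xs else xs) = xs @ ys \<and> (b \<longrightarrow> x \<in> set (xs @ ys))"
  by (auto simp: ins_def)

lemma frame_comb:
  "r < 20 \<Longrightarrow> r \<noteq> rlen \<Longrightarrow> fst (sem ser_com \<sigma>) r = fst \<sigma> r"
  "r < 20 \<Longrightarrow> r \<noteq> rlen \<Longrightarrow> fst (sem par_com \<sigma>) r = fst \<sigma> r"
  using asgd_comb by (auto intro!: sem_frame)

lemma sem_ser_par:
  assumes inv: "inv \<sigma> xs" and ij: "i < length xs" "j < length xs"
    and regs: "fst \<sigma> rx = R (Suc i)" "fst \<sigma> ry = R (Suc j)" "fst \<sigma> rD = D" "D \<le> d + 1"
  shows "\<exists>ys. inv (sem (ser_com ;; par_com) \<sigma>) (xs @ ys) \<and> closed_at (set (xs @ ys)) D (xs ! i) (xs ! j)"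
proof -
  obtain s1 t1 e1 D1 S1 P1 where X: "xs ! i = (s1, t1, e1, D1, S1, P1)" by (cases "xs ! i")
  obtain s2 t2 e2 D2 S2 P2 where Y: "xs ! j = (s2, t2, e2, D2, S2, P2)" by (cases "xs ! j")
  let ?\<sigma> = "sem ser_com \<sigma>"
  obtain ys where ys: "(if ser_ok D (xs ! i) (xs ! j) then ins (ser_res D (xs ! i) (xs ! j)) xs else xs) = xs @ ys"
    "ser_ok D (xs ! i) (xs ! j) \<longrightarrow> ser_res D (xs ! i) (xs ! j) \<in> set (xs @ ys)"
    using ins_append by blast
  have inv1: "inv ?\<sigma> (xs @ ys)"
    using sem_ser[OF inv ij regs X Y] unfolding ys(1)[symmetric] X Y .
  have ij': "i < length (xs @ ys)" "j < length (xs @ ys)" "(xs @ ys) ! i = xs ! i" "(xs @ ys) ! j = xs ! j"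
    using ij by (auto simp: nth_append)
  have regs': "fst ?\<sigma> rx = R (Suc i)" "fst ?\<sigma> ry = R (Suc j)" "fst ?\<sigma> rD = D" using regs by (simp_all add: frame_comb)
  obtain zs where zs: "(if par_ok D (xs ! i) (xs ! j) then ins (par_res D (xs ! i) (xs ! j)) (xs @ ys) else xs @ ys) = (xs @ ys) @ zs"
    "par_ok D (xs ! i) (xs ! j) \<longrightarrow> par_res D (xs ! i) (xs ! j) \<in> set ((xs @ ys) @ zs)"
    using ins_append by blast
  have "inv (sem par_com ?\<sigma>) ((xs @ ys) @ zs)"
    using sem_par[OF inv1 ij'(1,2) regs' regs(4) ij'(3,4)[unfolded X Y]] unfolding zs(1)[symmetric] X Y .
  moreover have "closed_at (set (xs @ ys @ zs)) D (xs ! i) (xs ! j)"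
    using ys(2) zs(2) unfolding closed_at_def by (simp only: set_append Un_iff) blast
  ultimately show ?thesis by (intro exI[of _ "ys @ zs"]) (simp only: append_assoc sem.simps(3))
qed

lemma sem_pair_com:
  assumes inv: "inv \<sigma> xs" and ij: "i < length xs" "j < length xs"
    and regs: "fst \<sigma> rx = R (Suc i)" "fst \<sigma> ry = R (Suc j)"
  shows "\<exists>ys. inv (sem pair_com \<sigma>) (xs @ ys) \<and> closed (set (xs @ ys)) (xs ! i) (xs ! j)"
proof -
  have "(\<exists>ys. inv (sem pair_com \<sigma>) (xs @ ys) \<and> (\<forall>D<fst \<sigma> rd2. closed_at (set (xs @ ys)) D (xs ! i) (xs ! j))) \<and>
      fst (sem pair_com \<sigma>) rx = R (Suc i) \<and> fst (sem pair_com \<sigma>) ry = R (Suc j)"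
    unfolding pair_com_def
  proof (rule sem_For[where I = "\<lambda>k \<tau>. (\<exists>ys. inv \<tau> (xs @ ys) \<and> (\<forall>D<k. closed_at (set (xs @ ys)) D (xs ! i) (xs ! j))) \<and>
      fst \<tau> rx = R (Suc i) \<and> fst \<tau> ry = R (Suc j)"])
    show "(\<exists>ys. inv \<sigma> (xs @ ys) \<and> (\<forall>D<0. closed_at (set (xs @ ys)) D (xs ! i) (xs ! j))) \<and>
      fst \<sigma> rx = R (Suc i) \<and> fst \<sigma> ry = R (Suc j)"
      using inv regs by (intro conjI exI[of _ "[]"]) auto
  next
    fix D \<tau> assume D: "D < fst \<sigma> rd2"
    assume "(\<exists>ys. inv \<tau> (xs @ ys) \<and> (\<forall>D'<D. closed_at (set (xs @ ys)) D' (xs ! i) (xs ! j))) \<and>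
      fst \<tau> rx = R (Suc i) \<and> fst \<tau> ry = R (Suc j)"
    then obtain ys where ys: "inv \<tau> (xs @ ys)" "\<forall>D'<D. closed_at (set (xs @ ys)) D' (xs ! i) (xs ! j)"
      and r: "fst \<tau> rx = R (Suc i)" "fst \<tau> ry = R (Suc j)" by blast
    let ?\<tau> = "upd rD D \<tau>"
    have Dd: "D \<le> d + 1" using D inv_regs(3)[OF inv] by simp
    have "inv ?\<tau> (xs @ ys)" by (rule inv_upd[OF ys(1)]) simp
    from sem_ser_par[OF this, of i j D] ij r Dd obtain zs where
      zs: "inv (sem (ser_com ;; par_com) ?\<tau>) ((xs @ ys) @ zs)" "closed_at (set ((xs @ ys) @ zs)) D (xs ! i) (xs ! j)"
      by (auto simp: nth_append)
    show "(\<exists>ys. inv (sem (ser_com ;; par_com) ?\<tau>) (xs @ ys) \<and>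
        (\<forall>D'<Suc D. closed_at (set (xs @ ys)) D' (xs ! i) (xs ! j))) \<and>
      fst (sem (ser_com ;; par_com) ?\<tau>) rx = R (Suc i) \<and> fst (sem (ser_com ;; par_com) ?\<tau>) ry = R (Suc j)"
    proof (intro conjI exI[of _ "ys @ zs"])
      show "\<forall>D'<Suc D. closed_at (set (xs @ ys @ zs)) D' (xs ! i) (xs ! j)"
        using ys(2) zs(2) by (auto simp: less_Suc_eq closed_at_def)
    qed (use zs(1) r in \<open>simp_all add: frame_comb\<close>)
  qed
  then show ?thesis unfolding inv_regs(3)[OF inv] closed_def by (auto simp: less_Suc_eq_le)
qed

lemma frame_pair: "r < 20 \<Longrightarrow> r \<noteq> rlen \<Longrightarrow> r \<noteq> rD \<Longrightarrow> fst (sem pair_com \<sigma>) r = fst \<sigma> r"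
  using asgd_comb by (intro sem_frame) (auto simp: pair_com_def)

lemma frame_swap: "r < 15 \<Longrightarrow> r \<noteq> rlen \<Longrightarrow> r \<noteq> rD \<Longrightarrow> r \<noteq> ro \<Longrightarrow> fst (sem swap_com \<sigma>) r = fst \<sigma> r"
  using asgd_comb by (intro sem_frame) (auto simp: swap_com_def pair_com_def)

lemma sem_swap_com:
  assumes inv: "inv \<sigma> xs" and ij: "i < length xs" "j < length xs"
    and regs: "fst \<sigma> ri = i" "fst \<sigma> rj = j"
  shows "\<exists>ys. inv (sem swap_com \<sigma>) (xs @ ys) \<and> closed (set (xs @ ys)) (xs ! i) (xs ! j) \<and>
    closed (set (xs @ ys)) (xs ! j) (xs ! i)"
proof -
  let ?I = "\<lambda>k :: nat. \<lambda>\<tau>. (\<exists>ys. inv \<tau> (xs @ ys) \<and> (0 < k \<longrightarrow> closed (set (xs @ ys)) (xs ! i) (xs ! j)) \<and>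
      (1 < k \<longrightarrow> closed (set (xs @ ys)) (xs ! j) (xs ! i))) \<and> fst \<tau> ri = i \<and> fst \<tau> rj = j"
  have "?I (fst \<sigma> rtwo) (sem swap_com \<sigma>)"
    unfolding swap_com_def
  proof (rule sem_For[where I = ?I])
    show "?I 0 \<sigma>" using inv regs by (intro conjI exI[of _ "[]"]) auto
  next
    fix k \<tau> assume k: "k < fst \<sigma> rtwo" and I: "?I k \<tau>"
    then obtain ys where ys: "inv \<tau> (xs @ ys)" "0 < k \<longrightarrow> closed (set (xs @ ys)) (xs ! i) (xs ! j)"
      "1 < k \<longrightarrow> closed (set (xs @ ys)) (xs ! j) (xs ! i)" and r: "fst \<tau> ri = i" "fst \<tau> rj = j" by blast
    let ?c = "CIf (EV ro)
        (CAsg rx (eadr (EAdd (EV rj) (EN 1)) (EN 0)) ;; CAsg ry (eadr (EAdd (EV ri) (EN 1)) (EN 0)))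
        (CAsg rx (eadr (EAdd (EV ri) (EN 1)) (EN 0)) ;; CAsg ry (eadr (EAdd (EV rj) (EN 1)) (EN 0)))"
    define a b where "a = (if k = 0 then i else j)" and "b = (if k = 0 then j else i)"
    define \<rho> where "\<rho> = sem ?c (upd ro k \<tau>)"
    have i1: "inv (upd ro w \<tau>) (xs @ ys)" for w by (rule inv_upd[OF ys(1)]) simp
    have i2: "inv (upd rx v (upd ro w \<tau>)) (xs @ ys)" for v w by (rule inv_upd[OF i1]) simp
    have \<rho>: "\<rho> = upd ry (R (Suc b)) (upd rx (R (Suc a)) (upd ro k \<tau>))"
      using r by (simp add: \<rho>_def eadr_record[OF i1, unfolded One_nat_def] eadr_record[OF i2, unfolded One_nat_def] a_def b_def)
    have "inv \<rho> (xs @ ys)" unfolding \<rho> by (rule inv_upd[OF i2]) simp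
    moreover have ab: "a < length xs" "b < length xs" using ij by (auto simp: a_def b_def)
    ultimately obtain zs where
      zs: "inv (sem pair_com \<rho>) ((xs @ ys) @ zs)" "closed (set ((xs @ ys) @ zs)) (xs ! a) (xs ! b)"
      using sem_pair_com[of \<rho> "xs @ ys" a b] by (auto simp: \<rho> nth_append)
    have k2: "k = 0 \<or> k = 1" using k inv_regs(5)[OF inv] by auto
    have "fst (sem pair_com \<rho>) ri = i" "fst (sem pair_com \<rho>) rj = j" using r by (simp_all add: frame_pair \<rho>)
    moreover have "closed (set (xs @ ys @ zs)) (xs ! i) (xs ! j)"
      using k2 ys(2) zs(2) closed_mono[of "set (xs @ ys)" "xs ! i" "xs ! j" "set (xs @ ys @ zs)"]
      by (auto simp: a_def b_def)
    moreover have "1 < Suc k \<longrightarrow> closed (set (xs @ ys @ zs)) (xs ! j) (xs ! i)"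
      using k2 zs(2) by (auto simp: a_def b_def)
    ultimately show "?I (Suc k) (sem (?c ;; pair_com) (upd ro k \<tau>))"
      using zs(1) unfolding sem.simps(3)[of ?c] \<rho>_def[symmetric] by (intro conjI exI[of _ "ys @ zs"]) auto
  qed
  then show ?thesis unfolding inv_regs(5)[OF inv] by auto
qed

lemma sem_sat_com:
  assumes inv: "inv \<sigma> xs"
  shows "\<exists>ys. inv (sem sat_com \<sigma>) ys \<and> set xs \<subseteq> set ys \<and> (\<forall>x\<in>set ys. \<forall>y\<in>set ys. closed (set ys) x y)"
proof -
  define settled where "settled k l \<longleftrightarrow> (\<forall>a<k. \<forall>b<k. a < length l \<longrightarrow> b < length l \<longrightarrow> closed (set l) (l ! a) (l ! b))"
    for k l
  let ?c = "CIf (eand (ele (EV rj) (EV ri)) (elt (EV ri) (EV rlen))) swap_com nop"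
  have "\<exists>ys. inv (sem sat_com \<sigma>) ys \<and> set xs \<subseteq> set ys \<and> settled (fst \<sigma> rM) ys"
    unfolding sat_com_def
  proof (rule sem_For[where I = "\<lambda>i \<tau>. \<exists>l. inv \<tau> l \<and> set xs \<subseteq> set l \<and> settled i l"])
    show "\<exists>l. inv \<sigma> l \<and> set xs \<subseteq> set l \<and> settled 0 l" using inv by (intro exI[of _ xs]) (auto simp: settled_def)
  next
    fix i \<tau> assume "\<exists>l. inv \<tau> l \<and> set xs \<subseteq> set l \<and> settled i l"
    then obtain l where l: "inv \<tau> l" "set xs \<subseteq> set l" "settled i l" by blast
    let ?\<tau> = "upd ri i \<tau>"
    have \<tau>: "inv ?\<tau> l" by (rule inv_upd[OF l(1)]) simp
    \<comment> \<open>If \<open>i\<close> is beyond the list, the round appends nothing. Thus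
      position \<open>i\<close> cannot come into being in the middle of its own round, where some
      \<open>j\<close> would already have been missed.\<close>
    let ?J = "\<lambda>j \<rho>. fst \<rho> ri = i \<and> (\<exists>ys. inv \<rho> (l @ ys) \<and> (length l \<le> i \<longrightarrow> ys = []) \<and>
       (i < length l \<longrightarrow> (\<forall>b<j. b \<le> i \<longrightarrow> closed (set (l @ ys)) (l ! i) (l ! b) \<and> closed (set (l @ ys)) (l ! b) (l ! i))))"
    have "?J (fst ?\<tau> rM) (sem (CFor rj rM ?c) ?\<tau>)"
    proof (rule sem_For[where I = ?J])
      show "?J 0 ?\<tau>" using \<tau> by (intro conjI exI[of _ "[]"]) auto
    next
      fix j \<rho> assume "?J j \<rho>"
      then obtain ys where ys: "inv \<rho> (l @ ys)" "length l \<le> i \<longrightarrow> ys = []"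
        "i < length l \<longrightarrow> (\<forall>b<j. b \<le> i \<longrightarrow> closed (set (l @ ys)) (l ! i) (l ! b) \<and> closed (set (l @ ys)) (l ! b) (l ! i))"
        and r: "fst \<rho> ri = i" by blast
      let ?\<rho> = "upd rj j \<rho>"
      have i\<rho>: "inv ?\<rho> (l @ ys)" by (rule inv_upd[OF ys(1)]) simp
      show "?J (Suc j) (sem ?c ?\<rho>)"
      proof (cases "j \<le> i \<and> i < length (l @ ys)")
        case False
        then have "sem ?c ?\<rho> = upd rr 0 ?\<rho>" using r inv_regs(9)[OF i\<rho>] by (simp add: nop_def)
        moreover have "inv (upd rr 0 ?\<rho>) (l @ ys)" by (rule inv_upd[OF i\<rho>]) simp
        moreover have "i < length l \<longrightarrow> \<not> j \<le> i" using False by auto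
        ultimately show ?thesis using ys(2,3) r
          by (intro conjI exI[of _ ys]) (auto simp: less_Suc_eq)
      next
        case True
        then have il: "i < length l" using ys(2) by (cases "i < length l") auto
        have s: "sem ?c ?\<rho> = sem swap_com ?\<rho>" using True r inv_regs(9)[OF i\<rho>] by simp
        obtain zs where zs: "inv (sem swap_com ?\<rho>) ((l @ ys) @ zs)"
          "closed (set ((l @ ys) @ zs)) (l ! i) (l ! j)" "closed (set ((l @ ys) @ zs)) (l ! j) (l ! i)"
          using sem_swap_com[OF i\<rho>, of i j] True r il by (auto simp: nth_append)
        have "closed (set (l @ ys @ zs)) (l ! i) (l ! b) \<and> closed (set (l @ ys @ zs)) (l ! b) (l ! i)"
          if "b < Suc j" "b \<le> i" for b
        proof (cases "b = j")
          case False
          then have "closed (set (l @ ys)) (l ! i) (l ! b)" "closed (set (l @ ys)) (l ! b) (l ! i)"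
            using ys(3) il that by auto
          moreover have "set (l @ ys) \<subseteq> set (l @ ys @ zs)" by auto
          ultimately show ?thesis using closed_mono by blast
        qed (use zs in simp)
        then show ?thesis unfolding s using zs(1) il r
          by (intro conjI exI[of _ "ys @ zs"]) (auto simp: frame_swap)
      qed
    qed
    then obtain ys where ys: "inv (sem (CFor rj rM ?c) ?\<tau>) (l @ ys)" "length l \<le> i \<longrightarrow> ys = []"
      "i < length l \<longrightarrow> (\<forall>b<bound. b \<le> i \<longrightarrow> closed (set (l @ ys)) (l ! i) (l ! b) \<and> closed (set (l @ ys)) (l ! b) (l ! i))"
      unfolding inv_regs(8)[OF \<tau>] by blast
    have "settled (Suc i) (l @ ys)"
    proof (cases "i < length l")
      case False
      then show ?thesis using ys(2) l(3) by (auto simp: settled_def less_Suc_eq)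
    next
      case True
      have "b < bound" if "b \<le> i" for b using that True length_inv[OF l(1)] by simp
      then have "closed (set (l @ ys)) (l ! i) (l ! b) \<and> closed (set (l @ ys)) (l ! b) (l ! i)" if "b \<le> i" for b
        using ys(3) True that by blast
      moreover have "closed (set (l @ ys)) (l ! a) (l ! b)" if "a < i" "b < i" for a b
      proof -
        have "closed (set l) (l ! a) (l ! b)" using l(3) that True by (simp add: settled_def)
        then show ?thesis by (rule closed_mono) auto
      qed
      ultimately have "closed (set (l @ ys)) (l ! a) (l ! b)" if "a \<le> i" "b \<le> i" for a b
        using that by (metis le_neq_implies_less)
      then show ?thesis using True by (auto simp: settled_def nth_append less_Suc_eq_le)
    qed
    then show "\<exists>l. inv (sem (CFor rj rM ?c) ?\<tau>) l \<and> set xs \<subseteq> set l \<and> settled (Suc i) l"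
      using ys(1) l(2) by (intro exI[of _ "l @ ys"]) auto
  qed
  then obtain ys where ys: "inv (sem sat_com \<sigma>) ys" "set xs \<subseteq> set ys" "settled bound ys"
    unfolding inv_regs(8)[OF inv] by blast
  have "closed (set ys) x y" if "x \<in> set ys" "y \<in> set ys" for x y
    using that ys(3) length_inv[OF ys(1)] by (fastforce simp: in_set_conv_nth settled_def)
  then show ?thesis using ys by blast
qed

lemma sem_edge_com:
  assumes inv: "inv \<sigma> []"
  shows "\<exists>ys. inv (sem edge_com \<sigma>) ys \<and>
    (\<forall>s\<le>n. \<forall>t\<le>n. \<forall>D\<le>d + 1. (s \<noteq> t \<or> s = n) \<longrightarrow> edge_summary s t D \<in> set ys)"
proof -
  let ?w = "write_com (EV rs) (EV rt) (EN 1) (EN 0)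
         (CAsg rr (eor (eand (eeq (EV ra) (EN 0)) (eeq (EV rb) (EN 1)))
           (eand (eeq (EV ra) (EN 1)) (eeq (EV rb) (EN 0)))))
         (EV rr)"
  let ?c = "CIf (eor (enot (eeq (EV rs) (EV rt))) (eeq (EV rs) (EV rn))) (?w ;; insert_com) nop"
  let ?in = "\<lambda>l s t D. (s \<noteq> t \<or> s = n) \<longrightarrow> edge_summary s t D \<in> set l"
  have body: "\<exists>zs. inv (sem ?c \<tau>) (l @ zs) \<and> ?in (l @ zs) s t D \<and> fst (sem ?c \<tau>) rs = s \<and> fst (sem ?c \<tau>) rt = t"
    if l: "inv \<tau> l" and r: "fst \<tau> rs = s" "fst \<tau> rt = t" "fst \<tau> rD = D" "s \<le> n" "t \<le> n" "D \<le> d + 1"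
    for \<tau> l s t D
  proof (cases "s \<noteq> t \<or> s = n")
    case False
    then have "sem ?c \<tau> = upd rr 0 \<tau>" using r inv_regs(1)[OF l] by (simp add: nop_def)
    moreover have "inv (upd rr 0 \<tau>) l" by (rule inv_upd[OF l]) simp
    ultimately show ?thesis using False r by (intro exI[of _ "[]"]) auto
  next
    case True
    have "near \<tau> (sem ?w \<tau>) \<and> holds (snd (sem ?w \<tau>)) (R 0) (s, t, 1, D, {}, {(0, 1), (1, 0)})"
    proof (rule sem_write, goal_cases)
      case 1
      then show ?case using l by (simp add: inv_def)
    qed (use r in \<open>auto simp: near_def\<close>)
    then have w: "near \<tau> (sem ?w \<tau>)" "holds (snd (sem ?w \<tau>)) (R 0) (edge_summary s t D)"
      by (auto simp: edge_summary_def)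
    have "inv (sem insert_com (sem ?w \<tau>)) (ins (edge_summary s t D) l)"
      by (rule sem_insert[OF near_inv[OF w(1) l] w(2)]) (use reach.edge r True in blast)
    moreover have s: "sem ?c \<tau> = sem insert_com (sem ?w \<tau>)" using True r inv_regs(1)[OF l] by auto
    moreover have "fst (sem ?c \<tau>) rs = s" "fst (sem ?c \<tau>) rt = t"
      using r by (simp_all add: sem_frame asgd_insert nop_def)
    ultimately show ?thesis using ins_append[of True "edge_summary s t D" l] by auto
  qed
  have le: "(\<forall>D<d + 2. Q D) \<longleftrightarrow> (\<forall>D\<le>d + 1. Q D)" "(\<forall>t<n + 1. Q t) \<longleftrightarrow> (\<forall>t\<le>n. Q t)" for Q
    by (auto simp: less_Suc_eq_le)
  have D2: "fst \<tau> rd2 = d + 2" "fst \<tau> rn1 = n + 1" if "inv \<tau> l" for \<tau> l using inv_regs[OF that] by auto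
  have "\<exists>ys. inv (sem edge_com \<sigma>) ys \<and> (\<forall>s<fst \<sigma> rn1. \<forall>t\<le>n. \<forall>D\<le>d + 1. ?in ys s t D)"
    unfolding edge_com_def
  proof (rule sem_For[where I = "\<lambda>s' \<tau>. \<exists>l. inv \<tau> l \<and> (\<forall>s<s'. \<forall>t\<le>n. \<forall>D\<le>d + 1. ?in l s t D)"])
    fix s \<tau> assume s: "s < fst \<sigma> rn1" and "\<exists>l. inv \<tau> l \<and> (\<forall>s'<s. \<forall>t\<le>n. \<forall>D\<le>d + 1. ?in l s' t D)"
    then obtain l where l: "inv \<tau> l" "\<forall>s'<s. \<forall>t\<le>n. \<forall>D\<le>d + 1. ?in l s' t D" by blast
    have sn: "s \<le> n" using s D2[OF inv] by simp
    let ?\<tau> = "upd rs s \<tau>"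
    have \<tau>: "inv ?\<tau> l" by (rule inv_upd[OF l(1)]) simp
    have "\<exists>ys. inv (sem (CFor rt rn1 (CFor rD rd2 ?c)) ?\<tau>) (l @ ys) \<and>
      fst (sem (CFor rt rn1 (CFor rD rd2 ?c)) ?\<tau>) rs = s \<and> (\<forall>t<fst ?\<tau> rn1. \<forall>D\<le>d + 1. ?in (l @ ys) s t D)"
    proof (rule sem_For[where I = "\<lambda>t' \<rho>. \<exists>ys. inv \<rho> (l @ ys) \<and> fst \<rho> rs = s \<and> (\<forall>t<t'. \<forall>D\<le>d + 1. ?in (l @ ys) s t D)"])
      show "\<exists>ys. inv ?\<tau> (l @ ys) \<and> fst ?\<tau> rs = s \<and> (\<forall>t<0. \<forall>D\<le>d + 1. ?in (l @ ys) s t D)"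
        using \<tau> by (intro exI[of _ "[]"]) auto
    next
      fix t \<rho> assume t: "t < fst ?\<tau> rn1" and
        "\<exists>ys. inv \<rho> (l @ ys) \<and> fst \<rho> rs = s \<and> (\<forall>t'<t. \<forall>D\<le>d + 1. ?in (l @ ys) s t' D)"
      then obtain ys where ys: "inv \<rho> (l @ ys)" "fst \<rho> rs = s" "\<forall>t'<t. \<forall>D\<le>d + 1. ?in (l @ ys) s t' D" by blast
      have tn: "t \<le> n" using t D2[OF \<tau>] by simp
      let ?\<rho> = "upd rt t \<rho>"
      have \<rho>: "inv ?\<rho> (l @ ys)" by (rule inv_upd[OF ys(1)]) simp
      let ?K = "\<lambda>D' \<mu>. \<exists>zs. inv \<mu> ((l @ ys) @ zs) \<and> fst \<mu> rs = s \<and> fst \<mu> rt = t \<and> (\<forall>D<D'. ?in ((l @ ys) @ zs) s t D)"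
      have "?K (fst ?\<rho> rd2) (sem (CFor rD rd2 ?c) ?\<rho>)"
      proof (rule sem_For[where I = ?K])
        show "?K 0 ?\<rho>" using \<rho> ys(2) by (intro exI[of _ "[]"]) auto
      next
        fix D \<mu> assume D: "D < fst ?\<rho> rd2" and "?K D \<mu>"
        then obtain zs where zs: "inv \<mu> ((l @ ys) @ zs)" "fst \<mu> rs = s" "fst \<mu> rt = t"
          "\<forall>D'<D. ?in ((l @ ys) @ zs) s t D'" by blast
        have "inv (upd rD D \<mu>) ((l @ ys) @ zs)" by (rule inv_upd[OF zs(1)]) simp
        from body[OF this, of s t D] zs(2,3) sn tn D D2[OF \<rho>] obtain us where
          "inv (sem ?c (upd rD D \<mu>)) (((l @ ys) @ zs) @ us)" "?in (((l @ ys) @ zs) @ us) s t D"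
          "fst (sem ?c (upd rD D \<mu>)) rs = s" "fst (sem ?c (upd rD D \<mu>)) rt = t" by (auto simp del: sem.simps)
        then show "?K (Suc D) (sem ?c (upd rD D \<mu>))"
          using zs(4) by (intro exI[of _ "zs @ us"]) (auto simp: less_Suc_eq simp del: sem.simps)
      qed
      then obtain zs where zs: "inv (sem (CFor rD rd2 ?c) ?\<rho>) ((l @ ys) @ zs)" "fst (sem (CFor rD rd2 ?c) ?\<rho>) rs = s"
        "\<forall>D\<le>d + 1. ?in ((l @ ys) @ zs) s t D" unfolding D2[OF \<rho>] le by blast
      then show "\<exists>ys. inv (sem (CFor rD rd2 ?c) ?\<rho>) (l @ ys) \<and> fst (sem (CFor rD rd2 ?c) ?\<rho>) rs = s \<and>
          (\<forall>t'<Suc t. \<forall>D\<le>d + 1. ?in (l @ ys) s t' D)"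
      proof (intro exI[of _ "ys @ zs"] conjI allI impI)
        fix t' D assume t': "t' < Suc t" "D \<le> d + 1" "s \<noteq> t' \<or> s = n"
        show "edge_summary s t' D \<in> set (l @ ys @ zs)"
        proof (cases "t' = t")
          case False
          then have "edge_summary s t' D \<in> set (l @ ys)" using ys(3) t' by (simp add: less_Suc_eq)
          then show ?thesis by auto
        qed (use zs(3) t' in auto)
      qed (use zs(1,2) in simp_all)
    qed
    then obtain ys where ys: "inv (sem (CFor rt rn1 (CFor rD rd2 ?c)) ?\<tau>) (l @ ys)"
      "\<forall>t\<le>n. \<forall>D\<le>d + 1. ?in (l @ ys) s t D" unfolding D2[OF \<tau>] le by blast
    then show "\<exists>l. inv (sem (CFor rt rn1 (CFor rD rd2 ?c)) ?\<tau>) l \<and> (\<forall>s'<Suc s. \<forall>t\<le>n. \<forall>D\<le>d + 1. ?in l s' t D)"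
    proof (intro exI[of _ "l @ ys"] conjI allI impI)
      fix s' t D assume s': "s' < Suc s" "t \<le> n" "D \<le> d + 1" "s' \<noteq> t \<or> s' = n"
      show "edge_summary s' t D \<in> set (l @ ys)"
      proof (cases "s' = s")
        case False
        then have "edge_summary s' t D \<in> set l" using l(2) s' by (simp add: less_Suc_eq)
        then show ?thesis by auto
      qed (use ys(2) s' in auto)
    qed (rule ys(1))
  qed (use inv in auto)
  then show ?thesis unfolding D2[OF inv] le .
qed

lemma sem_accept_com:
  assumes inv: "inv \<sigma> xs"
  shows "fst (sem accept_com \<sigma>) 0 = of_bool (\<exists>x\<in>set xs. accepting x)"
proof -
  let ?g = "eand (eeq (efld rx 3) (EV rd1))
            (enot (eand (elt (efld rx 0) (EV rn)) (eand (elt (efld rx 1) (EV rn))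
              (eand (eA (efld rx 0) (efld rx 1)) (enot (eeq (efld rx 2) (EN 1)))))))"
  let ?v = "eor (eS rx (EV rv)) (eor (eeq (EV rv) (efld rx 0)) (eeq (EV rv) (efld rx 1)))"
  let ?a = "CIf ?g (call rr [(rv, rn)] ?v ;; CIf (EV rr) (CAsg 0 (EN 1)) nop) nop"
  let ?c = "CIf (elt (EV ri) (EV rlen)) (CAsg rx (eadr (EAdd (EV ri) (EN 1)) (EN 0)) ;; ?a) nop"
  let ?\<sigma> = "upd 0 0 \<sigma>"
  have \<sigma>: "inv ?\<sigma> xs" by (rule inv_upd[OF inv]) simp
  let ?I = "\<lambda>i \<tau>. inv \<tau> xs \<and> fst \<tau> 0 = of_bool (\<exists>j<i. j < length xs \<and> accepting (xs ! j))"
  have "?I (fst ?\<sigma> rM) (sem (CFor ri rM ?c) ?\<sigma>)"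
  proof (rule sem_For[where I = ?I])
    fix i \<tau> assume I: "?I i \<tau>"
    let ?\<tau> = "upd ri i \<tau>"
    have \<tau>: "inv ?\<tau> xs" by (rule inv_upd) (use I in auto)
    show "?I (Suc i) (sem ?c ?\<tau>)"
    proof (cases "i < length xs")
      case False
      then have "sem ?c ?\<tau> = upd rr 0 ?\<tau>" using inv_regs(9)[OF \<tau>] by (simp add: nop_def)
      moreover have "inv (upd rr 0 ?\<tau>) xs" by (rule inv_upd[OF \<tau>]) simp
      ultimately show ?thesis using I False by (auto simp: less_Suc_eq)
    next
      case True
      obtain s t e D S P where X: "xs ! i = (s, t, e, D, S, P)" by (cases "xs ! i")
      define \<rho> where "\<rho> = upd rx (R (Suc i)) ?\<tau>"
      have \<rho>: "inv \<rho> xs" unfolding \<rho>_def by (rule inv_upd[OF \<tau>]) simp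
      have s: "sem ?c ?\<tau> = sem ?a \<rho>"
        using True inv_regs(9)[OF \<tau>] eadr_record[OF \<tau>, of "EV ri", unfolded One_nat_def] by (simp add: \<rho>_def)
      define \<mu> where "\<mu> = sem (call rr [(rv, rn)] ?v) \<rho>"
      have ev: "rr \<notin> evars ?v" "rr \<notin> fst ` set [(rv, rn)]" "rr \<notin> snd ` set [(rv, rn)]"
        "fst ` set [(rv, rn)] \<inter> snd ` set [(rv, rn)] = {}" by auto
      have n\<mu>: "near \<rho> \<mu>" unfolding \<mu>_def by (rule near_call[OF near_refl ev]) auto
      have h: "holds (snd \<rho>') (fst \<rho>' rx) (s, t, e, D, S, P)" "fst \<rho>' rn = n" "fst \<rho>' rd2 = d + 2"
        if "near \<rho> \<rho>'" for \<rho>'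
      proof -
        have i: "inv \<rho>' xs" by (rule near_inv[OF that \<rho>])
        have "fst \<rho>' rx = R (Suc i)" using that by (simp add: near_def \<rho>_def)
        then show "holds (snd \<rho>') (fst \<rho>' rx) (s, t, e, D, S, P)" using True X[symmetric] i by (simp add: inv_def)
        show "fst \<rho>' rn = n" "fst \<rho>' rd2 = d + 2" using inv_regs[OF i] by simp_all
      qed
      have env: "env \<rho>" using \<rho> by (simp add: inv_def)
      have ea: "aval (eA (efld rx 0) (efld rx (Suc 0))) \<rho> = of_bool (A s t)" if "s < n" "t < n"
        using eA_access[OF env, of "efld rx 0" "efld rx (Suc 0)"] access[OF h[OF near_refl]] that by simp
      have g: "aval ?g \<rho> \<noteq> 0 \<longleftrightarrow> D = d + 1 \<and> (s < n \<and> t < n \<and> A s t \<longrightarrow> e = 1)"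
        using access[OF h[OF near_refl]] ea inv_regs[OF \<rho>] by auto
      have u: "near \<rho> (upd rv v \<rho>)" for v by (rule near_upd) auto
      have "allv [(rv, rn)] ?v \<rho> \<longleftrightarrow> (\<forall>v<n. v \<in> S \<or> v = s \<or> v = t)"
        using access[OF h[OF u]] inv_regs[OF \<rho>] by auto
      then have m: "fst \<mu> rr = of_bool (\<forall>v<n. v \<in> S \<or> v = s \<or> v = t)"
        using sem_call(2)[OF ev, of \<rho>] by (simp add: \<mu>_def)
      have *: "sem ?a \<rho> = (if aval ?g \<rho> \<noteq> 0 then if aval (EV rr) \<mu> \<noteq> 0 then upd 0 1 \<mu> else sem nop \<mu> else sem nop \<rho>)"
        by (simp only: sem.simps(1,3,4) \<mu>_def aval.simps(2))
      have a: "sem ?a \<rho> = (if D = d + 1 \<and> (s < n \<and> t < n \<and> A s t \<longrightarrow> e = 1) then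
          if \<forall>v<n. v \<in> S \<or> v = s \<or> v = t then upd 0 1 \<mu> else upd rr 0 \<mu> else upd rr 0 \<rho>)"
      proof -
        have "aval (EV rr) \<mu> \<noteq> 0 \<longleftrightarrow> (\<forall>v<n. v \<in> S \<or> v = s \<or> v = t)" using m by simp
        moreover have "sem nop \<nu> = upd rr 0 \<nu>" for \<nu> by (simp add: nop_def)
        ultimately show ?thesis using * unfolding g by (simp only:)
      qed
      have \<mu>: "inv \<mu> xs" by (rule near_inv[OF n\<mu> \<rho>])
      have 0: "fst \<mu> 0 = fst \<tau> 0" "fst \<rho> 0 = fst \<tau> 0" using n\<mu> by (simp_all add: near_def \<rho>_def)
      have "inv (sem ?a \<rho>) xs" unfolding a using inv_upd[OF \<mu>] inv_upd[OF \<rho>] by simp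
      moreover have "fst (sem ?a \<rho>) 0 = of_bool (fst \<tau> 0 \<noteq> 0 \<or> accepting (xs ! i))"
        unfolding a X using 0 I by auto
      moreover have "(\<exists>j<Suc i. j < length xs \<and> accepting (xs ! j)) \<longleftrightarrow> fst \<tau> 0 \<noteq> 0 \<or> accepting (xs ! i)"
        using I True by (auto simp: less_Suc_eq)
      ultimately show ?thesis unfolding s by simp
    qed
  qed (use \<sigma> in auto)
  then have "fst (sem (CFor ri rM ?c) ?\<sigma>) 0 = of_bool (\<exists>j<bound. j < length xs \<and> accepting (xs ! j))"
    unfolding inv_regs(8)[OF \<sigma>] by blast
  moreover have "(\<exists>j<bound. j < length xs \<and> accepting (xs ! j)) \<longleftrightarrow> (\<exists>x\<in>set xs. accepting x)"
  proof
    assume "\<exists>x\<in>set xs. accepting x"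
    then obtain j where "j < length xs" "accepting (xs ! j)" by (metis in_set_conv_nth)
    then show "\<exists>j<bound. j < length xs \<and> accepting (xs ! j)"
      using length_inv[OF inv] by (meson less_le_trans)
  qed (use nth_mem in blast)
  moreover have "sem accept_com \<sigma> = sem (CFor ri rM ?c) ?\<sigma>"
    by (simp only: accept_com_def sem.simps(1,3) aval.simps(2))
  ultimately show ?thesis by simp
qed

text \<open>The final list contains the edge summaries and is closed under both rules, hence
  contains \<open>reach\<close> by induction; the invariant gives the other inclusion.\<close>

lemma sem_main_com:
  assumes "env \<sigma>"
  shows "fst (sem main_com \<sigma>) 0 = of_bool (\<exists>x\<in>reach. accepting x)"
proof -
  have "inv (upd rlen 0 \<sigma>) []" using assms by (simp add: inv_def env_def)
  from sem_edge_com[OF this] obtain es where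
    es: "inv (sem edge_com (upd rlen 0 \<sigma>)) es" "\<And>s t D. s \<le> n \<Longrightarrow> t \<le> n \<Longrightarrow> D \<le> d + 1 \<Longrightarrow> s \<noteq> t \<or> s = n \<Longrightarrow>
      edge_summary s t D \<in> set es" by blast
  from sem_sat_com[OF es(1)] obtain ys where
    ys: "inv (sem sat_com (sem edge_com (upd rlen 0 \<sigma>))) ys" "set es \<subseteq> set ys"
      "\<And>x y. x \<in> set ys \<Longrightarrow> y \<in> set ys \<Longrightarrow> closed (set ys) x y" by blast
  have "x \<in> set ys" if "x \<in> reach" for x
    using that
  proof induction
    case (edge s t D)
    then show ?case using es(2) ys(2) by blast
  next
    case (series x y D)
    then show ?case using ys(3)[of x y] by (auto simp: closed_def closed_at_def)
  next
    case (parallel x y D)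
    then show ?case using ys(3)[of x y] by (auto simp: closed_def closed_at_def)
  qed
  then have "set ys = reach" using ys(1) by (auto simp: inv_def)
  then show ?thesis using sem_accept_com[OF ys(1)] by (simp add: main_com_def)
qed

end

section \<open>Setup and running time\<close>

definition setup1 :: com where
  "setup1 = CAsg rn (ELd (EN 1)) ;; CAsg rd1 (EAdd (ELd (EN 0)) (EN 1)) ;; CAsg rd2 (EAdd (ELd (EN 0)) (EN 2)) ;;
     CAsg rn1 (EAdd (EV rn) (EN 1)) ;; CAsg rtwo (EN 2)"

text \<open>\<open>rx\<close> is doubled once per neighbour of \<open>ri\<close>, \<open>rT\<close>
  accumulates \<open>weight_sum\<close>, and \<open>ry\<close> starts from \<open>rT\<close> and is
  quadrupled \<open>(d + 2) ^ 2\<close> times. The product of the last two, formed in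
  \<open>setup3\<close>, is \<open>bound\<close>.\<close>

definition setup2 :: com where
  "setup2 = CAsg rQ (EAdd (EN 2) (EMul rn (EV rn))) ;;
     CAsg rW (EAdd (EAdd (EN 4) (EV rn)) (EMul rd2 (EV rd2))) ;;
     CAsg rT (EN 2) ;;
     CFor ri rn
       (CAsg rx (EN 1) ;;
        CFor rj rn (CIf (eA (EV ri) (EV rj)) (CAsg rx (EAdd (EV rx) (EV rx))) nop) ;;
        CAsg rT (EAdd (EV rT) (EV rx))) ;;
     CAsg ry (EV rT) ;;
     CFor ri rd2 (CFor rj rd2 (CAsg ry (EAdd (EAdd (EV ry) (EV ry)) (EAdd (EV ry) (EV ry)))))"

definition setup3 :: com where
  "setup3 = CAsg rM (EMul rT (EV ry))"

text \<open>A compiled piece may not assign its own loop bounds, so the program comes in stages that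
  supply bounds to later ones: \<open>rn\<close> and \<open>rd2\<close>, then \<open>rT\<close>,
  then \<open>rM\<close>.\<close>

definition sp_program :: program where
  "sp_program = Seq (compile setup1 31) (Seq (compile setup2 31) (Seq (compile setup3 31) (compile main_com 31)))"

context dp
begin

lemma sem_setup1:
  assumes "snd \<sigma> 0 = d" "snd \<sigma> 1 = n"
  shows "fst (sem setup1 \<sigma>) rn = n" "fst (sem setup1 \<sigma>) rd1 = d + 1" "fst (sem setup1 \<sigma>) rd2 = d + 2"
    "fst (sem setup1 \<sigma>) rn1 = n + 1" "fst (sem setup1 \<sigma>) rtwo = 2" "snd (sem setup1 \<sigma>) = snd \<sigma>"
  using assms by (simp_all add: setup1_def)

lemma sem_weight_sum:
  assumes "fst \<sigma> rn = n" and A: "\<And>i j. i < n \<Longrightarrow> j < n \<Longrightarrow> snd \<sigma> (2 + n * i + j) = of_bool (A i j)"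
    and "fst \<sigma> rT = 2"
  defines "c \<equiv> CFor rj rn (CIf (eA (EV ri) (EV rj)) (CAsg rx (EAdd (EV rx) (EV rx))) nop)"
  defines "b \<equiv> CAsg rx (EN 1) ;; c ;; CAsg rT (EAdd (EV rT) (EV rx))"
  shows "fst (sem (CFor ri rn b) \<sigma>) rT = weight_sum" "snd (sem (CFor ri rn b) \<sigma>) = snd \<sigma>"
proof -
  have fr: "fst (sem c \<tau>) r = fst \<tau> r" if "r \<notin> {rj, rx, rr}" for r \<tau>
    using that by (intro sem_frame) (auto simp: c_def nop_def)
  have inner: "fst (sem c \<tau>) rx = 2 ^ card (nbrs i) \<and> snd (sem c \<tau>) = snd \<sigma>"
    if \<tau>: "fst \<tau> ri = i" "i < n" "fst \<tau> rn = n" "snd \<tau> = snd \<sigma>" "fst \<tau> rx = 1" for \<tau> i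
  proof -
    let ?J = "\<lambda>j \<rho>. fst \<rho> rx = 2 ^ card {k. k < j \<and> A i k} \<and> snd \<rho> = snd \<sigma> \<and> fst \<rho> ri = i \<and> fst \<rho> rn = n"
    have "?J (fst \<tau> rn) (sem c \<tau>)" unfolding c_def
    proof (rule sem_For[where I = ?J])
      fix j \<rho> assume j: "j < fst \<tau> rn" "?J j \<rho>"
      have e: "aval (eA (EV ri) (EV rj)) (upd rj j \<rho>) = of_bool (A i j)"
        using j A[OF \<tau>(2), of j] \<tau>(3) by (simp add: eA_def)
      have "{k. k < Suc j \<and> A i k} = (if A i j then insert j {k. k < j \<and> A i k} else {k. k < j \<and> A i k})"
        by (auto simp: less_Suc_eq)
      then have "card {k. k < Suc j \<and> A i k} = (if A i j then Suc (card {k. k < j \<and> A i k}) else card {k. k < j \<and> A i k})"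
        by simp
      then show "?J (Suc j) (sem (CIf (eA (EV ri) (EV rj)) (CAsg rx (EAdd (EV rx) (EV rx))) nop) (upd rj j \<rho>))"
        using j(2) e by (auto simp: nop_def)
    qed (use \<tau> in auto)
    moreover have "{k. k < n \<and> A i k} = nbrs i" using \<tau>(2) by (auto simp: nbrs_def)
    ultimately show ?thesis using \<tau>(3) by simp
  qed
  let ?I = "\<lambda>i \<tau>. fst \<tau> rT = 2 + (\<Sum>j<i. 2 ^ card (nbrs j)) \<and> snd \<tau> = snd \<sigma> \<and> fst \<tau> rn = n"
  have "?I (fst \<sigma> rn) (sem (CFor ri rn b) \<sigma>)"
  proof (rule sem_For[where I = ?I])
    fix i \<tau> assume i: "i < fst \<sigma> rn" "?I i \<tau>"
    have "fst (sem c (upd rx 1 (upd ri i \<tau>))) rx = 2 ^ card (nbrs i) \<and> snd (sem c (upd rx 1 (upd ri i \<tau>))) = snd \<sigma>"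
      by (rule inner) (use i assms(1) in auto)
    then show "?I (Suc i) (sem b (upd ri i \<tau>))"
      using i(2) fr by (simp add: b_def)
  qed (use assms in auto)
  then show "fst (sem (CFor ri rn b) \<sigma>) rT = weight_sum" "snd (sem (CFor ri rn b) \<sigma>) = snd \<sigma>"
    unfolding assms(1) by (auto simp: weight_sum_def)
qed

lemma sem_quadruple:
  assumes "fst \<sigma> rd2 = d + 2"
  defines "c \<equiv> CAsg ry (EAdd (EAdd (EV ry) (EV ry)) (EAdd (EV ry) (EV ry)))"
  shows "fst (sem (CFor ri rd2 (CFor rj rd2 c)) \<sigma>) ry = fst \<sigma> ry * 4 ^ ((d + 2) ^ 2)"
    "snd (sem (CFor ri rd2 (CFor rj rd2 c)) \<sigma>) = snd \<sigma>"
proof -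
  have inner: "fst (sem (CFor rj rd2 c) \<tau>) ry = fst \<tau> ry * 4 ^ (d + 2) \<and> snd (sem (CFor rj rd2 c) \<tau>) = snd \<tau> \<and>
      fst (sem (CFor rj rd2 c) \<tau>) rd2 = d + 2" if "fst \<tau> rd2 = d + 2" for \<tau>
  proof -
    let ?J = "\<lambda>j \<rho>. fst \<rho> ry = fst \<tau> ry * 4 ^ j \<and> snd \<rho> = snd \<tau> \<and> fst \<rho> rd2 = d + 2"
    have "?J (fst \<tau> rd2) (sem (CFor rj rd2 c) \<tau>)"
      by (rule sem_For[where I = ?J]) (use that in \<open>auto simp: c_def\<close>)
    then show ?thesis unfolding that .
  qed
  let ?I = "\<lambda>i \<tau>. fst \<tau> ry = fst \<sigma> ry * 4 ^ ((d + 2) * i) \<and> snd \<tau> = snd \<sigma> \<and> fst \<tau> rd2 = d + 2"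
  have "?I (fst \<sigma> rd2) (sem (CFor ri rd2 (CFor rj rd2 c)) \<sigma>)"
  proof (rule sem_For[where I = ?I])
    fix i \<tau> assume I: "?I i \<tau>"
    then have "fst (upd ri i \<tau>) rd2 = d + 2" by simp
    from inner[OF this] I show "?I (Suc i) (sem (CFor rj rd2 c) (upd ri i \<tau>))"
      by (simp add: power_add mult_ac del: sem.simps)
  qed (use assms(1) in auto)
  then show "fst (sem (CFor ri rd2 (CFor rj rd2 c)) \<sigma>) ry = fst \<sigma> ry * 4 ^ ((d + 2) ^ 2)"
    "snd (sem (CFor ri rd2 (CFor rj rd2 c)) \<sigma>) = snd \<sigma>"
    unfolding assms(1) power2_eq_square by auto
qed

lemma sem_setup2:
  assumes "fst \<sigma> rn = n" "fst \<sigma> rd2 = d + 2"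
    and A: "\<And>i j. i < n \<Longrightarrow> j < n \<Longrightarrow> snd \<sigma> (2 + n * i + j) = of_bool (A i j)"
  shows "fst (sem setup2 \<sigma>) rQ = R 0" "fst (sem setup2 \<sigma>) rW = W" "fst (sem setup2 \<sigma>) rT = weight_sum"
    "fst (sem setup2 \<sigma>) ry = weight_sum * 4 ^ ((d + 2) ^ 2)" "snd (sem setup2 \<sigma>) = snd \<sigma>"
proof -
  let ?\<sigma>1 = "upd rT 2 (upd rW W (upd rQ (R 0) \<sigma>))"
  let ?b = "CAsg rx (EN 1) ;;
        CFor rj rn (CIf (eA (EV ri) (EV rj)) (CAsg rx (EAdd (EV rx) (EV rx))) nop) ;;
        CAsg rT (EAdd (EV rT) (EV rx))"
  let ?q = "CFor ri rd2 (CFor rj rd2 (CAsg ry (EAdd (EAdd (EV ry) (EV ry)) (EAdd (EV ry) (EV ry)))))"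
  let ?\<sigma>2 = "sem (CFor ri rn ?b) ?\<sigma>1"
  let ?\<sigma>3 = "upd ry (fst ?\<sigma>2 rT) ?\<sigma>2"
  have sem: "sem setup2 \<sigma> = sem ?q ?\<sigma>3"
    using assms(1,2) by (simp add: setup2_def R_def W_def del: sem.simps(5))
  have w: "fst ?\<sigma>2 rT = weight_sum" "snd ?\<sigma>2 = snd ?\<sigma>1"
    by (rule sem_weight_sum; use assms(1) A in simp)+
  have fr2: "fst ?\<sigma>2 r = fst ?\<sigma>1 r" if "r \<in> {rQ, rW, rd2}" for r
    by (rule sem_frame) (use that in \<open>auto simp: nop_def\<close>)
  have "fst ?\<sigma>3 rd2 = d + 2" using fr2[of rd2] assms(2) by simp
  note q = sem_quadruple[OF this]
  show "fst (sem setup2 \<sigma>) ry = weight_sum * 4 ^ ((d + 2) ^ 2)" "snd (sem setup2 \<sigma>) = snd \<sigma>"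
    unfolding sem q using w by simp_all
  have fr3: "fst (sem ?q ?\<sigma>3) r = fst ?\<sigma>3 r" if "r \<in> {rQ, rW, rT}" for r
    by (rule sem_frame) (use that in auto)
  show "fst (sem setup2 \<sigma>) rQ = R 0" "fst (sem setup2 \<sigma>) rW = W" "fst (sem setup2 \<sigma>) rT = weight_sum"
    unfolding sem using fr3[of rQ] fr3[of rW] fr3[of rT] fr2[of rQ] fr2[of rW] w(1) by (simp_all del: sem.simps)
qed

end

lemma static_loops:
  "cloops setup1 = {}" "cloops setup2 = {rn, rd2}" "cloops setup3 = {rT}"
  "cloops main_com \<subseteq> {rn, rd2, rn1, rtwo, rW, rM}"
  by (auto simp: setup1_def setup2_def setup3_def main_com_def edge_com_def sat_com_def swap_com_def accept_com_def pair_com_def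
      ser_com_def par_com_def ser_wr_def par_wr_def comb_com_def write_com_def insert_com_def nop_def call_def)

lemma static_assigned:
  "asgd setup2 \<inter> {rn, rd2, rd1, rn1, rtwo} = {}" "asgd setup3 = {rM}"
  "asgd main_com \<inter> {rn, rd2, rn1, rtwo, rW, rM} = {}"
  by (auto simp: setup1_def setup2_def setup3_def main_com_def edge_com_def sat_com_def swap_com_def accept_com_def pair_com_def
      ser_com_def par_com_def ser_wr_def par_wr_def comb_com_def write_com_def insert_com_def nop_def call_def)

lemma static_vars:
  "\<forall>x\<in>cvars setup1. x < 31" "\<forall>x\<in>cvars setup2. x < 31" "\<forall>x\<in>cvars setup3. x < 31" "\<forall>x\<in>cvars main_com. x < 31"
  by (auto simp: setup1_def setup2_def setup3_def main_com_def edge_com_def sat_com_def swap_com_def accept_com_def pair_com_def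
      ser_com_def par_com_def ser_wr_def par_wr_def comb_com_def write_com_def insert_com_def nop_def call_def)

definition sp_cost :: "nat \<Rightarrow> nat" where
  "sp_cost B = ccost setup1 B + (ccost setup2 B + (ccost setup3 B + ccost main_com B))"

lemma (in dp_prog) run_sp_program:
  assumes "snd \<sigma> 0 = d" "snd \<sigma> 1 = n"
    and A: "\<And>i j. i < n \<Longrightarrow> j < n \<Longrightarrow> snd \<sigma> (2 + n * i + j) = of_bool (A i j)"
  shows "\<exists>k \<tau>. exec sp_program \<sigma> k \<tau> \<and> fst \<tau> 0 = of_bool (\<exists>x\<in>reach. accepting x) \<and> k \<le> sp_cost bound"
proof -
  note s1 = sem_setup1[OF assms(1,2)]
  have A1: "snd (sem setup1 \<sigma>) (2 + n * i + j) = of_bool (A i j)" if "i < n" "j < n" for i j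
    using A[OF that] s1(6) by simp
  note s2 = sem_setup2[OF s1(1,3) A1]
  let ?\<sigma>2 = "sem setup2 (sem setup1 \<sigma>)"
  let ?\<sigma>3 = "sem setup3 ?\<sigma>2"
  have fr: "fst ?\<sigma>2 r = fst (sem setup1 \<sigma>) r" if "r \<in> {rn, rd2, rd1, rn1, rtwo}" for r
    using static_assigned(1) that by (intro sem_frame) blast
  have s3: "fst ?\<sigma>3 rM = bound" "snd ?\<sigma>3 = snd \<sigma>" "\<And>r. r \<noteq> rM \<Longrightarrow> fst ?\<sigma>3 r = fst ?\<sigma>2 r"
    using s2 s1(6) by (auto simp: setup3_def bound_def power2_eq_square)
  have env: "env ?\<sigma>3"
    unfolding env_def using s1 s2 s3 fr A by simp
  \<comment> \<open>All registers that bound a loop of the main program have to stay below the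
    single parameter \<open>bound\<close> of the cost function.\<close>
  have "W \<le> bound" "n + 1 \<le> bound" "d + 2 \<le> bound" "2 \<le> bound"
  proof -
    have "d + 2 \<le> (d + 2) ^ 2" by (simp add: power2_eq_square)
    then show "n + 1 \<le> bound" "d + 2 \<le> bound" "2 \<le> bound" using bound_ge(1) by linarith+
    show "W \<le> bound" using bound_ge(1) by (simp add: W_def power2_eq_square)
  qed
  note le = this
  have sim: "simul 31 \<sigma> \<sigma>" by (simp add: simul_def)
  obtain k1 \<tau>1 where r1: "exec (compile setup1 31) \<sigma> k1 \<tau>1" "k1 \<le> ccost setup1 bound" "simul 31 (sem setup1 \<sigma>) \<tau>1"
    by (rule run_compile[where B = bound, OF static_vars(1) _ _ sim]) (auto simp: static_loops)
  obtain k2 \<tau>2 where r2: "exec (compile setup2 31) \<tau>1 k2 \<tau>2" "k2 \<le> ccost setup2 bound" "simul 31 ?\<sigma>2 \<tau>2"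
    by (rule run_compile[where B = bound, OF static_vars(2) _ _ r1(3)]) (use static_assigned(1) s1 le in \<open>auto simp: static_loops\<close>)
  obtain k3 \<tau>3 where r3: "exec (compile setup3 31) \<tau>2 k3 \<tau>3" "k3 \<le> ccost setup3 bound" "simul 31 ?\<sigma>3 \<tau>3"
    by (rule run_compile[where B = bound, OF static_vars(3) _ _ r2(3)])
      (use static_assigned(2) s2(3) bound_ge(2) in \<open>auto simp: static_loops\<close>)
  have "fst ?\<sigma>3 y \<le> bound" if "y \<in> {rn, rd2, rn1, rtwo, rW, rM}" for y
    using that le env by (auto simp: env_def)
  then have l4: "\<forall>y\<in>cloops main_com. fst ?\<sigma>3 y \<le> bound" using static_loops(4) by blast
  have "cloops main_com \<inter> asgd main_com = {}" using static_loops(4) static_assigned(3) by blast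
  then obtain k4 \<tau>4 where r4: "exec (compile main_com 31) \<tau>3 k4 \<tau>4" "k4 \<le> ccost main_com bound"
    "simul 31 (sem main_com ?\<sigma>3) \<tau>4" using run_compile[OF static_vars(4) l4 _ r3(3)] by blast
  have "exec sp_program \<sigma> (k1 + (k2 + (k3 + k4))) \<tau>4"
    unfolding sp_program_def by (rule exec_Seq r1(1) r2(1) r3(1) r4(1))+
  moreover have "fst \<tau>4 0 = of_bool (\<exists>x\<in>reach. accepting x)"
    using r4(3) sem_main_com[OF env] by (simp add: simul_def)
  moreover have "k1 + (k2 + (k3 + k4)) \<le> sp_cost bound"
    using r1(2) r2(2) r3(2) r4(2) by (simp add: sp_cost_def)
  ultimately show ?thesis by blast
qed

lemma sp_cost_poly: "\<exists>c h. \<forall>B. sp_cost B \<le> c * (B + 1) ^ h"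
  using ccost_poly[of "setup1 ;; setup2 ;; setup3 ;; main_com"] by (simp add: sp_cost_def)

lemma nth_concat_square:
  assumes "\<And>x. x \<in> set xs \<Longrightarrow> length (f x) = m" "i < length xs" "j < m"
  shows "concat (map f xs) ! (m * i + j) = f (xs ! i) ! j"
  using assms
proof (induction xs arbitrary: i)
  case (Cons x xs)
  then show ?case by (cases i) (auto simp: nth_append)
qed simp

lemma encode_nth:
  assumes "distinct vs" "i < length vs" "j < length vs"
  shows "snd (initial_state (encode d vs G)) (2 + length vs * i + j) = of_bool ((vs ! i, vs ! j) \<in> parcs G)"
proof -
  let ?f = "\<lambda>u. map (\<lambda>v. if (u, v) \<in> parcs G then 1 else 0 :: nat) vs"
  let ?n = "length vs"
  have l: "length (concat (map ?f vs)) = ?n * ?n" by (simp add: length_concat comp_def sum_list_triv)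
  have "?n * i + j < ?n * Suc i" using assms(3) by simp
  also have "?n * Suc i \<le> ?n * ?n" using assms(2) by (intro mult_le_mono2) simp
  finally have lt: "?n * i + j < ?n * ?n" .
  have "concat (map ?f vs) ! (?n * i + j) = ?f (vs ! i) ! j"
    by (rule nth_concat_square) (use assms in auto)
  then show ?thesis using lt l assms(3) by (simp add: initial_state_def encode_def)
qed

text \<open>The exponent is a number of doublings, arranged as nested loops of \<open>d + 2\<close>,
  \<open>d + 2\<close> and \<open>c\<close> rounds; \<open>c\<close> is a constant in the program
  text.\<close>

lemma computable_exp_square: "computable (\<lambda>d. 2 ^ (c * (d + 2) ^ 2))"
proof -
  define p1 where "p1 = CAsg 6 (EAdd (ELd (EN 0)) (EN 2)) ;; CAsg 2 (EN c) ;; CAsg 0 (EN 1)"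
  define b where "b = CAsg 0 (EAdd (EV 0) (EV 0))"
  define p2 where "p2 = CFor 3 6 (CFor 4 6 (CFor 5 2 b))"
  have "\<exists>k. runs (Seq (compile p1 7) (compile p2 7)) [d] k (2 ^ (c * (d + 2) ^ 2))" for d
  proof -
    let ?\<sigma> = "initial_state [d]"
    let ?\<sigma>1 = "sem p1 ?\<sigma>"
    have \<sigma>1: "fst ?\<sigma>1 6 = d + 2" "fst ?\<sigma>1 2 = c" "fst ?\<sigma>1 0 = 1"
      by (simp_all add: p1_def initial_state_def)
    have in1: "fst (sem (CFor 5 2 b) \<tau>) 0 = fst \<tau> 0 * 2 ^ c \<and> fst (sem (CFor 5 2 b) \<tau>) 2 = c \<and>
        fst (sem (CFor 5 2 b) \<tau>) 6 = d + 2" if "fst \<tau> 2 = c" "fst \<tau> 6 = d + 2" for \<tau>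
    proof -
      let ?I = "\<lambda>i. \<lambda>\<rho> :: state. fst \<rho> 0 = fst \<tau> 0 * 2 ^ i \<and> fst \<rho> 2 = c \<and> fst \<rho> 6 = d + 2"
      have "?I (fst \<tau> 2) (sem (CFor 5 2 b) \<tau>)"
        by (rule sem_For[where I = ?I]) (use that in \<open>auto simp: b_def\<close>)
      then show ?thesis unfolding that .
    qed
    have in2: "fst (sem (CFor 4 6 (CFor 5 2 b)) \<tau>) 0 = fst \<tau> 0 * 2 ^ (c * (d + 2)) \<and>
        fst (sem (CFor 4 6 (CFor 5 2 b)) \<tau>) 2 = c \<and> fst (sem (CFor 4 6 (CFor 5 2 b)) \<tau>) 6 = d + 2"
      if "fst \<tau> 2 = c" "fst \<tau> 6 = d + 2" for \<tau>
    proof -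
      let ?I = "\<lambda>i. \<lambda>\<rho> :: state. fst \<rho> 0 = fst \<tau> 0 * 2 ^ (c * i) \<and> fst \<rho> 2 = c \<and> fst \<rho> 6 = d + 2"
      have "?I (fst \<tau> 6) (sem (CFor 4 6 (CFor 5 2 b)) \<tau>)"
      proof (rule sem_For[where I = ?I])
        fix i \<rho> assume I: "?I i \<rho>"
        then have "fst (upd 4 i \<rho>) 2 = c" "fst (upd 4 i \<rho>) 6 = d + 2" by simp_all
        from in1[OF this] I show "?I (Suc i) (sem (CFor 5 2 b) (upd 4 i \<rho>))"
          by (simp add: power_add mult_ac del: sem.simps)
      qed (use that in auto)
      then show ?thesis unfolding that .
    qed
    let ?I = "\<lambda>i. \<lambda>\<rho> :: state. fst \<rho> 0 = 2 ^ (c * (d + 2) * i) \<and> fst \<rho> 2 = c \<and> fst \<rho> 6 = d + 2"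
    have "?I (fst ?\<sigma>1 6) (sem p2 ?\<sigma>1)"
      unfolding p2_def
    proof (rule sem_For[where I = ?I])
      fix i \<rho> assume I: "?I i \<rho>"
      then have "fst (upd 3 i \<rho>) 2 = c" "fst (upd 3 i \<rho>) 6 = d + 2" by simp_all
      from in2[OF this] I show "?I (Suc i) (sem (CFor 4 6 (CFor 5 2 b)) (upd 3 i \<rho>))"
        by (simp add: power_add mult_ac del: sem.simps)
    qed (use \<sigma>1 in auto)
    then have "fst (sem p2 ?\<sigma>1) 0 = 2 ^ (c * (d + 2) * (d + 2))" unfolding \<sigma>1 by blast
    then have out: "fst (sem p2 ?\<sigma>1) 0 = 2 ^ (c * (d + 2) ^ 2)"
      by (simp only: power2_eq_square mult.assoc)
    \<comment> \<open>Registers 0 to 6 are in use, so temporaries start at 7; as \<open>p1\<close>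
      has no loops, 0 is a valid loop bound.\<close>
    obtain k1 \<tau>1 where r1: "exec (compile p1 7) ?\<sigma> k1 \<tau>1" "simul 7 ?\<sigma>1 \<tau>1"
      by (rule run_compile[where c = p1 and K = 7 and \<sigma> = ?\<sigma> and \<rho> = ?\<sigma> and B = 0])
        (auto simp: p1_def simul_def)
    obtain k2 \<tau>2 where r2: "exec (compile p2 7) \<tau>1 k2 \<tau>2" "simul 7 (sem p2 ?\<sigma>1) \<tau>2"
      by (rule run_compile[OF _ _ _ r1(2), of p2 "c + d + 2"]) (use \<sigma>1 in \<open>auto simp: p2_def b_def\<close>)
    have "fst \<tau>2 0 = 2 ^ (c * (d + 2) ^ 2)" using r2(2) out by (simp add: simul_def)
    then show ?thesis using exec_Seq[OF r1(1) r2(1)] unfolding runs_def by blast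
  qed
  then show ?thesis unfolding computable_def by blast
qed

theorem theorem7p4:
  shows "\<exists>f :: nat \<Rightarrow> nat. computable f \<and>
    (\<exists>(p :: program) (a :: nat) (b :: nat).
      \<forall>(d :: nat) (G :: nat pair_pre_digraph) (vs :: nat list).
        1 \<le> d \<and> pair_graph G \<and> connected (with_proj G) \<and> distinct vs \<and> set vs = pverts G \<longrightarrow>
        (\<exists>k. runs p (encode d vs G) k (if has_sp_supergraph d G then 1 else 0) \<and>
             k \<le> f d * 2 ^ (a * max_degree G) * card (pverts G) ^ b))"
proof -
  obtain c h where cost: "\<And>B. sp_cost B \<le> c * (B + 1) ^ h" using sp_cost_poly by blast
  \<comment> \<open>With \<open>q = (d + 2) ^ 2\<close>, the factor \<open>2 ^ (c * q)\<close>
    absorbs the constant \<open>c\<close>, and \<open>2 ^ (7 * h * q)\<close> the part of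
    \<open>(bound + 1) ^ h\<close> that depends on \<open>d\<close> alone. The exponents
    \<open>2 * h\<close> below come from the square of \<open>weight_sum\<close> in
    \<open>bound\<close>.\<close>
  let ?f = "\<lambda>d. 2 ^ ((c + 7 * h) * (d + 2) ^ 2) :: nat"
  have "\<exists>k. runs sp_program (encode d vs G) k (if has_sp_supergraph d G then 1 else 0) \<and>
      k \<le> ?f d * 2 ^ (2 * h * max_degree G) * card (pverts G) ^ (2 * h)"
    if d: "1 \<le> d" and G: "pair_graph G" and conn: "connected (with_proj G)" and vs: "distinct vs" "set vs = pverts G"
    for d vs and G :: "nat pair_pre_digraph"
  proof -
    interpret dp_graph G vs d by (rule dp_graph.intro) (use d G vs in auto)
    let ?A = "\<lambda>i j. (vs ! i, vs ! j) \<in> parcs G"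
    interpret prog: dp_prog "length vs" d ?A
      using reach_universe card_reach[OF conn] by unfold_locales
    let ?\<sigma> = "initial_state (encode d vs G)"
    have "snd ?\<sigma> 0 = d" "snd ?\<sigma> 1 = length vs" by (simp_all add: initial_state_def encode_def)
    from prog.run_sp_program[OF this encode_nth[OF vs(1)]] obtain k \<tau> where
      k: "exec sp_program ?\<sigma> k \<tau>" "fst \<tau> 0 = of_bool (\<exists>x\<in>reach. accepting x)" "k \<le> sp_cost bound" by blast
    have "runs sp_program (encode d vs G) k (if has_sp_supergraph d G then 1 else 0)"
      unfolding runs_def using k(1,2) unfolding reach_iff_supergraph of_bool_def by blast
    moreover have "k \<le> ?f d * 2 ^ (2 * h * max_degree G) * card (pverts G) ^ (2 * h)"
    proof -
      let ?q = "(d + 2) ^ 2" and ?D = "max_degree G" and ?n = "length vs"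
      have "vs \<noteq> []" using conn vs(2) by (auto simp: connected_def strongly_connected_def)
      then have T: "weight_sum \<le> 3 * 2 ^ ?D * ?n" by (rule weight_sum_le)
      have q: "1 \<le> ?q" by simp
      have "bound + 1 \<le> 2 * bound" using bound_ge(1) by linarith
      also have "\<dots> \<le> 2 * ((3 * 2 ^ ?D * ?n) ^ 2 * 4 ^ ?q)"
        unfolding bound_def using T by (intro mult_left_mono mult_right_mono power_mono) auto
      \<comment> \<open>18 is \<open>2 * 3 ^ 2\<close>, the 3 being that of
        \<open>weight_sum_le\<close>. It is at most \<open>2 ^ (5 * q)\<close> as \<open>q\<close>
        is positive, and \<open>4 ^ q\<close> adds \<open>2 * q\<close> to the exponent; hence the
        7.\<close>
      also have "\<dots> = 18 * 4 ^ ?q * (2 ^ (2 * ?D) * ?n ^ 2)"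
        by (simp add: power_mult_distrib power_mult[symmetric] mult_ac)
      also have "\<dots> \<le> 2 ^ (7 * ?q) * (2 ^ (2 * ?D) * ?n ^ 2)"
      proof (rule mult_right_mono)
        have "18 \<le> (2::nat) ^ (5 * ?q)" using power_increasing[of 5 "5 * ?q" "2::nat"] q by simp
        then have "18 * 4 ^ ?q \<le> (2::nat) ^ (5 * ?q) * 2 ^ (2 * ?q)"
          unfolding power_mult[of 2 2] by (intro mult_mono) auto
        also have "\<dots> = 2 ^ (7 * ?q)" by (simp add: power_add[symmetric])
        finally show "18 * 4 ^ ?q \<le> (2::nat) ^ (7 * ?q)" .
      qed simp
      finally have "(bound + 1) ^ h \<le> (2 ^ (7 * ?q) * (2 ^ (2 * ?D) * ?n ^ 2)) ^ h" by (intro power_mono) auto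
      also have "\<dots> = 2 ^ (7 * h * ?q) * (2 ^ (2 * h * ?D) * ?n ^ (2 * h))"
        by (simp add: power_mult_distrib power_mult[symmetric] mult_ac)
      finally have B: "(bound + 1) ^ h \<le> 2 ^ (7 * h * ?q) * (2 ^ (2 * h * ?D) * ?n ^ (2 * h))" .
      have "c \<le> 2 ^ c" using less_exp[of c] by simp
      also have "\<dots> \<le> 2 ^ (c * ?q)" using q by (intro power_increasing) auto
      finally have "c * (bound + 1) ^ h \<le> 2 ^ (c * ?q) * (2 ^ (7 * h * ?q) * (2 ^ (2 * h * ?D) * ?n ^ (2 * h)))"
        using B by (rule mult_mono) auto
      also have "\<dots> = ?f d * 2 ^ (2 * h * ?D) * ?n ^ (2 * h)"
        by (simp only: power_add add_mult_distrib mult.assoc)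
      finally show ?thesis
        using k(3) cost[of bound] vs distinct_card[of vs] by simp
    qed
    ultimately show ?thesis by blast
  qed
  then show ?thesis using computable_exp_square[of "c + 7 * h"] by blast
qed

end
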